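(* Let $\Bbbk$ be a field of characteristic $0$ and $V$ an $n$-dimensional $\Bbbk$-vector space. The loci in $\mathrm{Alg}(V)$ where $\mathrm{rk}\, d_{\mu_x}$ is constant yield a finite determinantal stratification of $\mathrm{Alg}(V)$ into locally closed $\mathrm{GL}(V)$-stable subvarieties. The orbit stratification by isomorphism class refines this further. Over an algebraically closed field, the separable locus stratifies by block-size profiles $$V_x\cong\bigoplus_s M_{r_s}(\Bbbk)\qquad\text{with}\qquad\sum_s r_s^2=n,$$ while over a general field of characteristic $0$ the stratification (of the separable locus) is by Wedderburn types $V_x\cong\bigoplus_i M_{r_i}(D_i)$ with division algebras $D_i$. The open top stratum consists of separable algebras characterized by $\Delta(x)\neq0$.
   Context: Fix a basis $(e_i)_{i=1}^n$ of $V$. $V^{2,1}=\mathrm{Hom}(V\otimes V,V)\cong\Bbbk^{n^3}$; each $x\in V^{2,1}$ determines a bilinear product $\mu_x$ on $V$, and $V_x=(V,\mu_x)$. $\mathrm{Alg}(V)$ is the closed subscheme of $V^{2,1}$ of associative products, cut out by the $n^4$ quadratic polynomials in the structure constants expressing associativity. $\mathrm{GL}(V)$ acts by $(g\cdot\mu)(a,b)=g\,\mu(g^{-1}a,g^{-1}b)$, so orbits correspond to isomorphism classes of algebras. $d_{\mu_x}:C^2(V_x,V_x)\to C^3(V_x,V_x)$, with $C^p(V_x,V_x)=\mathrm{Hom}(V^{\otimes p},V)$, is the Hochschild differential of $V_x$, and $\mathrm{rk}\,d_{\mu_x}$ is its rank. For $x\in\mathrm{Alg}(V)$ let $L_z$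 be left multiplication by $z$ in $V_x$ and $\Delta(x)=\det(\mathrm{Tr}(L_{e_ie_j}))_{i,j}$ the discriminant of the principal trace form $T_x(a,b)=\mathrm{Tr}(L_{ab})$. The separable locus is $U=\{x\in\mathrm{Alg}(V):\Delta(x)\neq0\}$. *)

theory Defs
  imports
    "HOL-Library.Function_Algebras"
    "HOL-Library.Poly_Mapping"
    "HOL-Library.Disjoint_Sets"
    "HOL-Analysis.Abstract_Topology"
    "Jordan_Normal_Form.Determinant"
    "Jordan_Normal_Form.DL_Submatrix"
begin

text \<open>
  The vector space \<open>V\<close> is the whole type \<open>'v\<close> with scalar multiplication \<open>scale\<close>, and
  \<open>e 0, \<dots>, e (n - 1)\<close> is its fixed basis. Values \<open>e i\<close> with \<open>i \<ge> n\<close> are never used.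
\<close>

definition is_basis ::
  "('k::field \<Rightarrow> 'v::ab_group_add \<Rightarrow> 'v) \<Rightarrow> nat \<Rightarrow> (nat \<Rightarrow> 'v) \<Rightarrow> bool" where
  "is_basis scale n e \<longleftrightarrow>
     vector_space scale \<and> inj_on e {..<n} \<and>
     \<not> module.dependent scale (e ` {..<n}) \<and> module.span scale (e ` {..<n}) = UNIV"

definition coord ::
  "('k::field \<Rightarrow> 'v::ab_group_add \<Rightarrow> 'v) \<Rightarrow> nat \<Rightarrow> (nat \<Rightarrow> 'v) \<Rightarrow> nat \<Rightarrow> 'v \<Rightarrow> 'k" where
  "coord scale n e i v = module.representation scale (e ` {..<n}) v (e i)"

text \<open>
  By the universal property of the tensor product, \<open>Hom(V \<otimes> V, V)\<close> is the space of bilinear maps,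
  and \<open>Hom(V \<otimes> V \<otimes> V, V)\<close> that of trilinear maps. A point \<open>x\<close> of \<open>V21\<close> is thus identified with
  its product \<open>\<mu>\<^sub>x\<close>.
\<close>

definition V21 :: "('k::field \<Rightarrow> 'v::ab_group_add \<Rightarrow> 'v) \<Rightarrow> ('v \<Rightarrow> 'v \<Rightarrow> 'v) set" where
  "V21 scale = {x. (\<forall>a. Vector_Spaces.linear scale scale (\<lambda>b. x a b)) \<and>
                   (\<forall>b. Vector_Spaces.linear scale scale (\<lambda>a. x a b))}"

definition Alg :: "('k::field \<Rightarrow> 'v::ab_group_add \<Rightarrow> 'v) \<Rightarrow> ('v \<Rightarrow> 'v \<Rightarrow> 'v) set" where
  "Alg scale = {x \<in> V21 scale. \<forall>a b c. x (x a b) c = x a (x b c)}"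

definition GL :: "('k::field \<Rightarrow> 'v::ab_group_add \<Rightarrow> 'v) \<Rightarrow> ('v \<Rightarrow> 'v) set" where
  "GL scale = {g. Vector_Spaces.linear scale scale g \<and> bij g}"

definition act :: "('v \<Rightarrow> 'v) \<Rightarrow> ('v \<Rightarrow> 'v \<Rightarrow> 'v) \<Rightarrow> 'v \<Rightarrow> 'v \<Rightarrow> 'v" where
  "act g x = (\<lambda>a b. g (x (inv_into UNIV g a) (inv_into UNIV g b)))"

definition orbit ::
  "('k::field \<Rightarrow> 'v::ab_group_add \<Rightarrow> 'v) \<Rightarrow> ('v \<Rightarrow> 'v \<Rightarrow> 'v) \<Rightarrow> ('v \<Rightarrow> 'v \<Rightarrow> 'v) set" where
  "orbit scale x = (\<lambda>g. act g x) ` GL scale"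

definition GL_stable ::
  "('k::field \<Rightarrow> 'v::ab_group_add \<Rightarrow> 'v) \<Rightarrow> ('v \<Rightarrow> 'v \<Rightarrow> 'v) set \<Rightarrow> bool" where
  "GL_stable scale S \<longleftrightarrow> (\<forall>g \<in> GL scale. \<forall>x \<in> S. act g x \<in> S)"

text \<open>
  The indeterminate \<open>(i, j, k)\<close> stands for the coefficient of \<open>e k\<close> in the product of \<open>e i\<close> and
  \<open>e j\<close>; the superfluous indeterminates, with an index \<open>\<ge> n\<close>, are evaluated to \<open>0\<close>.
\<close>

type_synonym 'k sc_poly = "((nat \<times> nat \<times> nat) \<Rightarrow>\<^sub>0 nat) \<Rightarrow>\<^sub>0 'k"

definition struct_const ::
  "('k::field \<Rightarrow> 'v::ab_group_add \<Rightarrow> 'v) \<Rightarrow> nat \<Rightarrow> (nat \<Rightarrow> 'v) \<Rightarrow>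
   ('v \<Rightarrow> 'v \<Rightarrow> 'v) \<Rightarrow> nat \<times> nat \<times> nat \<Rightarrow> 'k" where
  "struct_const scale n e x =
     (\<lambda>(i, j, k). if i < n \<and> j < n \<and> k < n then coord scale n e k (x (e i) (e j)) else 0)"

definition sc_eval ::
  "('k::field \<Rightarrow> 'v::ab_group_add \<Rightarrow> 'v) \<Rightarrow> nat \<Rightarrow> (nat \<Rightarrow> 'v) \<Rightarrow>
   'k sc_poly \<Rightarrow> ('v \<Rightarrow> 'v \<Rightarrow> 'v) \<Rightarrow> 'k" where
  "sc_eval scale n e p x =
     (\<Sum>m \<in> Poly_Mapping.keys p. Poly_Mapping.lookup p m *
        (\<Prod>v \<in> Poly_Mapping.keys m. struct_const scale n e x v ^ Poly_Mapping.lookup m v))"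

text \<open>The principal open sets are a base of the Zariski topology on \<open>V21\<close>.\<close>

definition zariski ::
  "('k::field \<Rightarrow> 'v::ab_group_add \<Rightarrow> 'v) \<Rightarrow> nat \<Rightarrow> (nat \<Rightarrow> 'v) \<Rightarrow> ('v \<Rightarrow> 'v \<Rightarrow> 'v) topology" where
  "zariski scale n e =
     topology_generated_by (range (\<lambda>p. {x \<in> V21 scale. sc_eval scale n e p x \<noteq> 0}))"

definition zariski_Alg ::
  "('k::field \<Rightarrow> 'v::ab_group_add \<Rightarrow> 'v) \<Rightarrow> nat \<Rightarrow> (nat \<Rightarrow> 'v) \<Rightarrow> ('v \<Rightarrow> 'v \<Rightarrow> 'v) topology" where
  "zariski_Alg scale n e = subtopology (zariski scale n e) (Alg scale)"

definition locally_closed_in :: "'a topology \<Rightarrow> 'a set \<Rightarrow> bool" where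
  "locally_closed_in T S \<longleftrightarrow> (\<exists>W C. openin T W \<and> closedin T C \<and> S = W \<inter> C)"

definition stratification ::
  "('k::field \<Rightarrow> 'v::ab_group_add \<Rightarrow> 'v) \<Rightarrow> nat \<Rightarrow> (nat \<Rightarrow> 'v) \<Rightarrow>
   ('v \<Rightarrow> 'v \<Rightarrow> 'v) set \<Rightarrow> 'i set \<Rightarrow> ('i \<Rightarrow> ('v \<Rightarrow> 'v \<Rightarrow> 'v) set) \<Rightarrow> bool" where
  "stratification scale n e X I S \<longleftrightarrow>
     (\<Union>i \<in> I. S i) = X \<and> disjoint_family_on S I \<and>
     (\<forall>i \<in> I. S i \<noteq> {} \<and> locally_closed_in (zariski_Alg scale n e) (S i) \<and> GL_stable scale (S i))"

definition minors :: "nat \<Rightarrow> 'a::comm_ring_1 mat \<Rightarrow> 'a set" where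
  "minors r M = {det (submatrix M I J) | I J.
     I \<subseteq> {..<dim_row M} \<and> J \<subseteq> {..<dim_col M} \<and> card I = r \<and> card J = r}"

text \<open>
  The sets \<open>S r\<close> are the exact-rank loci, within \<open>X\<close>, of one matrix of polynomials in the
  structure constants.
\<close>

definition determinantal ::
  "('k::field \<Rightarrow> 'v::ab_group_add \<Rightarrow> 'v) \<Rightarrow> nat \<Rightarrow> (nat \<Rightarrow> 'v) \<Rightarrow>
   ('v \<Rightarrow> 'v \<Rightarrow> 'v) set \<Rightarrow> (nat \<Rightarrow> ('v \<Rightarrow> 'v \<Rightarrow> 'v) set) \<Rightarrow> bool" where
  "determinantal scale n e X S \<longleftrightarrow>
     (\<exists>M :: 'k sc_poly mat. \<forall>r.
        S r = {x \<in> X. (\<forall>f \<in> minors (Suc r) M. sc_eval scale n e f x = 0) \<and>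
                      (\<exists>f \<in> minors r M. sc_eval scale n e f x \<noteq> 0)})"

definition hochschild_d ::
  "('v::ab_group_add \<Rightarrow> 'v \<Rightarrow> 'v) \<Rightarrow> ('v \<Rightarrow> 'v \<Rightarrow> 'v) \<Rightarrow> 'v \<Rightarrow> 'v \<Rightarrow> 'v \<Rightarrow> 'v" where
  "hochschild_d x f = (\<lambda>a b c. x a (f b c) - f (x a b) c + f a (x b c) - x (f a b) c)"

definition rk_d :: "('k::field \<Rightarrow> 'v::ab_group_add \<Rightarrow> 'v) \<Rightarrow> ('v \<Rightarrow> 'v \<Rightarrow> 'v) \<Rightarrow> nat" where
  "rk_d scale x =
     vector_space.dim (\<lambda>t \<phi>. \<lambda>a b c. scale t (\<phi> a b c)) (hochschild_d x ` V21 scale)"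

definition rank_stratum ::
  "('k::field \<Rightarrow> 'v::ab_group_add \<Rightarrow> 'v) \<Rightarrow> nat \<Rightarrow> ('v \<Rightarrow> 'v \<Rightarrow> 'v) set" where
  "rank_stratum scale r = {x \<in> Alg scale. rk_d scale x = r}"

text \<open>
  An algebra here is a carrier, which is a subspace of some vector space, with a product on it.
  No unit is required: the products in \<open>Alg\<close> need not be unital.
\<close>

definition alg_iso ::
  "('k \<Rightarrow> 'a::ab_group_add \<Rightarrow> 'a) \<Rightarrow> 'a set \<Rightarrow> ('a \<Rightarrow> 'a \<Rightarrow> 'a) \<Rightarrow>
   ('k \<Rightarrow> 'b::ab_group_add \<Rightarrow> 'b) \<Rightarrow> 'b set \<Rightarrow> ('b \<Rightarrow> 'b \<Rightarrow> 'b) \<Rightarrow> bool" where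
  "alg_iso sA A mA sB B mB \<longleftrightarrow>
     (\<exists>\<phi>. bij_betw \<phi> A B \<and>
       (\<forall>a \<in> A. \<forall>b \<in> A. \<phi> (a + b) = \<phi> a + \<phi> b) \<and>
       (\<forall>t. \<forall>a \<in> A. \<phi> (sA t a) = sB t (\<phi> a)) \<and>
       (\<forall>a \<in> A. \<forall>b \<in> A. \<phi> (mA a b) = mB (\<phi> a) (\<phi> b)))"

definition iso_class ::
  "('k::field \<Rightarrow> 'v::ab_group_add \<Rightarrow> 'v) \<Rightarrow> ('v \<Rightarrow> 'v \<Rightarrow> 'v) \<Rightarrow> ('v \<Rightarrow> 'v \<Rightarrow> 'v) set" where
  "iso_class scale x = {y \<in> Alg scale. alg_iso scale UNIV x scale UNIV y}"

definition trace_map ::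
  "('k::field \<Rightarrow> 'v::ab_group_add \<Rightarrow> 'v) \<Rightarrow> nat \<Rightarrow> (nat \<Rightarrow> 'v) \<Rightarrow> ('v \<Rightarrow> 'v) \<Rightarrow> 'k" where
  "trace_map scale n e f = (\<Sum>i<n. coord scale n e i (f (e i)))"

text \<open>In \<open>x z\<close> below, \<open>z = x (e i) (e j)\<close>, so \<open>x z\<close> is the left multiplication by \<open>z\<close>.\<close>

definition discriminant ::
  "('k::field \<Rightarrow> 'v::ab_group_add \<Rightarrow> 'v) \<Rightarrow> nat \<Rightarrow> (nat \<Rightarrow> 'v) \<Rightarrow> ('v \<Rightarrow> 'v \<Rightarrow> 'v) \<Rightarrow> 'k" where
  "discriminant scale n e x =
     det (mat n n (\<lambda>(i, j). trace_map scale n e (x (x (e i) (e j)))))"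

definition separable_locus ::
  "('k::field \<Rightarrow> 'v::ab_group_add \<Rightarrow> 'v) \<Rightarrow> nat \<Rightarrow> (nat \<Rightarrow> 'v) \<Rightarrow> ('v \<Rightarrow> 'v \<Rightarrow> 'v) set" where
  "separable_locus scale n e = {x \<in> Alg scale. discriminant scale n e x \<noteq> 0}"

text \<open>
  An algebra is separable if it is associative and unital and has a separability idempotent
  \<open>p = (\<Sum>s. b\<^sub>s \<otimes> c\<^sub>s)\<close> in \<open>V \<otimes> V\<close>: the multiplication sends \<open>p\<close> to the unit, and
  \<open>(\<Sum>s. a b\<^sub>s \<otimes> c\<^sub>s) = (\<Sum>s. b\<^sub>s \<otimes> c\<^sub>s a)\<close> for all \<open>a\<close>. Equality of two elements of \<open>V \<otimes> V\<close> is
  equality of their images under all bilinear forms \<open>\<beta>\<close>.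
\<close>

definition separable_algebra ::
  "('k::field \<Rightarrow> 'v::ab_group_add \<Rightarrow> 'v) \<Rightarrow> ('v \<Rightarrow> 'v \<Rightarrow> 'v) \<Rightarrow> bool" where
  "separable_algebra scale x \<longleftrightarrow> x \<in> Alg scale \<and>
     (\<exists>u. (\<forall>a. x u a = a \<and> x a u = a) \<and>
       (\<exists>p :: ('v \<times> 'v) list.
          (\<Sum>(b, c) \<leftarrow> p. x b c) = u \<and>
          (\<forall>a. \<forall>\<beta> :: 'v \<Rightarrow> 'v \<Rightarrow> 'k.
             (\<forall>b. Vector_Spaces.linear scale (*) (\<lambda>c. \<beta> b c)) \<and>
             (\<forall>c. Vector_Spaces.linear scale (*) (\<lambda>b. \<beta> b c)) \<longrightarrow>
             (\<Sum>(b, c) \<leftarrow> p. \<beta> (x a b) c) = (\<Sum>(b, c) \<leftarrow> p. \<beta> b (x c a)))))"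

text \<open>
  A block \<open>(r, D, m)\<close> stands for the algebra of \<open>r \<times> r\<close> matrices over the algebra with carrier
  \<open>D\<close> and product \<open>m\<close>. An element \<open>A\<close> of the direct sum over a list of blocks has the entry
  \<open>A s i j\<close> in row \<open>i\<close> and column \<open>j\<close> of its \<open>s\<close>-th block, and \<open>0\<close> outside the blocks.
\<close>

type_synonym 'd block = "nat \<times> 'd set \<times> ('d \<Rightarrow> 'd \<Rightarrow> 'd)"

definition blk_size :: "'d block \<Rightarrow> nat" where "blk_size = fst"
definition blk_carrier :: "'d block \<Rightarrow> 'd set" where "blk_carrier = fst \<circ> snd"
definition blk_mult :: "'d block \<Rightarrow> 'd \<Rightarrow> 'd \<Rightarrow> 'd" where "blk_mult = snd \<circ> snd"

definition in_blocks :: "'d block list \<Rightarrow> nat \<Rightarrow> nat \<Rightarrow> nat \<Rightarrow> bool" where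
  "in_blocks bs s i j \<longleftrightarrow> s < length bs \<and> i < blk_size (bs ! s) \<and> j < blk_size (bs ! s)"

definition matsum_carrier :: "'d::ab_group_add block list \<Rightarrow> (nat \<Rightarrow> nat \<Rightarrow> nat \<Rightarrow> 'd) set" where
  "matsum_carrier bs =
     {A. \<forall>s i j. (in_blocks bs s i j \<longrightarrow> A s i j \<in> blk_carrier (bs ! s)) \<and>
                 (\<not> in_blocks bs s i j \<longrightarrow> A s i j = 0)}"

definition matsum_scale ::
  "('k \<Rightarrow> 'd \<Rightarrow> 'd) \<Rightarrow> 'k \<Rightarrow> (nat \<Rightarrow> nat \<Rightarrow> nat \<Rightarrow> 'd) \<Rightarrow> nat \<Rightarrow> nat \<Rightarrow> nat \<Rightarrow> 'd" where
  "matsum_scale sD t A = (\<lambda>s i j. sD t (A s i j))"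

definition matsum_mult ::
  "'d::ab_group_add block list \<Rightarrow> (nat \<Rightarrow> nat \<Rightarrow> nat \<Rightarrow> 'd) \<Rightarrow> (nat \<Rightarrow> nat \<Rightarrow> nat \<Rightarrow> 'd) \<Rightarrow>
   nat \<Rightarrow> nat \<Rightarrow> nat \<Rightarrow> 'd" where
  "matsum_mult bs A B = (\<lambda>s i j.
     if in_blocks bs s i j
     then (\<Sum>l<blk_size (bs ! s). blk_mult (bs ! s) (A s i l) (B s l j)) else 0)"

definition is_alg_closed :: "'k::field itself \<Rightarrow> bool" where
  "is_alg_closed (_ :: 'k itself) \<longleftrightarrow> (\<forall>p :: 'k poly. degree p > 0 \<longrightarrow> (\<exists>t. poly p t = 0))"

definition profiles :: "nat \<Rightarrow> nat multiset set" where
  "profiles n = {\<rho>. 0 \<notin># \<rho> \<and> (\<Sum>r \<in># \<rho>. r\<^sup>2) = n}"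

definition scalar_blocks :: "nat list \<Rightarrow> 'k::field block list" where
  "scalar_blocks rs = map (\<lambda>r. (r, UNIV, (*))) rs"

definition profile_stratum ::
  "('k::field \<Rightarrow> 'v::ab_group_add \<Rightarrow> 'v) \<Rightarrow> nat multiset \<Rightarrow> ('v \<Rightarrow> 'v \<Rightarrow> 'v) set" where
  "profile_stratum scale \<rho> =
     {x \<in> Alg scale. \<exists>rs. mset rs = \<rho> \<and>
        alg_iso scale UNIV x
          (matsum_scale (*)) (matsum_carrier (scalar_blocks rs :: 'k block list))
          (matsum_mult (scalar_blocks rs))}"

text \<open>
  Up to isomorphism a finite-dimensional algebra lives on some \<open>k\<^sup>d\<close>, realised as the functions
  \<open>nat \<Rightarrow> 'k\<close> that vanish from \<open>d\<close> on. Addition of functions is pointwise.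
\<close>

definition kspace :: "nat \<Rightarrow> (nat \<Rightarrow> 'k::field) set" where
  "kspace d = {v. \<forall>i \<ge> d. v i = 0}"

definition kscale :: "'k::field \<Rightarrow> (nat \<Rightarrow> 'k) \<Rightarrow> nat \<Rightarrow> 'k" where
  "kscale t v = (\<lambda>i. t * v i)"

definition division_algebra :: "nat \<Rightarrow> ((nat \<Rightarrow> 'k::field) \<Rightarrow> (nat \<Rightarrow> 'k) \<Rightarrow> (nat \<Rightarrow> 'k)) \<Rightarrow> bool" where
  "division_algebra d m \<longleftrightarrow>
     (\<forall>a \<in> kspace d. \<forall>b \<in> kspace d. m a b \<in> kspace d) \<and>
     (\<forall>a \<in> kspace d. \<forall>b \<in> kspace d. \<forall>c \<in> kspace d.
        m (a + b) c = m a c + m b c \<and> m a (b + c) = m a b + m a c \<and> m (m a b) c = m a (m b c)) \<and>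
     (\<forall>t. \<forall>a \<in> kspace d. \<forall>b \<in> kspace d.
        m (kscale t a) b = kscale t (m a b) \<and> m a (kscale t b) = kscale t (m a b)) \<and>
     (\<exists>u \<in> kspace d. u \<noteq> 0 \<and> (\<forall>a \<in> kspace d. m u a = a \<and> m a u = a) \<and>
        (\<forall>a \<in> kspace d. a \<noteq> 0 \<longrightarrow> (\<exists>b \<in> kspace d. m a b = u \<and> m b a = u)))"

type_synonym 'k wtype = "(nat \<times> nat \<times> ((nat \<Rightarrow> 'k) \<Rightarrow> (nat \<Rightarrow> 'k) \<Rightarrow> (nat \<Rightarrow> 'k))) list"

text \<open>
  The list entry \<open>(r, d, m)\<close> stands for the summand \<open>M\<^sub>r(D)\<close> with \<open>D = (k\<^sup>d, m)\<close>, of dimension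
  \<open>r\<^sup>2 d\<close>. Lists that differ by a permutation and by isomorphisms of the division algebras
  represent the same Wedderburn type.
\<close>

definition wtypes :: "nat \<Rightarrow> 'k::field wtype set" where
  "wtypes n = {W. (\<forall>(r, d, m) \<in> set W. r > 0 \<and> division_algebra d m) \<and>
                  (\<Sum>(r, d, m) \<leftarrow> W. r\<^sup>2 * d) = n}"

definition same_wtype :: "'k::field wtype \<Rightarrow> 'k wtype \<Rightarrow> bool" where
  "same_wtype W W' \<longleftrightarrow>
     rel_mset (\<lambda>(r, d, m) (r', d', m'). r = r' \<and>
         alg_iso kscale (kspace d) m kscale (kspace d') m')
       (mset W) (mset W')"

definition wtype_blocks :: "'k::field wtype \<Rightarrow> (nat \<Rightarrow> 'k) block list" where
  "wtype_blocks W = map (\<lambda>(r, d, m). (r, kspace d, m)) W"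

definition wedderburn_stratum ::
  "('k::field \<Rightarrow> 'v::ab_group_add \<Rightarrow> 'v) \<Rightarrow> 'k wtype \<Rightarrow> ('v \<Rightarrow> 'v \<Rightarrow> 'v) set" where
  "wedderburn_stratum scale W =
     {x \<in> Alg scale.
        alg_iso scale UNIV x
          (matsum_scale kscale) (matsum_carrier (wtype_blocks W)) (matsum_mult (wtype_blocks W))}"

end

(*
  A point x is separable iff its trace form is nondegenerate, iff V_x is unital and von Neumann
  regular (every y has a z with yzy = y): dual bases of the trace form give a separability
  idempotent; averaging projections with it makes every left ideal A y = A f with f idempotent;
  and the trace form cannot vanish on a nonzero idempotent in characteristic 0.  Regularity splits
  the unit into idempotents with division corners, and linking those with f A f' nonzero produces
  systems of matrix units, called frames below.  Frames are the same as isomorphisms onto sums of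
  matrix algebras, and two frames of one algebra are matched by the links between their corners,
  the block sizes being ratios of traces; this is Wedderburn's theorem with uniqueness.  Over an
  algebraically closed field all corners are trivial and the element sum e_i e_j e^i e^j acts on
  M_r(k) as 1 / r^2, so traces of polynomials in it make each profile stratum closed in the
  separable locus.  The rank strata are cut out by the minors of the matrix of the Hochschild
  differential.
*)

theory Submission
  imports Defs "HOL-Combinatorics.List_Permutation" "Jordan_Normal_Form.Char_Poly"
begin

subsection \<open>Traces\<close>

text \<open>Products in \<open>Alg\<close> carry no unit, so the unit has to come out of the
  nondegenerate trace form: it is the sum of e_i e^i, the element representing the functional
  \<open>trL\<close>. Characteristic 0 acts mainly through one device: the trace of an idempotent
  operator is its rank, so ranks are added, compared and used as induction measures inside the
  field. The value 1 / r^2 has this origin. On M_r(k) the trace of left multiplication is r times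
  the matrix trace, so the units E_ij have the dual basis E_ji / r. The sum of e_i v e^i sends E_kl
  to the identity divided by r if k = l and to 0 otherwise; the second summation in e_i e_j e^i e^j
  contributes another 1 / r. Distinct sizes give distinct values, so the product of the factors z -
  1 / q^2 over all sizes q other than p isolates the blocks of size p, and its trace counts them.
  Dual bases have the discriminant as denominator; multiplying it away keeps everything polynomial
  and does no harm where it is nonzero.\<close>

locale based_space =
  fixes scale :: "'k::field_char_0 \<Rightarrow> 'v::ab_group_add \<Rightarrow> 'v" and n :: nat and e :: "nat \<Rightarrow> 'v"
  assumes basis: "is_basis scale n e"
begin

sublocale vector_space scale
  using basis by (simp add: is_basis_def)

sublocale fin: finite_dimensional_vector_space scale "e ` {..<n}"
  using basis by unfold_locales (auto simp: is_basis_def)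

abbreviation crd :: "nat \<Rightarrow> 'v \<Rightarrow> 'k" where "crd \<equiv> coord scale n e"
abbreviation lin :: "('v \<Rightarrow> 'v) \<Rightarrow> bool" where "lin \<equiv> Vector_Spaces.linear scale scale"
abbreviation linf :: "('v \<Rightarrow> 'k) \<Rightarrow> bool" where "linf \<equiv> Vector_Spaces.linear scale (*)"
abbreviation tr :: "('v \<Rightarrow> 'v) \<Rightarrow> 'k" where "tr \<equiv> trace_map scale n e"

abbreviation \<Delta> :: "('v \<Rightarrow> 'v \<Rightarrow> 'v) \<Rightarrow> 'k" where "\<Delta> \<equiv> discriminant scale n e"
abbreviation locus :: "('v \<Rightarrow> 'v \<Rightarrow> 'v) set" where "locus \<equiv> separable_locus scale n e"
abbreviation zariskiA :: "('v \<Rightarrow> 'v \<Rightarrow> 'v) topology" where "zariskiA \<equiv> zariski_Alg scale n e"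
abbreviation ev :: "'k sc_poly \<Rightarrow> ('v \<Rightarrow> 'v \<Rightarrow> 'v) \<Rightarrow> 'k" where "ev \<equiv> sc_eval scale n e"
abbreviation wstratum :: "'k wtype \<Rightarrow> ('v \<Rightarrow> 'v \<Rightarrow> 'v) set" where
  "wstratum \<equiv> wedderburn_stratum scale"
abbreviation pstratum :: "nat multiset \<Rightarrow> ('v \<Rightarrow> 'v \<Rightarrow> 'v) set" where
  "pstratum \<equiv> profile_stratum scale"
abbreviation rstratum :: "nat \<Rightarrow> ('v \<Rightarrow> 'v \<Rightarrow> 'v) set" where "rstratum \<equiv> rank_stratum scale"

lemma inj_e: "inj_on e {..<n}"
  using basis by (simp add: is_basis_def)

lemma vs_mult: "vector_space ((*) :: 'k \<Rightarrow> 'k \<Rightarrow> 'k)"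
  by unfold_locales (auto simp: algebra_simps)

lemma linI: "(\<And>a b. f (a + b) = f a + f b) \<Longrightarrow> (\<And>t a. f (scale t a) = scale t (f a)) \<Longrightarrow> lin f"
  by (simp add: Vector_Spaces.linear_iff vector_space_axioms)

lemma linfI: "(\<And>a b. f (a + b) = f a + f b) \<Longrightarrow> (\<And>t a. f (scale t a) = t * f a) \<Longrightarrow> linf f"
  by (simp add: Vector_Spaces.linear_iff vector_space_axioms vs_mult)

lemma lin_add: "lin f \<Longrightarrow> f (a + b) = f a + f b"
  and lin_scale: "lin f \<Longrightarrow> f (scale t a) = scale t (f a)"
  by (simp_all add: Vector_Spaces.linear_iff)

lemma lin_zero: "lin f \<Longrightarrow> f 0 = 0"
  using lin_scale[of f 0 0] by simp

lemma lin_sum: "lin f \<Longrightarrow> f (\<Sum>i\<in>I. g i) = (\<Sum>i\<in>I. f (g i))"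
  by (induction I rule: infinite_finite_induct) (auto simp: lin_zero lin_add)

lemma linf_add: "linf f \<Longrightarrow> f (a + b) = f a + f b"
  and linf_scale: "linf f \<Longrightarrow> f (scale t a) = t * f a"
  by (simp_all add: Vector_Spaces.linear_iff)

lemma linf_zero: "linf f \<Longrightarrow> f 0 = 0"
  using linf_scale[of f 0 0] by simp

lemma linf_sum: "linf f \<Longrightarrow> f (\<Sum>i\<in>I. g i) = (\<Sum>i\<in>I. f (g i))"
  by (induction I rule: infinite_finite_induct) (auto simp: linf_zero linf_add)

lemma linf_lin: "linf \<phi> \<Longrightarrow> lin f \<Longrightarrow> linf (\<lambda>w. \<phi> (f w))"
  by (auto intro!: linfI simp: lin_add lin_scale linf_add linf_scale)

lemma linf_crd: "linf (crd i)"
  unfolding coord_def[abs_def]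
  by (rule linear_representation) (use fin.independent_Basis fin.span_Basis in auto)

lemmas crd_add = linf_add[OF linf_crd]
  and crd_scale = linf_scale[OF linf_crd]
  and crd_zero = linf_zero[OF linf_crd]
  and crd_sum = linf_sum[OF linf_crd]

lemma crd_e: "i < n \<Longrightarrow> j < n \<Longrightarrow> crd i (e j) = (if i = j then 1 else 0)"
  using inj_e by (auto simp: coord_def representation_basis fin.independent_Basis inj_on_def)

lemma expand: "v = (\<Sum>i<n. scale (crd i v) (e i))"
proof -
  have "(\<Sum>b\<in>e ` {..<n}. scale (representation (e ` {..<n}) v b) b) = v"
    by (rule sum_representation_eq) (auto simp: fin.independent_Basis fin.span_Basis)
  then show ?thesis
    by (simp add: sum.reindex[OF inj_e] coord_def)
qed

lemma crd_eqI: "(\<And>i. i < n \<Longrightarrow> crd i v = crd i w) \<Longrightarrow> v = w"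
  by (subst expand, subst (2) expand) simp

lemma lin_eqI: "lin f \<Longrightarrow> lin g \<Longrightarrow> (\<And>i. i < n \<Longrightarrow> f (e i) = g (e i)) \<Longrightarrow> f v = g v"
  by (subst (1 2) expand) (simp add: lin_sum lin_scale)

lemma tr_cong: "(\<And>v. f v = g v) \<Longrightarrow> tr f = tr g"
  by (simp add: trace_map_def)

lemma tr_sum: "tr (\<lambda>w. \<Sum>i\<in>I. f i w) = (\<Sum>i\<in>I. tr (f i))"
  by (simp add: trace_map_def crd_sum sum.swap[of _ "{..<n}"])

lemma tr_add: "tr (\<lambda>w. f w + g w) = tr f + tr g"
  by (simp add: trace_map_def crd_add sum.distrib)

lemma tr_scale: "tr (\<lambda>w. scale t (f w)) = t * tr f"
  by (simp add: trace_map_def crd_scale sum_distrib_left)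

lemma tr_rank_one: "linf \<phi> \<Longrightarrow> tr (\<lambda>w. scale (\<phi> w) v) = \<phi> v"
proof -
  assume "linf \<phi>"
  then have "\<phi> v = (\<Sum>i<n. crd i v * \<phi> (e i))"
    by (subst expand) (simp add: linf_sum linf_scale)
  then show ?thesis
    by (simp add: trace_map_def crd_scale mult.commute)
qed

text \<open>The reproducing identity writes \<open>f\<close> as the sum of the rank one maps sending
  \<open>w\<close> to \<open>scale (\<phi> i w) (f (v i))\<close>. A trace can thus be read off in
  whatever coordinates are at hand; later the matrix units of a frame serve as
  \<open>v\<close>.\<close>

lemma tr_decomp:
  assumes "\<And>i. i \<in> I \<Longrightarrow> linf (\<phi> i)" "\<And>w. w = (\<Sum>i\<in>I. scale (\<phi> i w) (v i))" "lin f"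
  shows "tr f = (\<Sum>i\<in>I. \<phi> i (f (v i)))"
proof -
  have "tr f = tr (\<lambda>w. \<Sum>i\<in>I. scale (\<phi> i w) (f (v i)))"
    by (rule tr_cong, subst assms(2), simp add: lin_sum lin_scale assms(3))
  also have "\<dots> = (\<Sum>i\<in>I. \<phi> i (f (v i)))"
    by (simp add: tr_sum tr_rank_one assms(1))
  finally show ?thesis .
qed

lemma tr_comm:
  assumes "lin f" "lin g"
  shows "tr (\<lambda>v. f (g v)) = tr (\<lambda>v. g (f v))"
proof -
  have "tr (\<lambda>v. f (g v)) = tr (\<lambda>v. \<Sum>i<n. scale (crd i (g v)) (f (e i)))"
    by (rule tr_cong, subst (1) expand) (simp add: lin_sum lin_scale assms)
  also have "\<dots> = tr (\<lambda>v. g (f v))"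
    by (simp add: tr_sum tr_rank_one linf_lin[OF linf_crd] assms)
       (simp add: trace_map_def)
  finally show ?thesis .
qed

lemma tr_id: "tr (\<lambda>v. v) = of_nat n"
  by (simp add: trace_map_def crd_e)

text \<open>The coordinate functionals are defined on all of V, by extending a basis of
  \<open>W\<close>. Being globally linear, they can enter traces and rank one maps.\<close>

lemma subspace_coords:
  assumes "subspace W"
  obtains d :: nat and b \<phi> where "\<And>i. i < d \<Longrightarrow> linf (\<phi> i)" "\<And>i. i < d \<Longrightarrow> b i \<in> W"
    "\<And>i j. i < d \<Longrightarrow> j < d \<Longrightarrow> \<phi> i (b j) = (if i = j then 1 else 0)"
    "\<And>w. w \<in> W \<Longrightarrow> w = (\<Sum>i<d. scale (\<phi> i w) (b i))"
proof -
  obtain B where B: "B \<subseteq> W" "independent B" "W \<subseteq> span B"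
    by (rule basis_exists[of W])
  have "finite B"
    using B(2) by (rule fin.finiteI_independent)
  let ?E = "extend_basis B"
  have E: "B \<subseteq> ?E" "independent ?E" "span ?E = UNIV"
    using B(2) by (auto simp: extend_basis_superset independent_extend_basis span_extend_basis)
  obtain h where h: "bij_betw h {..<card B} B"
    using ex_bij_betw_nat_finite[OF \<open>finite B\<close>] by (auto simp: atLeast0LessThan)
  show ?thesis
  proof
    show "linf (\<lambda>w. representation ?E w (h i))" for i
      by (rule linear_representation) (use E in auto)
    show "h i \<in> W" if "i < card B" for i
      using h that B(1) by (auto simp: bij_betw_def)
    show "representation ?E (h j) (h i) = (if i = j then 1 else 0)"
      if "i < card B" "j < card B" for i j
    proof -
      have "h j \<in> ?E"
        using h that E(1) by (auto simp: bij_betw_def)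
      then show ?thesis
        using h that E by (auto simp: representation_basis bij_betw_def inj_on_def)
    qed
    show "w = (\<Sum>i<card B. scale (representation ?E w (h i)) (h i))" if "w \<in> W" for w
    proof -
      have w: "w \<in> span B" using that B by auto
      have "representation ?E w = representation B w"
        using representation_extend E w by blast
      moreover have "(\<Sum>b\<in>B. scale (representation B w b) b) = w"
        by (rule sum_representation_eq) (use B w \<open>finite B\<close> in auto)
      ultimately show ?thesis
        by (simp add: sum.reindex_bij_betw[OF h, of "\<lambda>b. scale (representation B w b) b"])
    qed
  qed
qed

text \<open>On its range \<open>f\<close> is the identity, so in coordinates of the range the trace
  counts basis vectors. In characteristic 0 this field element determines the rank
  \<open>d\<close>.\<close>

lemma tr_idem:
  assumes "lin f" "\<And>v. f (f v) = f v"
  shows "\<exists>d. tr f = of_nat d \<and> (d = 0 \<longleftrightarrow> (\<forall>v. f v = 0))"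
proof -
  have "subspace (range f)"
  proof (rule subspaceI)
    show "0 \<in> range f"
      by (rule range_eqI[where x = 0]) (simp add: lin_zero assms(1))
    show "x + y \<in> range f" if "x \<in> range f" "y \<in> range f" for x y
      using that by (auto simp: lin_add[OF assms(1), symmetric])
    show "scale c x \<in> range f" if "x \<in> range f" for c x
      using that by (auto simp: lin_scale[OF assms(1), symmetric])
  qed
  then obtain d :: nat and b \<phi> where *: "\<And>i. i < d \<Longrightarrow> linf (\<phi> i)" "\<And>i. i < d \<Longrightarrow> b i \<in> range f"
    "\<And>i j. i < d \<Longrightarrow> j < d \<Longrightarrow> \<phi> i (b j) = (if i = j then 1 else 0)"
    "\<And>w. w \<in> range f \<Longrightarrow> w = (\<Sum>i<d. scale (\<phi> i w) (b i))"
    by (rule subspace_coords) blast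
  have fb: "f (b i) = b i" if "i < d" for i
    using *(2)[OF that] assms(2) by auto
  have "tr f = tr (\<lambda>w. \<Sum>i<d. scale (\<phi> i (f w)) (b i))"
    by (rule tr_cong) (rule *(4), simp)
  also have "\<dots> = (\<Sum>i<d. \<phi> i (f (b i)))"
    by (simp add: tr_sum tr_rank_one linf_lin *(1) assms(1))
  also have "\<dots> = of_nat d"
    by (simp add: fb *(3))
  finally have "tr f = of_nat d" .
  moreover have "d = 0 \<longleftrightarrow> (\<forall>v. f v = 0)"
  proof
    assume "d = 0"
    then show "\<forall>v. f v = 0" using *(4) by auto
  next
    assume f0: "\<forall>v. f v = 0"
    show "d = 0"
    proof (rule ccontr)
      assume "d \<noteq> 0"
      then have "b 0 = 0" "\<phi> 0 (b 0) = 1" "linf (\<phi> 0)"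
        using *(1,2)[of 0] *(3)[of 0 0] f0 by auto
      then show False using linf_zero by fastforce
    qed
  qed
  ultimately show ?thesis by blast
qed

end

context based_space
begin

lemma subspace_range: "lin f \<Longrightarrow> subspace (range f)"
proof (rule subspaceI)
  assume f: "lin f"
  show "0 \<in> range f" by (rule range_eqI[where x = 0]) (simp add: lin_zero f)
  show "a + b \<in> range f" if "a \<in> range f" "b \<in> range f" for a b
    using that by (auto simp: lin_add[OF f, symmetric])
  show "scale t a \<in> range f" if "a \<in> range f" for t a
    using that by (auto simp: lin_scale[OF f, symmetric])
qed

text \<open>The basis dual to \<open>e\<close> under the trace form, multiplied by the discriminant: by the adjugate,
  its coordinates are polynomials in the structure constants.\<close>

definition edual :: "('v \<Rightarrow> 'v \<Rightarrow> 'v) \<Rightarrow> nat \<Rightarrow> 'v" where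
  "edual x j = (\<Sum>k<n. scale (adj_mat (mat n n (\<lambda>(i, j). tr (x (x (e i) (e j))))) $$ (k, j)) (e k))"

lemma linf_diff: "linf f \<Longrightarrow> f (a - b) = f a - f b"
  using linf_add[of f "a - b" b] by simp

end

subsection \<open>The trace form\<close>

locale based_algebra = based_space scale n e
  for scale :: "'k::field_char_0 \<Rightarrow> 'v::ab_group_add \<Rightarrow> 'v" and n :: nat and e :: "nat \<Rightarrow> 'v" +
  fixes x :: "'v \<Rightarrow> 'v \<Rightarrow> 'v" (infixl "\<cdot>" 70)
  assumes alg: "x \<in> Alg scale"
begin

definition trL :: "'v \<Rightarrow> 'k" where "trL a = tr (\<lambda>v. a \<cdot> v)"

abbreviation T :: "'v \<Rightarrow> 'v \<Rightarrow> 'k" where "T a b \<equiv> trL (a \<cdot> b)"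

lemma lin_l: "lin (\<lambda>v. a \<cdot> v)" and lin_r: "lin (\<lambda>v. v \<cdot> a)"
  using alg by (auto simp: Alg_def V21_def)

lemma assoc: "a \<cdot> b \<cdot> c = a \<cdot> (b \<cdot> c)"
  using alg by (auto simp: Alg_def)

lemmas mult_add_l = lin_add[OF lin_r] and mult_add_r = lin_add[OF lin_l]
  and mult_scale_l = lin_scale[OF lin_r] and mult_scale_r = lin_scale[OF lin_l]
  and mult_zero_l [simp] = lin_zero[OF lin_r] and mult_zero_r [simp] = lin_zero[OF lin_l]
  and mult_sum_l = lin_sum[OF lin_r] and mult_sum_r = lin_sum[OF lin_l]

lemma mult_minus_l: "(- a) \<cdot> b = - (a \<cdot> b)"
  using mult_scale_l[of "-1" a b] by simp

lemma mult_minus_r: "a \<cdot> (- b) = - (a \<cdot> b)"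
  using mult_scale_r[of a "-1" b] by simp

lemma mult_diff_l: "(a - b) \<cdot> c = a \<cdot> c - b \<cdot> c"
  using mult_add_l[of a "- b" c] by (simp add: mult_minus_l)

lemma mult_diff_r: "a \<cdot> (b - c) = a \<cdot> b - a \<cdot> c"
  using mult_add_r[of a b "- c"] by (simp add: mult_minus_r)

lemmas mult_distrib = mult_add_l mult_add_r mult_scale_l mult_scale_r mult_minus_l mult_minus_r
  mult_diff_l mult_diff_r

text \<open>By associativity left multiplication by a product is a composition, so symmetry is the
  commutation rule for traces.\<close>

lemma T_sym: "T a b = T b a"
  using tr_comm[OF lin_l lin_l, of a b] by (simp add: trL_def assoc)

lemma linf_trL: "linf trL"
  by (rule linfI) (simp_all add: trL_def mult_add_l tr_add mult_scale_l tr_scale)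

lemma linf_T: "linf (\<lambda>b. T a b)" "linf (\<lambda>a. T a b)"
  using linf_lin[OF linf_trL lin_l] linf_lin[OF linf_trL lin_r] by auto

lemma disc_mat: "\<Delta> x = det (mat n n (\<lambda>(i, j). T (e i) (e j)))"
  by (simp add: discriminant_def trL_def)

text \<open>\<open>\<Delta> x\<close> is the Gram determinant of \<open>T\<close> in the basis
  \<open>e\<close>, and the kernel of the Gram matrix consists of the coordinate vectors of the
  radical of \<open>T\<close>.\<close>

lemma disc_nonzero_iff:
  "\<Delta> x \<noteq> 0 \<longleftrightarrow> (\<forall>a. (\<forall>b. T a b = 0) \<longrightarrow> a = 0)"
proof -
  let ?G = "mat n n (\<lambda>(i, j). T (e i) (e j))"
  have G: "?G \<in> carrier_mat n n" by simp
  have ker: "?G *\<^sub>v vec n c = vec n (\<lambda>i. T (e i) (\<Sum>j<n. scale (c j) (e j)))" for c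
    by (intro eq_vecI)
       (auto simp: scalar_prod_def linf_sum[OF linf_T(1)] linf_scale[OF linf_T(1)] mult.commute
         lessThan_atLeast0)
  have rad: "(\<forall>b. T a b = 0) \<longleftrightarrow> (\<forall>i<n. T (e i) a = 0)" for a
  proof safe
    show "T (e i) a = 0" if "\<forall>b. T a b = 0" for i using that T_sym by metis
    fix b
    assume *: "\<forall>i<n. T (e i) a = 0"
    have "T b a = (\<Sum>i<n. crd i b * T (e i) a)"
      by (subst expand[of b]) (simp add: linf_sum[OF linf_T(2)] linf_scale[OF linf_T(2)])
    then show "T a b = 0" using * by (subst T_sym) simp
  qed
  show ?thesis
  proof (cases "\<Delta> x = 0")
    case True
    then obtain v where v: "v \<in> carrier_vec n" "v \<noteq> 0\<^sub>v n" "?G *\<^sub>v v = 0\<^sub>v n"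
      using det_0_iff_vec_prod_zero_field[OF G] by (auto simp: disc_mat)
    define a where "a = (\<Sum>j<n. scale (v $ j) (e j))"
    have v': "v = vec n (\<lambda>j. v $ j)" using v(1) by auto
    have "vec n (\<lambda>i. T (e i) a) = 0\<^sub>v n"
      using v(3) ker[of "\<lambda>j. v $ j"] v' by (simp add: a_def)
    then have "\<forall>i<n. T (e i) a = 0"
      by (metis index_vec index_zero_vec(1))
    moreover have "a \<noteq> 0"
    proof
      assume "a = 0"
      have "v $ i = crd i a" if "i < n" for i
        using that by (simp add: a_def crd_sum crd_scale crd_e if_distrib cong: if_cong)
      then have "v = 0\<^sub>v n" using v(1) \<open>a = 0\<close> by (intro eq_vecI) (auto simp: crd_zero)
      then show False using v(2) by simp
    qed
    ultimately show ?thesis using True rad by blast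
  next
    case False
    have "a = 0" if "\<forall>i<n. T (e i) a = 0" for a
    proof -
      have "?G *\<^sub>v vec n (\<lambda>i. crd i a) = 0\<^sub>v n"
        using that by (subst ker) (auto simp: expand[symmetric])
      then have "vec n (\<lambda>i. crd i a) = 0\<^sub>v n"
        using False det_0_iff_vec_prod_zero_field[OF G] by (metis disc_mat vec_carrier)
      then show ?thesis
        by (intro crd_eqI) (metis crd_zero index_vec index_zero_vec(1))
    qed
    then show ?thesis using False rad by blast
  qed
qed

lemma edual_eq:
  "edual x j = (\<Sum>k<n. scale (adj_mat (mat n n (\<lambda>(i, j). T (e i) (e j))) $$ (k, j)) (e k))"
  by (simp add: edual_def trL_def)

text \<open>An entry of the identity G adj(G) = det(G) 1 for the Gram matrix G of the trace
  form.\<close>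

lemma T_edual:
  assumes "i < n" "j < n"
  shows "T (e i) (edual x j) = (if i = j then \<Delta> x else 0)"
proof -
  let ?G = "mat n n (\<lambda>(i, j). T (e i) (e j))"
  have G: "?G \<in> carrier_mat n n" by simp
  have "(?G * adj_mat ?G) $$ (i, j) = (\<Delta> x \<cdot>\<^sub>m 1\<^sub>m n) $$ (i, j)"
    using adj_mat(2)[OF G] by (simp add: disc_mat)
  moreover have "(?G * adj_mat ?G) $$ (i, j) = (\<Sum>k<n. T (e i) (e k) * adj_mat ?G $$ (k, j))"
    using assms adj_mat(1)[OF G] by (simp add: scalar_prod_def lessThan_atLeast0)
  ultimately show ?thesis
    using assms
    by (simp add: edual_eq linf_sum[OF linf_T(1)] linf_scale[OF linf_T(1)] mult.commute)
qed

end

section \<open>Dual bases, the unit and the separability idempotent\<close>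

locale disc_algebra = based_algebra scale n e x
  for scale :: "'k::field_char_0 \<Rightarrow> 'v::ab_group_add \<Rightarrow> 'v" and n :: nat and e :: "nat \<Rightarrow> 'v"
    and x :: "'v \<Rightarrow> 'v \<Rightarrow> 'v" (infixl "\<cdot>" 70) +
  assumes disc: "discriminant scale n e x \<noteq> 0"
begin

lemma nondeg: "(\<And>b. T a b = 0) \<Longrightarrow> a = 0"
  using disc disc_nonzero_iff by blast

lemma nondeg_eq: "(\<And>b. T a b = T a' b) \<Longrightarrow> a = a'"
  using nondeg[of "a - a'"] by (simp add: linf_diff[OF linf_T(2)])

definition dual :: "nat \<Rightarrow> 'v" where
  "dual j = scale (1 / \<Delta> x) (edual x j)"

lemma T_dual: "i < n \<Longrightarrow> j < n \<Longrightarrow> T (e i) (dual j) = (if i = j then 1 else 0)"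
  using T_edual disc by (simp add: dual_def linf_scale[OF linf_T(1)])

lemma crd_eq_T: "j < n \<Longrightarrow> crd j a = T a (dual j)"
  by (subst (2) expand[of a])
     (simp add: linf_sum[OF linf_T(2)] linf_scale[OF linf_T(2)] T_dual if_distrib cong: if_cong)

lemma expand_dual: "a = (\<Sum>i<n. scale (T a (e i)) (dual i))"
proof (rule nondeg_eq)
  fix b
  have "T (\<Sum>i<n. scale (T a (e i)) (dual i)) b = (\<Sum>i<n. crd i b * T a (e i))"
    by (simp add: linf_sum[OF linf_T(2)] linf_scale[OF linf_T(2)] T_sym[of "dual _"] crd_eq_T[of _
        b] mult.commute)
  also have "\<dots> = T a b"
    by (subst (2) expand[of b]) (simp add: linf_sum[OF linf_T(1)] linf_scale[OF linf_T(1)])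
  finally show "T a b = T (\<Sum>i<n. scale (T a (e i)) (dual i)) b" by simp
qed

definition unit :: "'v" where "unit = (\<Sum>i<n. e i \<cdot> dual i)"

text \<open>After a cyclic shift the i-th term is \<open>T (b \<cdot> e i) (dual i)\<close>, the
  i-th diagonal coordinate of left multiplication by \<open>b\<close>. Since \<open>unit\<close>
  represents \<open>trL\<close>, nondegeneracy and associativity then make it a two-sided
  unit.\<close>

lemma T_unit: "T unit b = trL b"
proof -
  have "T unit b = (\<Sum>i<n. T (b \<cdot> e i) (dual i))"
    unfolding unit_def linf_sum[OF linf_T(2)]
    by (rule sum.cong[OF refl]) (metis T_sym assoc)
  also have "\<dots> = trL b"
    by (simp add: trL_def trace_map_def crd_eq_T)
  finally show ?thesis .
qed

lemma unit_l: "unit \<cdot> a = a"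
  by (rule nondeg_eq) (metis T_unit assoc)

lemma unit_r: "a \<cdot> unit = a"
  by (rule nondeg_eq) (metis T_unit T_sym assoc)

text \<open>Both sides expand to the double sum of
  \<open>T (a \<cdot> e i) (dual j) * \<beta> (e j) (dual i)\<close>: on the left
  \<open>a \<cdot> e i\<close> is expanded in \<open>e\<close>, on the right
  \<open>dual i \<cdot> a\<close> in \<open>dual\<close>, and cyclic invariance identifies the
  coefficients.\<close>

lemma separability_identity:
  assumes "\<And>b. linf (\<lambda>c. \<beta> b c)" "\<And>c. linf (\<lambda>b. \<beta> b c)"
  shows "(\<Sum>i<n. \<beta> (a \<cdot> e i) (dual i)) = (\<Sum>i<n. \<beta> (e i) (dual i \<cdot> a))"
proof -
  have "(\<Sum>i<n. \<beta> (a \<cdot> e i) (dual i)) = (\<Sum>i<n. \<Sum>j<n. T (a \<cdot> e i) (dual j) * \<beta> (e j) (dual i))"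
    by (rule sum.cong[OF refl], subst expand)
       (simp add: linf_sum[OF assms(2)] linf_scale[OF assms(2)] crd_eq_T)
  also have "\<dots> = (\<Sum>j<n. \<Sum>i<n. T (dual j \<cdot> a) (e i) * \<beta> (e j) (dual i))"
    by (subst sum.swap) (intro sum.cong refl, metis T_sym assoc)
  also have "\<dots> = (\<Sum>i<n. \<beta> (e i) (dual i \<cdot> a))"
    by (rule sum.cong[OF refl], subst (2) expand_dual)
       (simp add: linf_sum[OF assms(1)] linf_scale[OF assms(1)])
  finally show ?thesis .
qed

lemma separable: "separable_algebra scale x"
  unfolding separable_algebra_def
proof (intro conjI exI allI)
  let ?p = "map (\<lambda>i. (e i, dual i)) [0..<n]"
  show "(\<Sum>(b, c)\<leftarrow>?p. b \<cdot> c) = unit"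
    by (simp add: unit_def comp_def interv_sum_list_conv_sum_set_nat lessThan_atLeast0)
  fix a and \<beta> :: "'v \<Rightarrow> 'v \<Rightarrow> 'k"
  show "(\<forall>b. linf (\<beta> b)) \<and> (\<forall>c. linf (\<lambda>b. \<beta> b c)) \<longrightarrow>
    (\<Sum>(b, c)\<leftarrow>?p. \<beta> (a \<cdot> b) c) = (\<Sum>(b, c)\<leftarrow>?p. \<beta> b (c \<cdot> a))"
    using separability_identity[of \<beta> a]
    by (simp add: comp_def interv_sum_list_conv_sum_set_nat lessThan_atLeast0)
qed (auto simp: alg unit_l unit_r)

end

section \<open>Separability, von Neumann regularity and the discriminant\<close>

context based_algebra
begin

definition regular :: bool where "regular \<longleftrightarrow> (\<forall>y. \<exists>z. y \<cdot> z \<cdot> y = y)"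

lemma sum_list_mult_r: "a \<cdot> (\<Sum>p\<leftarrow>ps. f p) = (\<Sum>p\<leftarrow>ps. a \<cdot> f p)"
  by (induction ps) (simp_all add: mult_add_r)

lemma sum_list_mult_l: "(\<Sum>p\<leftarrow>ps. f p) \<cdot> a = (\<Sum>p\<leftarrow>ps. f p \<cdot> a)"
  by (induction ps) (simp_all add: mult_add_l)

lemma crd_sum_list: "crd k (\<Sum>p\<leftarrow>ps. f p) = (\<Sum>p\<leftarrow>ps. crd k (f p))"
  by (induction ps) (simp_all add: crd_add crd_zero)

text \<open>Averaging a linear projection onto the left ideal of \<open>y\<close> with the separability idempotent
  makes it a module projection, so this ideal is generated by an idempotent.\<close>

lemma separable_imp_regular:
  assumes "separable_algebra scale x"
  shows regular
  unfolding regular_def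
proof
  fix y
  obtain u p where u': "\<forall>a. u \<cdot> a = a \<and> a \<cdot> u = a" and p: "(\<Sum>(b, c)\<leftarrow>p. b \<cdot> c) = u"
    and sep: "\<forall>a. \<forall>\<beta>. (\<forall>b. linf (\<lambda>c. \<beta> b c)) \<and> (\<forall>c. linf (\<lambda>b. \<beta> b c)) \<longrightarrow>
       (\<Sum>(b, c)\<leftarrow>p. \<beta> (a \<cdot> b) c) = (\<Sum>(b, c)\<leftarrow>p. \<beta> b (c \<cdot> a))"
    using assms[unfolded separable_algebra_def]
    by (elim conjE exE) (rule that, assumption+)
  then have u: "u \<cdot> a = a" "a \<cdot> u = a" for a by auto
  let ?W = "range (\<lambda>v. v \<cdot> y)"
  have "subspace ?W"
    by (rule subspace_range[OF lin_r])
  then obtain d :: nat and b \<phi> where *: "\<And>i. i < d \<Longrightarrow> linf (\<phi> i)" "\<And>i. i < d \<Longrightarrow> b i \<in> ?W"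
    "\<And>w. w \<in> ?W \<Longrightarrow> w = (\<Sum>i<d. scale (\<phi> i w) (b i))"
    by (rule subspace_coords) blast
  define \<pi> where "\<pi> w = (\<Sum>i<d. scale (\<phi> i w) (b i))" for w
  have lin_\<pi>: "lin \<pi>"
    unfolding \<pi>_def
    by (rule linI)
       (simp_all add: linf_add[OF *(1)] linf_scale[OF *(1)] scale_left_distrib sum.distrib
         scale_sum_right)
  have \<pi>_W: "\<pi> w \<in> ?W" for w
  proof -
    define g where "g i = (SOME v. b i = v \<cdot> y)" for i
    have g: "b i = g i \<cdot> y" if i: "i < d" for i
    proof -
      obtain v where "b i = v \<cdot> y" using *(2)[OF i] by (rule imageE)
      then show ?thesis unfolding g_def by (rule someI)
    qed
    have "\<pi> w = (\<Sum>i<d. scale (\<phi> i w) (g i)) \<cdot> y"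
      by (simp add: \<pi>_def g mult_sum_l mult_scale_l)
    then show ?thesis by simp
  qed
  then have "\<forall>w. \<exists>v. \<pi> w = v \<cdot> y" by (simp add: image_iff)
  then obtain h where h: "\<And>w. \<pi> w = h w \<cdot> y" by (auto dest: choice)
  have \<pi>_id: "\<pi> (v \<cdot> y) = v \<cdot> y" for v
    using *(3)[of "v \<cdot> y"] by (simp add: \<pi>_def)
  \<comment> \<open>\<open>z \<cdot> y\<close> is the averaged projection applied to the unit. A
    left factor \<open>y\<close> is moved by \<open>sep\<close> inside \<open>\<pi>\<close>, which
    fixes \<open>c \<cdot> y\<close>; what is left is the unit times \<open>y\<close>.\<close>
  define z where "z = (\<Sum>(b, c)\<leftarrow>p. b \<cdot> h c)"
  have zy: "z \<cdot> y = (\<Sum>(b, c)\<leftarrow>p. b \<cdot> \<pi> c)"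
    by (simp add: z_def sum_list_mult_l case_prod_unfold h assoc)
  have "y \<cdot> (z \<cdot> y) = y"
  proof (rule crd_eqI)
    fix k
    have "crd k (y \<cdot> (z \<cdot> y)) = (\<Sum>(b, c)\<leftarrow>p. crd k (y \<cdot> b \<cdot> \<pi> c))"
      by (simp add: zy sum_list_mult_r case_prod_unfold crd_sum_list assoc)
    also have "\<dots> = (\<Sum>(b, c)\<leftarrow>p. crd k (b \<cdot> \<pi> (c \<cdot> y)))"
      by (rule sep[rule_format]) (auto intro!: linfI simp: crd_add crd_scale mult_distrib
          lin_add[OF lin_\<pi>] lin_scale[OF lin_\<pi>])
    also have "\<dots> = crd k ((\<Sum>(b, c)\<leftarrow>p. b \<cdot> c) \<cdot> y)"
      by (simp add: \<pi>_id sum_list_mult_l case_prod_unfold crd_sum_list assoc)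
    finally show "crd k (y \<cdot> (z \<cdot> y)) = crd k y" by (simp add: p u)
  qed
  then show "\<exists>z. y \<cdot> z \<cdot> y = y" by (auto simp: assoc)
qed

text \<open>The trace form is nonzero at a nonzero idempotent, whose left multiplication has trace equal
  to its rank.\<close>

lemma disc_nonzeroI:
  assumes "\<And>y. y \<noteq> 0 \<Longrightarrow> \<exists>p q. p \<cdot> y \<cdot> q \<noteq> 0 \<and> (p \<cdot> y \<cdot> q) \<cdot> (p \<cdot> y \<cdot> q) = p \<cdot> y \<cdot> q"
  shows "\<Delta> x \<noteq> 0"
  unfolding disc_nonzero_iff
proof (intro allI impI, rule ccontr)
  fix y
  assume y: "\<forall>b. T y b = 0" "y \<noteq> 0"
  then obtain p q where pq: "p \<cdot> y \<cdot> q \<noteq> 0" "(p \<cdot> y \<cdot> q) \<cdot> (p \<cdot> y \<cdot> q) = p \<cdot> y \<cdot> q"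
    using assms by blast
  define f where "f = p \<cdot> y \<cdot> q"
  have ff: "f \<cdot> f = f" "f \<noteq> 0" using pq by (simp_all add: f_def)
  obtain d where d: "trL f = of_nat d" "d = 0 \<longleftrightarrow> (\<forall>v. f \<cdot> v = 0)"
    using tr_idem[OF lin_l, of f] ff(1) by (auto simp: assoc[symmetric] trL_def)
  \<comment> \<open>As \<open>f\<close> is idempotent, \<open>T f f\<close> is its rank. Cyclic
    invariance brings \<open>y\<close> to the front, where every pairing vanishes by
    assumption.\<close>
  have "T f f = T p (y \<cdot> q \<cdot> f)"
    by (simp add: f_def assoc)
  also have "\<dots> = T (y \<cdot> q \<cdot> f) p" by (rule T_sym)
  also have "\<dots> = T y (q \<cdot> f \<cdot> p)" by (simp add: assoc)
  finally have "of_nat d = (0 :: 'k)"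
    using y d ff by simp
  then show False using d ff by (metis of_nat_eq_0_iff)
qed

text \<open>The idempotent is \<open>z \<cdot> y\<close> for a quasi-inverse \<open>z\<close> of
  \<open>y\<close>. The right factor \<open>q\<close> is \<open>z \<cdot> y\<close> once more,
  standing in for a unit, which is not at hand here.\<close>

lemma regular_imp_disc: "regular \<Longrightarrow> \<Delta> x \<noteq> 0"
proof (rule disc_nonzeroI)
  fix y :: 'v
  assume regular "y \<noteq> 0"
  then obtain z where z: "y \<cdot> z \<cdot> y = y" by (auto simp: regular_def)
  then have "z \<cdot> y \<cdot> z \<cdot> y = z \<cdot> y" "z \<cdot> y \<noteq> 0"
    using \<open>y \<noteq> 0\<close> by (auto simp: assoc)
  then show "\<exists>p q. p \<cdot> y \<cdot> q \<noteq> 0 \<and> (p \<cdot> y \<cdot> q) \<cdot> (p \<cdot> y \<cdot> q) = p \<cdot> y \<cdot> q"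
    using z by (intro exI[of _ z] exI[of _ "z \<cdot> y"]) (simp add: assoc)
qed

lemma disc_iff_separable: "\<Delta> x \<noteq> 0 \<longleftrightarrow> separable_algebra scale x"
  using separable_imp_regular regular_imp_disc disc_algebra.separable
  by (metis based_algebra_axioms disc_algebra_axioms.intro disc_algebra_def)

end

subsection \<open>Frames of matrix units\<close>

context based_algebra
begin

definition corner :: "'v \<Rightarrow> 'v set" where
  "corner c = {v. c \<cdot> v = v \<and> v \<cdot> c = v}"

definition division_idem :: "'v \<Rightarrow> bool" where
  "division_idem c \<longleftrightarrow> c \<cdot> c = c \<and> c \<noteq> 0 \<and>
     (\<forall>d\<in>corner c. d \<noteq> 0 \<longrightarrow> (\<exists>d'\<in>corner c. d \<cdot> d' = c \<and> d' \<cdot> d = c))"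

text \<open>The elements \<open>b s i \<cdot> a s j\<close> are the matrix units of the \<open>s\<close>-th block, and \<open>corner (c s)\<close> is
  its division algebra.\<close>

definition pframe :: "'v \<Rightarrow> nat \<Rightarrow> (nat \<Rightarrow> nat) \<Rightarrow> (nat \<Rightarrow> nat \<Rightarrow> 'v) \<Rightarrow> (nat \<Rightarrow> nat \<Rightarrow> 'v) \<Rightarrow>
    (nat \<Rightarrow> 'v) \<Rightarrow> bool" where
  "pframe u m r a b c \<longleftrightarrow>
     (\<forall>s<m. division_idem (c s) \<and> 0 < r s) \<and>
     (\<forall>s<m. \<forall>i<r s. c s \<cdot> a s i = a s i \<and> b s i \<cdot> c s = b s i) \<and>
     (\<forall>s<m. \<forall>t<m. \<forall>i<r s. \<forall>j<r t. a s i \<cdot> b t j = (if s = t \<and> i = j then c s else 0)) \<and>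
     (\<forall>s<m. \<forall>t<m. s \<noteq> t \<longrightarrow> (\<forall>v. c s \<cdot> (v \<cdot> c t) = 0)) \<and>
     u = (\<Sum>s<m. \<Sum>i<r s. b s i \<cdot> a s i)"

definition is_unit :: "'v \<Rightarrow> bool" where
  "is_unit u \<longleftrightarrow> (\<forall>v. u \<cdot> v = v \<and> v \<cdot> u = v)"

definition frame :: "nat \<Rightarrow> (nat \<Rightarrow> nat) \<Rightarrow> (nat \<Rightarrow> nat \<Rightarrow> 'v) \<Rightarrow> (nat \<Rightarrow> nat \<Rightarrow> 'v) \<Rightarrow>
    (nat \<Rightarrow> 'v) \<Rightarrow> bool" where
  "frame m r a b c \<longleftrightarrow> (\<exists>u. is_unit u \<and> pframe u m r a b c)"

lemma cornerD: "v \<in> corner c \<Longrightarrow> c \<cdot> v = v" "v \<in> corner c \<Longrightarrow> v \<cdot> c = v"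
  by (simp_all add: corner_def)

lemma corner_absorb: "v \<in> corner c \<Longrightarrow> c \<cdot> (v \<cdot> w) = v \<cdot> w" "v \<in> corner c \<Longrightarrow> v \<cdot> (c \<cdot> w) = v \<cdot> w"
  by (simp_all add: corner_def assoc[symmetric])

lemma subspace_corner: "subspace (corner c)"
  by (rule subspaceI) (simp_all add: corner_def mult_distrib)

lemma corner_mult: "v \<in> corner c \<Longrightarrow> w \<in> corner c \<Longrightarrow> v \<cdot> w \<in> corner c"
  by (simp add: corner_def assoc) (simp add: assoc[symmetric])

lemma division_idemD:
  assumes "division_idem c"
  shows "c \<cdot> c = c" "c \<cdot> (c \<cdot> v) = c \<cdot> v" "c \<noteq> 0" "c \<in> corner c"
  using assms by (auto simp: division_idem_def corner_def assoc[symmetric])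

text \<open>In a division algebra the only nonzero idempotent is the unit: cancel one factor of
  \<open>f \<cdot> f = f\<close> with the inverse of \<open>f\<close>.\<close>

lemma division_idem_eq:
  assumes c: "division_idem c" and f: "f \<in> corner c" "f \<cdot> f = f" "f \<noteq> 0"
  shows "f = c"
proof -
  obtain f' where f': "f' \<in> corner c" "f \<cdot> f' = c"
    using c f by (auto simp: division_idem_def)
  have "f = f \<cdot> c" using f by (simp add: cornerD)
  also have "\<dots> = f \<cdot> f \<cdot> f'" using f' by (simp add: assoc)
  finally show ?thesis using f f' by simp
qed

text \<open>For idempotents this is Murray-von Neumann equivalence: right multiplications by
  \<open>p\<close> and \<open>q\<close> are inverse isomorphisms between the left ideals generated
  by \<open>c\<close> and \<open>c'\<close>.\<close>

definition linked :: "'v \<Rightarrow> 'v \<Rightarrow> bool" where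
  "linked c c' \<longleftrightarrow> (\<exists>p q. c \<cdot> p = p \<and> p \<cdot> c' = p \<and> c' \<cdot> q = q \<and> q \<cdot> c = q \<and>
     p \<cdot> q = c \<and> q \<cdot> p = c')"

lemma linkedE:
  assumes "linked c c'"
  obtains p q where "c \<cdot> p = p" "p \<cdot> c' = p" "c' \<cdot> q = q" "q \<cdot> c = q" "p \<cdot> q = c" "q \<cdot> p = c'"
  using assms unfolding linked_def by blast

lemma linked_sym: "linked c c' \<Longrightarrow> linked c' c"
  unfolding linked_def by blast

text \<open>The composite of the two links, running from \<open>c1\<close> to \<open>c2\<close>,
  becomes \<open>c1\<close> after multiplication by the composite in the other direction. Since
  distinct blocks of a frame annihilate each other, this shows that an idempotent is linked to at
  most one block.\<close>

lemma linked_common: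
  assumes "linked c c1" "linked c c2" "c1 \<noteq> 0"
  shows "\<exists>v. c1 \<cdot> (v \<cdot> c2) \<noteq> 0"
proof -
  obtain p q where pq: "c \<cdot> p = p" "c1 \<cdot> q = q" "q \<cdot> p = c1"
    using linkedE[OF assms(1)] .
  obtain p' q' where pq': "p' \<cdot> c2 = p'" "p' \<cdot> q' = c"
    using linkedE[OF assms(2)] .
  have "c1 \<cdot> (q \<cdot> p' \<cdot> c2) \<cdot> (q' \<cdot> p) = (c1 \<cdot> q) \<cdot> ((p' \<cdot> c2) \<cdot> q' \<cdot> p)"
    by (simp add: assoc)
  also have "\<dots> = c1" by (simp only: pq pq')
  finally show ?thesis using assms(3) by (metis mult_zero_l)
qed

text \<open>With \<open>y\<close> the given nonzero product and
  \<open>y \<cdot> z \<cdot> y = y\<close>, the element \<open>w\<close> of the corner of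
  \<open>c'\<close> is nonzero because \<open>y \<cdot> w = y\<close>. Inverting \<open>w\<close>
  there gives a left inverse \<open>q\<close> of \<open>y\<close>. Then \<open>y \<cdot> q\<close>
  is a nonzero idempotent of the other corner, hence equal to \<open>c\<close>.\<close>

lemma link:
  assumes "regular" and c: "division_idem c" and c': "division_idem c'" and nz: "c \<cdot> (v \<cdot> c') \<noteq> 0"
  shows "linked c c'"
proof -
  define y where "y = c \<cdot> (v \<cdot> c')"
  have y: "c \<cdot> y = y" "y \<cdot> c' = y" "y \<noteq> 0"
    using division_idemD[OF c] division_idemD[OF c'] nz by (auto simp: y_def assoc)
  obtain z where z: "y \<cdot> (z \<cdot> y) = y"
    using \<open>regular\<close> unfolding regular_def assoc by blast
  define w where "w = c' \<cdot> (z \<cdot> y)"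
  have "y \<cdot> w = y \<cdot> (z \<cdot> y)"
    unfolding w_def by (metis assoc y(2))
  then have w: "w \<in> corner c'" "w \<noteq> 0"
    using z y(3) by (auto simp: w_def corner_def assoc y division_idemD[OF c'])
  then obtain w' where w': "w' \<in> corner c'" "w' \<cdot> w = c'"
    using c' by (auto simp: division_idem_def)
  define q where "q = w' \<cdot> (c' \<cdot> (z \<cdot> c))"
  have q: "c' \<cdot> q = q" "q \<cdot> c = q"
    by (auto simp: q_def corner_absorb[OF w'(1)] assoc division_idemD[OF c])
  have qy: "q \<cdot> y = c'"
    using w'(2) by (simp add: q_def w_def assoc y)
  have "y \<cdot> q = c"
  proof (rule division_idem_eq[OF c])
    show "y \<cdot> q \<in> corner c"
      by (simp add: corner_def assoc q) (simp add: assoc[symmetric] y)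
    show "y \<cdot> q \<cdot> (y \<cdot> q) = y \<cdot> q"
      by (metis assoc qy y(2))
    show "y \<cdot> q \<noteq> 0"
      by (metis assoc mult_zero_l qy y(2,3))
  qed
  then show ?thesis unfolding linked_def using y q qy by blast
qed

lemma idem_rank:
  assumes "f \<cdot> f = f"
  obtains d :: nat where "trL f = of_nat d" "d = 0 \<longleftrightarrow> f = 0"
proof -
  obtain d :: nat where d: "tr (\<lambda>v. f \<cdot> v) = of_nat d" "d = 0 \<longleftrightarrow> (\<forall>v. f \<cdot> v = 0)"
    using tr_idem[OF lin_l, of f] assms by (auto simp: assoc[symmetric])
  have "(\<forall>v. f \<cdot> v = 0) \<longleftrightarrow> f = 0"
    using assms by (metis mult_zero_l)
  then show ?thesis using d that[of d] by (simp add: trL_def)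
qed

lemmas trL_add = linf_add[OF linf_trL] and trL_diff = linf_diff[OF linf_trL]
  and trL_scale = linf_scale[OF linf_trL]

text \<open>Descent on the rank of \<open>h\<close>. Let \<open>y\<close> be a nonzero element of
  the corner without inverse and \<open>z\<close> a quasi-inverse of \<open>y\<close>, cut down to
  the corner. Then \<open>y \<cdot> z\<close> and \<open>z \<cdot> y\<close> are nonzero idempotents
  that are not both \<open>h\<close>. One that differs from \<open>h\<close> is the \<open>g\<close>
  below; \<open>g\<close> and \<open>h - g\<close> are nonzero idempotents whose ranks add up to
  that of \<open>h\<close>.\<close>

lemma primitive_exists:
  assumes reg: "regular"
  shows "trL h = of_nat d \<Longrightarrow> h \<cdot> h = h \<Longrightarrow> h \<noteq> 0 \<Longrightarrow> \<exists>f. division_idem f \<and> h \<cdot> f = f \<and> f \<cdot> h = f"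
proof (induction d arbitrary: h rule: less_induct)
  case (less d)
  show ?case
  proof (cases "division_idem h")
    case True
    then show ?thesis using less.prems by blast
  next
    case False
    then obtain y where y: "y \<in> corner h" "y \<noteq> 0"
      "\<not> (\<exists>z\<in>corner h. y \<cdot> z = h \<and> z \<cdot> y = h)"
      using less.prems by (auto simp: division_idem_def)
    obtain z0 where z0: "y \<cdot> (z0 \<cdot> y) = y"
      using reg unfolding regular_def assoc by blast
    define z where "z = h \<cdot> (z0 \<cdot> h)"
    have hh: "h \<cdot> (h \<cdot> v) = h \<cdot> v" for v using less.prems(2) by (metis assoc)
    have z: "z \<in> corner h" using less.prems(2) by (simp add: z_def corner_def assoc hh)
    have yzy: "y \<cdot> (z \<cdot> y) = y"
      using z0 by (simp add: z_def assoc corner_absorb[OF y(1)] cornerD[OF y(1)])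
    have "\<exists>g. g \<in> corner h \<and> g \<cdot> g = g \<and> g \<noteq> 0 \<and> g \<noteq> h"
    proof (cases "y \<cdot> z = h")
      case True
      then have "z \<cdot> y \<noteq> h" using y(3) z by blast
      moreover have "z \<cdot> y \<cdot> (z \<cdot> y) = z \<cdot> y" "z \<cdot> y \<noteq> 0"
        using yzy y(2) by (auto simp: assoc)
      ultimately show ?thesis using corner_mult[OF z y(1)] by blast
    next
      case False
      moreover have "y \<cdot> z \<cdot> (y \<cdot> z) = y \<cdot> z" "y \<cdot> z \<noteq> 0"
        using yzy y(2) by (metis assoc, metis assoc mult_zero_l)
      ultimately show ?thesis using corner_mult[OF y(1) z] by blast
    qed
    then obtain g where g: "g \<in> corner h" "g \<cdot> g = g" "g \<noteq> 0" "g \<noteq> h" by blast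
    obtain d1 where d1: "trL g = of_nat d1" "d1 = 0 \<longleftrightarrow> g = 0"
      using idem_rank[OF g(2)] .
    have "(h - g) \<cdot> (h - g) = h - g"
      using g less.prems by (simp add: mult_distrib cornerD)
    then obtain d2 where d2: "trL (h - g) = of_nat d2" "d2 = 0 \<longleftrightarrow> h - g = 0"
      by (rule idem_rank)
    have "(of_nat d :: 'k) = of_nat (d1 + d2)"
      using less.prems(1) d1 d2 by (simp add: trL_diff diff_eq_eq add.commute)
    then have "d1 < d" using d2 g(4) by (simp only: of_nat_eq_iff) auto
    then obtain f where "division_idem f" "g \<cdot> f = f" "f \<cdot> g = f"
      using less.IH[OF _ d1(1) g(2,3)] by blast
    then show ?thesis using g(1) by (metis assoc cornerD)
  qed
qed

lemma pframeD:
  assumes "pframe u m r a b c"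
  shows "s < m \<Longrightarrow> division_idem (c s)" "s < m \<Longrightarrow> 0 < r s"
    "s < m \<Longrightarrow> i < r s \<Longrightarrow> c s \<cdot> a s i = a s i" "s < m \<Longrightarrow> i < r s \<Longrightarrow> b s i \<cdot> c s = b s i"
    "s < m \<Longrightarrow> i < r s \<Longrightarrow> c s \<cdot> (a s i \<cdot> v) = a s i \<cdot> v"
    "s < m \<Longrightarrow> i < r s \<Longrightarrow> b s i \<cdot> (c s \<cdot> v) = b s i \<cdot> v"
    "s < m \<Longrightarrow> t < m \<Longrightarrow> i < r s \<Longrightarrow> j < r t \<Longrightarrow> a s i \<cdot> b t j = (if s = t \<and> i = j then c s else 0)"
    "s < m \<Longrightarrow> t < m \<Longrightarrow> i < r s \<Longrightarrow> j < r t \<Longrightarrow>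
       a s i \<cdot> (b t j \<cdot> v) = (if s = t \<and> i = j then c s \<cdot> v else 0)"
    "s < m \<Longrightarrow> t < m \<Longrightarrow> s \<noteq> t \<Longrightarrow> c s \<cdot> (v \<cdot> c t) = 0"
    "s < m \<Longrightarrow> t < m \<Longrightarrow> s \<noteq> t \<Longrightarrow> c s \<cdot> c t = 0"
    "u = (\<Sum>s<m. \<Sum>i<r s. b s i \<cdot> a s i)"
proof -
  note * = assms[unfolded pframe_def]
  show 1: "s < m \<Longrightarrow> division_idem (c s)" "s < m \<Longrightarrow> 0 < r s"
    and 2: "s < m \<Longrightarrow> i < r s \<Longrightarrow> c s \<cdot> a s i = a s i" "s < m \<Longrightarrow> i < r s \<Longrightarrow> b s i \<cdot> c s = b s i"
    and 3: "s < m \<Longrightarrow> t < m \<Longrightarrow> i < r s \<Longrightarrow> j < r t \<Longrightarrow>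
      a s i \<cdot> b t j = (if s = t \<and> i = j then c s else 0)"
    and 4: "\<And>v. s < m \<Longrightarrow> t < m \<Longrightarrow> s \<noteq> t \<Longrightarrow> c s \<cdot> (v \<cdot> c t) = 0"
    and "u = (\<Sum>s<m. \<Sum>i<r s. b s i \<cdot> a s i)"
    using * by blast+
  show "s < m \<Longrightarrow> i < r s \<Longrightarrow> c s \<cdot> (a s i \<cdot> v) = a s i \<cdot> v"
    "s < m \<Longrightarrow> i < r s \<Longrightarrow> b s i \<cdot> (c s \<cdot> v) = b s i \<cdot> v"
    using 2 by (metis assoc)+
  show "s < m \<Longrightarrow> t < m \<Longrightarrow> i < r s \<Longrightarrow> j < r t \<Longrightarrow>
      a s i \<cdot> (b t j \<cdot> v) = (if s = t \<and> i = j then c s \<cdot> v else 0)"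
    using 3 by (simp add: assoc[symmetric])
  show "c s \<cdot> c t = 0" if "s < m" "t < m" "s \<noteq> t"
    using 4[OF that, of "c t"] * that by (simp add: division_idemD)
qed

lemma pframe_unit_absorb:
  assumes F: "pframe u m r a b c" and "s < m" "i < r s"
  shows "a s i \<cdot> u = a s i" "u \<cdot> b s i = b s i"
proof -
  have "a s i \<cdot> u = (\<Sum>t<m. \<Sum>j<r t. if s = t \<and> i = j then a s i else 0)"
    unfolding pframeD(11)[OF F] mult_sum_r
    using assms(2,3) by (intro sum.cong refl) (auto simp: pframeD[OF F])
  also have "\<dots> = (\<Sum>t<m. if s = t then a s i else 0)"
    using assms(2,3) by (intro sum.cong refl) (auto)
  finally show "a s i \<cdot> u = a s i" using assms by simp
  have "u \<cdot> b s i = (\<Sum>t<m. \<Sum>j<r t. if s = t \<and> i = j then b s i else 0)"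
    unfolding pframeD(11)[OF F] mult_sum_l
    using assms(2,3) by (intro sum.cong refl) (auto simp: pframeD[OF F] assoc)
  also have "\<dots> = (\<Sum>t<m. if s = t then b s i else 0)"
    using assms(2,3) by (intro sum.cong refl) (auto)
  finally show "u \<cdot> b s i = b s i" using assms by simp
qed

lemma pframe_idem:
  assumes F: "pframe u m r a b c"
  shows "u \<cdot> u = u"
  by (subst (1 3) pframeD(11)[OF F])
     (simp add: mult_sum_l assoc pframe_unit_absorb[OF F])

text \<open>If \<open>f\<close> is linked to some \<open>c s\<close>, the link \<open>p\<close>,
  \<open>q\<close> enlarges that block by the new index \<open>r s\<close>; otherwise
  \<open>f\<close> opens a block of size 1. Testing the products
  \<open>c s \<cdot> (v \<cdot> f)\<close> suffices, because links are symmetric: a nonzero product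
  in the other order would produce a nonzero one in this order.\<close>

lemma pframe_extend:
  assumes reg: "regular" and F: "pframe u m r a b c" and f: "division_idem f" "u \<cdot> f = 0" "f \<cdot> u =
      0"
  shows "\<exists>m' r' a' b' c'. pframe (u + f) m' r' a' b' c'"
proof -
  have af: "a s i \<cdot> f = 0" "a s i \<cdot> (f \<cdot> v) = 0" if "s < m" "i < r s" for s i v
    using pframe_unit_absorb(1)[OF F that] f(2) by (metis assoc mult_zero_l mult_zero_r)+
  have fb: "f \<cdot> b s i = 0" "v \<cdot> f \<cdot> b s i = 0" if "s < m" "i < r s" for s i v
    using pframe_unit_absorb(2)[OF F that] f(3) by (metis assoc mult_zero_l mult_zero_r)+
  show ?thesis
  proof (cases "\<exists>s<m. \<exists>v. c s \<cdot> (v \<cdot> f) \<noteq> 0")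
    case True
    then obtain s v where s: "s < m" "c s \<cdot> (v \<cdot> f) \<noteq> 0" by blast
    obtain p q where pq: "c s \<cdot> p = p" "p \<cdot> f = p" "f \<cdot> q = q" "q \<cdot> c s = q" "p \<cdot> q = c s"
        "q \<cdot> p = f"
      using linkedE[OF link[OF reg pframeD(1)[OF F s(1)] f(1) s(2)]] .
    let ?r = "r(s := Suc (r s))"
    let ?a = "a(s := (a s)(r s := p))"
    let ?b = "b(s := (b s)(r s := q))"
    have aq: "a t i \<cdot> q = 0" if "t < m" "i < r t" for t i
      using af(2)[OF that, of q] pq by simp
    have pb: "p \<cdot> b t i = 0" if "t < m" "i < r t" for t i
      using fb(2)[OF that, of p] pq by simp
    have "(\<Sum>t<m. \<Sum>i<?r t. ?b t i \<cdot> ?a t i) =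
        (\<Sum>i<r s. b s i \<cdot> a s i) + f + (\<Sum>t\<in>{..<m} - {s}. \<Sum>i<r t. b t i \<cdot> a t i)"
      using s(1) pq by (subst sum.remove[of _ s]) (auto intro!: sum.cong)
    also have "\<dots> = u + f"
      using s(1) by (subst pframeD(11)[OF F], subst (2) sum.remove[of _ s]) auto
    finally have "pframe (u + f) m ?r ?a ?b c"
      unfolding pframe_def
      using pframeD[OF F] pq s(1) aq pb
      by (intro conjI allI impI) (auto simp: less_Suc_eq)
    then show ?thesis by blast
  next
    case False
    then have cf: "c s \<cdot> (v \<cdot> f) = 0" if "s < m" for s v using that by blast
    have fc: "f \<cdot> (v \<cdot> c s) = 0" if s: "s < m" for s v
    proof (rule ccontr)
      assume "f \<cdot> (v \<cdot> c s) \<noteq> 0"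
      then have "linked f (c s)"
        by (rule link[OF reg f(1) pframeD(1)[OF F s]])
      then obtain p q where "c s \<cdot> q = q" "q \<cdot> f = q" "p \<cdot> q = f"
        by (rule linkedE)
      then have "f = 0" using cf[OF s, of q] by simp
      then show False using f(1) by (simp add: division_idem_def)
    qed
    let ?r = "r(m := 1)"
    let ?a = "a(m := \<lambda>_. f)"
    let ?b = "b(m := \<lambda>_. f)"
    let ?c = "c(m := f)"
    have "(\<Sum>t<Suc m. \<Sum>i<?r t. ?b t i \<cdot> ?a t i) = u + f"
      using f(1) by (subst pframeD(11)[OF F]) (simp add: division_idemD)
    then have "pframe (u + f) (Suc m) ?r ?a ?b ?c"
      unfolding pframe_def
      using pframeD[OF F] cf fc f af(1) fb(1) division_idemD[OF f(1)]
      by (intro conjI allI impI) (auto simp: less_Suc_eq)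
    then show ?thesis by blast
  qed
qed

text \<open>Induction on the rank of the complement \<open>u - f\<close>: each step moves a division
  idempotent from the complement into the partial frame.\<close>

lemma frame_exists_aux:
  assumes reg: "regular" and u: "is_unit u"
  shows "pframe f m r a b c \<Longrightarrow> trL (u - f) = of_nat k \<Longrightarrow> \<exists>m r a b c. frame m r a b c"
proof (induction k arbitrary: f m r a b c rule: less_induct)
  case (less k)
  show ?case
  proof (cases "u = f")
    case True
    then show ?thesis using less.prems(1) u unfolding frame_def by blast
  next
    case False
    have ff: "f \<cdot> f = f" using pframe_idem[OF less.prems(1)] .
    have uu: "u \<cdot> v = v" "v \<cdot> u = v" for v using u by (auto simp: is_unit_def)
    have h: "(u - f) \<cdot> (u - f) = u - f" by (simp add: mult_distrib uu ff)
    obtain g where g: "division_idem g" "(u - f) \<cdot> g = g" "g \<cdot> (u - f) = g"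
      using primitive_exists[OF reg less.prems(2) h] False by auto
    then have fg: "f \<cdot> g = 0" "g \<cdot> f = 0" by (auto simp: mult_distrib uu)
    then obtain m' r' a' b' c' where F': "pframe (f + g) m' r' a' b' c'"
      using pframe_extend[OF reg less.prems(1) g(1)] by blast
    obtain d1 where d1: "trL g = of_nat d1" "d1 = 0 \<longleftrightarrow> g = 0"
      using idem_rank[OF division_idemD(1)[OF g(1)]] .
    have "(u - (f + g)) \<cdot> (u - (f + g)) = u - (f + g)"
      using g by (simp add: mult_distrib uu ff fg division_idemD)
    then obtain d2 where d2: "trL (u - (f + g)) = of_nat d2" by (rule idem_rank)
    have "(of_nat k :: 'k) = of_nat (d1 + d2)"
      using less.prems(2) d1 d2 by (simp add: trL_diff trL_add algebra_simps)
    then have "d2 < k" using d1 division_idemD(3)[OF g(1)] by (simp only: of_nat_eq_iff) auto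
    then show ?thesis using less.IH[OF _ F' d2] by blast
  qed
qed

lemma frame_exists:
  assumes "regular" "is_unit u"
  shows "\<exists>m r a b c. frame m r a b c"
proof -
  have "pframe 0 0 r a b c" for r a b c by (simp add: pframe_def)
  moreover have "trL (u - 0) = of_nat n"
    using assms(2) by (simp add: trL_def is_unit_def tr_id)
  ultimately show ?thesis using frame_exists_aux[OF assms] by blast
qed

text \<open>Two-sided Peirce decomposition: the unit, as the sum of the
  \<open>b s i \<cdot> a s i\<close>, is inserted on both sides of \<open>v\<close>. Terms between
  different blocks vanish since a product \<open>c s \<cdot> (_ \<cdot> c t)\<close> splits
  off.\<close>

lemma frame_expand:
  assumes "is_unit u" "pframe u m r a b c"
  shows "v = (\<Sum>s<m. \<Sum>i<r s. \<Sum>j<r s. b s i \<cdot> (a s i \<cdot> v \<cdot> b s j) \<cdot> a s j)"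
proof -
  note F = pframeD[OF assms(2)]
  have cross: "a s i \<cdot> (v \<cdot> (b t j \<cdot> w)) = 0" if "s < m" "t < m" "s \<noteq> t" "i < r s" "j < r t"
      for s t i j w
  proof -
    have "a s i \<cdot> (v \<cdot> (b t j \<cdot> w)) = c s \<cdot> ((a s i \<cdot> v \<cdot> b t j) \<cdot> c t) \<cdot> w"
      using that F(4,5,6) by (simp add: assoc)
    then show ?thesis using F(9)[OF that(1-3)] by simp
  qed
  have vu: "w \<cdot> v \<cdot> u = (\<Sum>t<m. \<Sum>j<r t. w \<cdot> v \<cdot> b t j \<cdot> a t j)" for w
    unfolding F(11) by (simp add: mult_sum_r assoc)
  have "v = u \<cdot> (v \<cdot> u)"
    using assms(1) by (simp add: is_unit_def)
  also have "\<dots> = (\<Sum>s<m. \<Sum>i<r s. b s i \<cdot> a s i) \<cdot> (v \<cdot> u)"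
    using F(11) by simp
  also have "\<dots> = (\<Sum>s<m. \<Sum>i<r s. b s i \<cdot> (a s i \<cdot> v \<cdot> u))"
    by (simp add: mult_sum_l assoc)
  also have "\<dots> = (\<Sum>s<m. \<Sum>i<r s. \<Sum>t<m. \<Sum>j<r t. b s i \<cdot> (a s i \<cdot> v \<cdot> b t j) \<cdot> a t j)"
    unfolding vu by (simp add: mult_sum_r assoc)
  also have "\<dots> = (\<Sum>s<m. \<Sum>i<r s. \<Sum>t<m. if s = t then \<Sum>j<r t. b s i \<cdot> (a s i \<cdot> v \<cdot> b t j) \<cdot> a t j
      else 0)"
    by (intro sum.cong refl) (auto simp: assoc cross)
  finally show ?thesis by simp
qed

text \<open>By the Peirce decomposition some entry \<open>a s i \<cdot> y \<cdot> b s j\<close> of a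
  nonzero \<open>y\<close> is nonzero. It lies in a division algebra, and dividing by it turns
  \<open>y\<close> into the idempotent \<open>c s\<close>.\<close>

lemma frame_disc:
  assumes "frame m r a b c"
  shows "\<Delta> x \<noteq> 0"
proof (rule disc_nonzeroI)
  fix y :: 'v
  assume "y \<noteq> 0"
  obtain u where u: "is_unit u" "pframe u m r a b c" using assms by (auto simp: frame_def)
  note F = pframeD[OF u(2)]
  have "\<exists>s i j. s < m \<and> i < r s \<and> j < r s \<and> a s i \<cdot> y \<cdot> b s j \<noteq> 0"
  proof (rule ccontr)
    assume "\<not> ?thesis"
    then have "y = 0"
      by (subst frame_expand[OF u]) (auto intro!: sum.neutral)
    then show False using \<open>y \<noteq> 0\<close> by simp
  qed
  then obtain s i j where s: "s < m" "i < r s" "j < r s" "a s i \<cdot> y \<cdot> b s j \<noteq> 0" by blast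
  have "a s i \<cdot> y \<cdot> b s j \<in> corner (c s)"
    using s F by (simp add: corner_def assoc)
  then obtain d where d: "a s i \<cdot> y \<cdot> b s j \<cdot> d = c s"
    using F(1)[OF s(1)] s(4) by (auto simp: division_idem_def)
  have "a s i \<cdot> y \<cdot> (b s j \<cdot> d) = c s" using d by (simp add: assoc)
  then show "\<exists>p q. p \<cdot> y \<cdot> q \<noteq> 0 \<and> (p \<cdot> y \<cdot> q) \<cdot> (p \<cdot> y \<cdot> q) = p \<cdot> y \<cdot> q"
    using division_idemD[OF F(1)[OF s(1)]] by metis
qed

text \<open>The dimension is the trace of the identity. It is taken in the coordinates given by the
  matrix units with entries \<open>\<beta> s k\<close>, each of which contributes 1.\<close>

lemma frame_dim:
  assumes "is_unit u" "pframe u m r a b c"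
    and \<phi>: "\<And>s k. s < m \<Longrightarrow> k < d s \<Longrightarrow> linf (\<phi> s k)"
    and \<beta>: "\<And>s k. s < m \<Longrightarrow> k < d s \<Longrightarrow> \<beta> s k \<in> corner (c s)"
    and dual: "\<And>s k. s < m \<Longrightarrow> k < d s \<Longrightarrow> \<phi> s k (\<beta> s k) = 1"
    and exp: "\<And>s w. s < m \<Longrightarrow> w \<in> corner (c s) \<Longrightarrow> w = (\<Sum>k<d s. scale (\<phi> s k w) (\<beta> s k))"
  shows "n = (\<Sum>s<m. (r s)\<^sup>2 * d s)"
proof -
  note F = pframeD[OF assms(2)]
  let ?I = "SIGMA s:{..<m}. {..<r s} \<times> {..<r s} \<times> {..<d s}"
  have cor: "a s i \<cdot> w \<cdot> b s j \<in> corner (c s)" if "s < m" "i < r s" "j < r s" for s i j w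
    using that F by (simp add: corner_def assoc)
  define \<Phi> where "\<Phi> = (\<lambda>(s, i, j, k) w. \<phi> s k (a s i \<cdot> w \<cdot> b s j))"
  define B where "B = (\<lambda>(s, i, j, k). b s i \<cdot> \<beta> s k \<cdot> a s j)"
  have "tr (\<lambda>v. v) = (\<Sum>p\<in>?I. \<Phi> p (B p))"
  proof (rule tr_decomp)
    fix p assume "p \<in> ?I"
    then show "linf (\<Phi> p)"
      by (auto intro!: linfI simp: \<Phi>_def mult_distrib linf_add[OF \<phi>] linf_scale[OF \<phi>])
  next
    fix w
    have "w = (\<Sum>s<m. \<Sum>i<r s. \<Sum>j<r s. b s i \<cdot> (a s i \<cdot> w \<cdot> b s j) \<cdot> a s j)"
      by (rule frame_expand[OF assms(1,2)])
    also have "\<dots> = (\<Sum>s<m. \<Sum>i<r s. \<Sum>j<r s. \<Sum>k<d s. scale (\<Phi> (s, i, j, k) w) (B (s, i, j, k)))"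
    proof (intro sum.cong refl)
      fix s i j assume "s \<in> {..<m}" "i \<in> {..<r s}" "j \<in> {..<r s}"
      then have "a s i \<cdot> w \<cdot> b s j = (\<Sum>k<d s. scale (\<Phi> (s, i, j, k) w) (\<beta> s k))"
        using exp[OF _ cor, of s i j w] by (simp add: \<Phi>_def)
      then show "b s i \<cdot> (a s i \<cdot> w \<cdot> b s j) \<cdot> a s j =
          (\<Sum>k<d s. scale (\<Phi> (s, i, j, k) w) (B (s, i, j, k)))"
        by (simp only:) (simp add: B_def mult_scale_l mult_scale_r mult_sum_l mult_sum_r)
    qed
    finally show "w = (\<Sum>p\<in>?I. scale (\<Phi> p w) (B p))"
      by (simp add: sum.Sigma sum.cartesian_product case_prod_unfold)
  qed (rule linI, simp_all)
  also have "\<dots> = (\<Sum>(s, i, j, k)\<in>?I. 1)"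
  proof (rule sum.cong[OF refl], clarsimp simp: \<Phi>_def B_def)
    fix s i j k assume *: "s < m" "i < r s" "j < r s" "k < d s"
    have "a s i \<cdot> (b s i \<cdot> \<beta> s k \<cdot> a s j) \<cdot> b s j = \<beta> s k"
      using * F cornerD[OF \<beta>[OF *(1,4)]] corner_absorb[OF \<beta>[OF *(1,4)]] by (simp add: assoc)
    then show "\<phi> s k (a s i \<cdot> (b s i \<cdot> \<beta> s k \<cdot> a s j) \<cdot> b s j) = 1" using dual * by simp
  qed
  also have "\<dots> = of_nat (\<Sum>s<m. (r s)\<^sup>2 * d s)"
    by (simp add: card_SigmaI card_cartesian_product power2_eq_square mult.assoc)
  finally show ?thesis by (simp only: tr_id of_nat_eq_iff)
qed

text \<open>Left multiplication by \<open>c s\<close> projects onto the right ideal of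
  \<open>c s\<close>, which the idempotents \<open>b s i \<cdot> a s i\<close> split into
  \<open>r s\<close> copies of the corner. So \<open>r s\<close> is a quotient of two traces that
  depend on \<open>c s\<close> alone, which is why block sizes can be compared between
  frames.\<close>

lemma tr_corner:
  assumes F: "pframe u m r a b c" and u: "is_unit u" and s: "s < m"
  shows "trL (c s) = of_nat (r s) * tr (\<lambda>v. c s \<cdot> v \<cdot> c s)"
proof -
  note F' = pframeD[OF F]
  have "trL (c s) = tr (\<lambda>v. \<Sum>i<r s. c s \<cdot> v \<cdot> (b s i \<cdot> a s i))"
    unfolding trL_def
  proof (rule tr_cong)
    fix v
    have "c s \<cdot> v = c s \<cdot> v \<cdot> u" using u by (simp add: is_unit_def)
    also have "\<dots> = (\<Sum>t<m. \<Sum>i<r t. c s \<cdot> v \<cdot> (b t i \<cdot> a t i))"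
      unfolding F'(11) by (simp add: mult_sum_r)
    also have "\<dots> = (\<Sum>t<m. if s = t then \<Sum>i<r t. c s \<cdot> v \<cdot> (b t i \<cdot> a t i) else 0)"
    proof (intro sum.cong refl)
      fix t assume t: "t \<in> {..<m}"
      have "c s \<cdot> v \<cdot> (b t i \<cdot> a t i) = c s \<cdot> ((v \<cdot> b t i) \<cdot> c t) \<cdot> a t i" if "i < r t" for i
        using that t F'(4)[of t i] by (simp add: assoc)
      then show "(\<Sum>i<r t. c s \<cdot> v \<cdot> (b t i \<cdot> a t i)) =
          (if s = t then \<Sum>i<r t. c s \<cdot> v \<cdot> (b t i \<cdot> a t i) else 0)"
        using F'(9)[OF s] t by (auto intro!: sum.neutral)
    qed
    finally show "c s \<cdot> v = (\<Sum>i<r s. c s \<cdot> v \<cdot> (b s i \<cdot> a s i))" using s by simp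
  qed
  also have "\<dots> = (\<Sum>i<r s. tr (\<lambda>v. c s \<cdot> v \<cdot> c s))"
    unfolding tr_sum
  proof (rule sum.cong[OF refl])
    fix i assume i: "i \<in> {..<r s}"
    have "tr (\<lambda>v. c s \<cdot> v \<cdot> (b s i \<cdot> a s i)) = tr (\<lambda>v. (c s \<cdot> v \<cdot> b s i) \<cdot> a s i)"
      by (simp add: assoc)
    \<comment> \<open>Commuting right multiplication by \<open>a s i\<close> to the inside brings
      \<open>a s i\<close> next to \<open>b s i\<close>, where their product is
      \<open>c s\<close>.\<close>
    also have "\<dots> = tr (\<lambda>v. c s \<cdot> (v \<cdot> a s i) \<cdot> b s i)"
      by (rule tr_comm[OF lin_r]) (rule linI; simp add: mult_distrib)
    also have "\<dots> = tr (\<lambda>v. c s \<cdot> v \<cdot> c s)"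
      using i s F'(7)[OF s s, of i i] by (simp add: assoc)
    finally show "tr (\<lambda>v. c s \<cdot> v \<cdot> (b s i \<cdot> a s i)) = tr (\<lambda>v. c s \<cdot> v \<cdot> c s)" .
  qed
  finally show ?thesis by simp
qed

lemma tr_corner_nonzero:
  assumes "division_idem c"
  shows "tr (\<lambda>v. c \<cdot> v \<cdot> c) \<noteq> 0"
proof -
  note c = division_idemD[OF assms]
  have "\<exists>d. tr (\<lambda>v. c \<cdot> v \<cdot> c) = of_nat d \<and> (d = 0 \<longleftrightarrow> (\<forall>v. c \<cdot> v \<cdot> c = 0))"
    by (rule tr_idem) (auto intro!: linI simp: mult_distrib, simp add: assoc c)
  moreover have "c \<cdot> c \<cdot> c \<noteq> 0" using c by simp
  ultimately show ?thesis by (metis of_nat_eq_0_iff)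
qed

text \<open>Links match the blocks. Each \<open>c s\<close> is linked to some \<open>c' t\<close>,
  since inserting the unit written in the other frame cannot annihilate it, and to only one by
  \<open>linked_common\<close>. A link carries one corner to the other and preserves both traces in
  \<open>tr_corner\<close>, hence the block size.\<close>

lemma frame_unique:
  assumes reg: "regular" and u: "is_unit u"
    and F: "pframe u m r a b c" and F': "pframe u m' r' a' b' c'"
  shows "\<exists>\<pi>. bij_betw \<pi> {..<m} {..<m'} \<and>
    (\<forall>s<m. r s = r' (\<pi> s) \<and> alg_iso scale (corner (c s)) x scale (corner (c' (\<pi> s))) x)"
proof -
  let ?R = "\<lambda>s t. linked (c s) (c' t)"
  note D = pframeD[OF F] and D' = pframeD[OF F']
  have uu: "u \<cdot> v = v" "v \<cdot> u = v" for v using u by (auto simp: is_unit_def)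
  have ex: "\<exists>t<m'. ?R s t" if s: "s < m" for s
  proof -
    have "\<exists>t<m'. \<exists>i<r' t. c s \<cdot> (b' t i \<cdot> c' t) \<noteq> 0"
    proof (rule ccontr)
      assume *: "\<not> ?thesis"
      have "c s = (\<Sum>t<m'. \<Sum>i<r' t. c s \<cdot> (b' t i \<cdot> c' t) \<cdot> a' t i)"
        by (subst uu(2)[symmetric], subst D'(11)) (simp add: mult_sum_r D' assoc)
      also have "\<dots> = 0" using * by (auto intro!: sum.neutral)
      finally show False using D(1)[OF s] by (simp add: division_idem_def)
    qed
    then show ?thesis
      using link[OF reg D(1)[OF s] D'(1)] by blast
  qed
  have ex': "\<exists>s<m. ?R s t" if t: "t < m'" for t
  proof -
    have "\<exists>s<m. \<exists>i<r s. c' t \<cdot> (b s i \<cdot> c s) \<noteq> 0"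
    proof (rule ccontr)
      assume *: "\<not> ?thesis"
      have "c' t = (\<Sum>s<m. \<Sum>i<r s. c' t \<cdot> (b s i \<cdot> c s) \<cdot> a s i)"
        by (subst uu(2)[symmetric], subst D(11)) (simp add: mult_sum_r D assoc)
      also have "\<dots> = 0" using * by (auto intro!: sum.neutral)
      finally show False using D'(1)[OF t] by (simp add: division_idem_def)
    qed
    then show ?thesis
      using linked_sym[OF link[OF reg D'(1)[OF t] D(1)]] by blast
  qed
  have inj: "t = t'" if "?R s t" "?R s t'" "t < m'" "t' < m'" for s t t'
    using linked_common[OF that(1,2) division_idemD(3)[OF D'(1)[OF that(3)]]] D'(9)[OF that(3,4)]
    by blast
  have inj': "s = s'" if "?R s t" "?R s' t" "s < m" "s' < m" for s s' t
    using linked_common[OF linked_sym[OF that(1)] linked_sym[OF that(2)] division_idemD(3)[OF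
        D(1)[OF that(3)]]]
      D(9)[OF that(3,4)]
    by blast
  obtain \<pi> where \<pi>: "\<And>s. s < m \<Longrightarrow> \<pi> s < m' \<and> ?R s (\<pi> s)"
    using ex by metis
  have "bij_betw \<pi> {..<m} {..<m'}"
  proof (rule bij_betw_imageI)
    show "inj_on \<pi> {..<m}"
    proof (rule inj_onI)
      fix s s' assume "s \<in> {..<m}" "s' \<in> {..<m}" "\<pi> s = \<pi> s'"
      then show "s = s'" using inj'[of s "\<pi> s" s'] \<pi>[of s] \<pi>[of s'] by simp
    qed
    show "\<pi> ` {..<m} = {..<m'}"
    proof safe
      fix t assume "t < m'"
      then obtain s where s: "s < m" "?R s t" using ex' by blast
      then have "t = \<pi> s" using inj[OF s(2)] \<pi>[OF s(1)] \<open>t < m'\<close> by blast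
      then show "t \<in> \<pi> ` {..<m}" using s by blast
    qed (use \<pi> in auto)
  qed
  moreover have "r s = r' (\<pi> s) \<and> alg_iso scale (corner (c s)) x scale (corner (c' (\<pi> s))) x"
    if s: "s < m" for s
  proof -
    define t where "t = \<pi> s"
    have t: "t < m'" using \<pi>[OF s] t_def by simp
    obtain p q where pq: "c s \<cdot> p = p" "p \<cdot> c' t = p" "c' t \<cdot> q = q" "q \<cdot> c s = q" "p \<cdot> q = c s"
        "q \<cdot> p = c' t"
      using linkedE[OF conjunct2[OF \<pi>[OF s]], folded t_def] .
    have pqv: "p \<cdot> (q \<cdot> v) = c s \<cdot> v" "q \<cdot> (p \<cdot> v) = c' t \<cdot> v" for v
      using pq by (metis assoc)+
    have "trL (c s) = trL (c' t)"
      using T_sym[of p q] pq by simp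
    moreover have "tr (\<lambda>v. c s \<cdot> v \<cdot> c s) = tr (\<lambda>v. c' t \<cdot> v \<cdot> c' t)"
    proof -
      have "tr (\<lambda>v. c s \<cdot> v \<cdot> c s) = tr (\<lambda>v. p \<cdot> (q \<cdot> v \<cdot> p) \<cdot> q)"
        by (simp add: assoc pqv pq)
      also have "\<dots> = tr (\<lambda>v. q \<cdot> (p \<cdot> v \<cdot> q) \<cdot> p)"
        by (rule tr_comm) (rule linI; simp add: mult_distrib)+
      also have "\<dots> = tr (\<lambda>v. c' t \<cdot> v \<cdot> c' t)"
        by (simp add: assoc pqv pq)
      finally show ?thesis .
    qed
    ultimately have "(of_nat (r s) :: 'k) = of_nat (r' t)"
      using tr_corner[OF F u s] tr_corner[OF F' u t] tr_corner_nonzero[OF D(1)[OF s]] by simp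
    then have "r s = r' t" by simp
    moreover have "alg_iso scale (corner (c s)) x scale (corner (c' t)) x"
      unfolding alg_iso_def
    proof (intro exI[of _ "\<lambda>v. q \<cdot> v \<cdot> p"] conjI ballI allI)
      show "bij_betw (\<lambda>v. q \<cdot> v \<cdot> p) (corner (c s)) (corner (c' t))"
      proof (rule bij_betw_byWitness[where f' = "\<lambda>v. p \<cdot> v \<cdot> q"])
        show "\<forall>v\<in>corner (c s). p \<cdot> (q \<cdot> v \<cdot> p) \<cdot> q = v"
          by (simp add: assoc pqv pq corner_def)
        show "\<forall>v\<in>corner (c' t). q \<cdot> (p \<cdot> v \<cdot> q) \<cdot> p = v"
          by (simp add: assoc pqv pq corner_def)
        show "(\<lambda>v. q \<cdot> v \<cdot> p) ` corner (c s) \<subseteq> corner (c' t)"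
          by (auto simp: corner_def assoc pq) (metis assoc pq(3))
        show "(\<lambda>v. p \<cdot> v \<cdot> q) ` corner (c' t) \<subseteq> corner (c s)"
          by (auto simp: corner_def assoc pq) (metis assoc pq(1))
      qed
      fix v w assume "v \<in> corner (c s)" "w \<in> corner (c s)"
      then show "q \<cdot> (v \<cdot> w) \<cdot> p = (q \<cdot> v \<cdot> p) \<cdot> (q \<cdot> w \<cdot> p)"
        by (simp add: assoc pqv corner_absorb)
    qed (simp_all add: mult_distrib)
    ultimately show ?thesis by (simp add: t_def)
  qed
  ultimately show ?thesis by blast
qed

end

subsection \<open>Sums of matrix algebras\<close>

lemma sum_fun_eval: "(\<Sum>i\<in>I. f i) y = (\<Sum>i\<in>I. f i y)"
  by (induction I rule: infinite_finite_induct) auto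

lemma alg_iso_refl: "alg_iso s A m s A m"
  unfolding alg_iso_def by (intro exI[of _ "\<lambda>v. v"]) (auto simp: bij_betw_def)

lemma alg_iso_trans:
  assumes "alg_iso sA A mA sB B mB" "alg_iso sB B mB sC C mC"
  shows "alg_iso sA A mA sC C mC"
proof -
  obtain f where f: "bij_betw f A B" "\<forall>a\<in>A. \<forall>b\<in>A. f (a + b) = f a + f b"
    "\<forall>t. \<forall>a\<in>A. f (sA t a) = sB t (f a)" "\<forall>a\<in>A. \<forall>b\<in>A. f (mA a b) = mB (f a) (f b)"
    using assms(1) unfolding alg_iso_def by blast
  obtain g where g: "bij_betw g B C" "\<forall>a\<in>B. \<forall>b\<in>B. g (a + b) = g a + g b"
    "\<forall>t. \<forall>a\<in>B. g (sB t a) = sC t (g a)" "\<forall>a\<in>B. \<forall>b\<in>B. g (mB a b) = mC (g a) (g b)"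
    using assms(2) unfolding alg_iso_def by blast
  have "f a \<in> B" if "a \<in> A" for a using f(1) that by (auto simp: bij_betw_def)
  then show ?thesis
    unfolding alg_iso_def
    by (intro exI[of _ "g \<circ> f"]) (use f g bij_betw_trans[OF f(1) g(1)] in auto)
qed

text \<open>Carriers are sets, so closure of \<open>A\<close> is what identifies a sum or product of
  preimages with the preimage of the sum or product.\<close>

lemma alg_iso_sym:
  assumes iso: "alg_iso sA A mA sB B mB"
    and A: "\<And>a b. a \<in> A \<Longrightarrow> b \<in> A \<Longrightarrow> a + b \<in> A" "\<And>t a. a \<in> A \<Longrightarrow> sA t a \<in> A"
      "\<And>a b. a \<in> A \<Longrightarrow> b \<in> A \<Longrightarrow> mA a b \<in> A"
  shows "alg_iso sB B mB sA A mA"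
proof -
  obtain f where f: "bij_betw f A B" "\<And>a b. a \<in> A \<Longrightarrow> b \<in> A \<Longrightarrow> f (a + b) = f a + f b"
    "\<And>t a. a \<in> A \<Longrightarrow> f (sA t a) = sB t (f a)"
    "\<And>a b. a \<in> A \<Longrightarrow> b \<in> A \<Longrightarrow> f (mA a b) = mB (f a) (f b)"
    using iso unfolding alg_iso_def by blast
  let ?g = "inv_into A f"
  have g: "bij_betw ?g B A" using f(1) by (rule bij_betw_inv_into)
  have gA: "?g b \<in> A" if "b \<in> B" for b using g that by (auto simp: bij_betw_def)
  have fg: "f (?g b) = b" if "b \<in> B" for b using f(1) that by (rule bij_betw_inv_into_right)
  have gf: "?g (f a) = a" if "a \<in> A" for a using f(1) that by (rule bij_betw_inv_into_left)
  have "?g (a + b) = ?g a + ?g b" if "a \<in> B" "b \<in> B" for a b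
    using gf[OF A(1)[OF gA[OF that(1)] gA[OF that(2)]]] f(2) gA fg that by simp
  moreover have "?g (sB t a) = sA t (?g a)" if "a \<in> B" for t a
    using gf[OF A(2)[OF gA[OF that(1)]]] f(3) gA fg that by simp
  moreover have "?g (mB a b) = mA (?g a) (?g b)" if "a \<in> B" "b \<in> B" for a b
    using gf[OF A(3)[OF gA[OF that(1)] gA[OF that(2)]]] f(4) gA fg that by simp
  ultimately show ?thesis
    unfolding alg_iso_def using g by blast
qed

text \<open>What the passage to frames uses of a division algebra.\<close>

definition divblk :: "'d::ab_group_add set \<Rightarrow> ('d \<Rightarrow> 'd \<Rightarrow> 'd) \<Rightarrow> bool" where
  "divblk D m \<longleftrightarrow> 0 \<in> D \<and> (\<forall>d\<in>D. m d 0 = 0 \<and> m 0 d = 0) \<and>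
     (\<exists>u\<in>D. u \<noteq> 0 \<and> (\<forall>d\<in>D. m u d = d \<and> m d u = d) \<and>
       (\<forall>d\<in>D. d \<noteq> 0 \<longrightarrow> (\<exists>d'\<in>D. m d d' = u \<and> m d' d = u)))"

definition mat_unit :: "nat \<Rightarrow> nat \<Rightarrow> nat \<Rightarrow> 'd \<Rightarrow> nat \<Rightarrow> nat \<Rightarrow> nat \<Rightarrow> 'd::ab_group_add" where
  "mat_unit s i j d = (\<lambda>s' i' j'. if s' = s \<and> i' = i \<and> j' = j then d else 0)"

context
  fixes bs :: "'d::ab_group_add block list"
  assumes blk: "\<And>s. s < length bs \<Longrightarrow> divblk (blk_carrier (bs ! s)) (blk_mult (bs ! s))"
begin

lemma mat_unit_carrier:
  "in_blocks bs s i j \<Longrightarrow> d \<in> blk_carrier (bs ! s) \<Longrightarrow> mat_unit s i j d \<in> matsum_carrier bs"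
  using blk by (auto simp: matsum_carrier_def mat_unit_def in_blocks_def divblk_def)

lemma mat_unit_mult_left:
  assumes "in_blocks bs s i j" "d \<in> blk_carrier (bs ! s)" "M \<in> matsum_carrier bs"
  shows "matsum_mult bs (mat_unit s i j d) M =
    (\<lambda>s' i' j'. if s' = s \<and> i' = i \<and> in_blocks bs s i j' then blk_mult (bs ! s) d (M s j j') else
        0)"
proof (intro ext)
  fix s' i' j'
  let ?m = "blk_mult (bs ! s')"
  have M: "M s' l j' \<in> blk_carrier (bs ! s')" if "in_blocks bs s' l j'" for l
    using that assms(3) by (auto simp: matsum_carrier_def)
  have m0: "?m 0 (M s' l j') = 0" if "s' < length bs" "l < blk_size (bs ! s')"
      "j' < blk_size (bs ! s')" for l
    using blk[OF that(1)] M[of l] that by (auto simp: divblk_def in_blocks_def)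
  have "(\<Sum>l<blk_size (bs ! s'). ?m (mat_unit s i j d s' i' l) (M s' l j')) =
      (\<Sum>l<blk_size (bs ! s'). if l = j then (if s' = s \<and> i' =
          i then ?m d (M s' j j') else 0) else 0)"
    if "in_blocks bs s' i' j'"
    using that by (intro sum.cong refl) (auto simp: mat_unit_def in_blocks_def m0)
  then show "matsum_mult bs (mat_unit s i j d) M s' i' j' =
      (if s' = s \<and> i' = i \<and> in_blocks bs s i j' then blk_mult (bs ! s) d (M s j j') else 0)"
    using assms(1) by (auto simp: matsum_mult_def in_blocks_def)
qed

lemma mat_unit_mult_right:
  assumes "in_blocks bs s i j" "d \<in> blk_carrier (bs ! s)" "M \<in> matsum_carrier bs"
  shows "matsum_mult bs M (mat_unit s i j d) =
    (\<lambda>s' i' j'. if s' = s \<and> j' = j \<and> in_blocks bs s i' j then blk_mult (bs ! s) (M s i' i) d else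
        0)"
proof (intro ext)
  fix s' i' j'
  let ?m = "blk_mult (bs ! s')"
  have M: "M s' i' l \<in> blk_carrier (bs ! s')" if "in_blocks bs s' i' l" for l
    using that assms(3) by (auto simp: matsum_carrier_def)
  have m0: "?m (M s' i' l) 0 = 0" if "s' < length bs" "l < blk_size (bs ! s')"
      "i' < blk_size (bs ! s')" for l
    using blk[OF that(1)] M[of l] that by (auto simp: divblk_def in_blocks_def)
  have "(\<Sum>l<blk_size (bs ! s'). ?m (M s' i' l) (mat_unit s i j d s' l j')) =
      (\<Sum>l<blk_size (bs ! s'). if l = i then (if s' = s \<and> j' =
          j then ?m (M s' i' i) d else 0) else 0)"
    if "in_blocks bs s' i' j'"
    using that by (intro sum.cong refl) (auto simp: mat_unit_def in_blocks_def m0)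
  then show "matsum_mult bs M (mat_unit s i j d) s' i' j' =
      (if s' = s \<and> j' = j \<and> in_blocks bs s i' j then blk_mult (bs ! s) (M s i' i) d else 0)"
    using assms(1) by (auto simp: matsum_mult_def in_blocks_def)
qed

lemma mat_unit_mult:
  assumes "in_blocks bs s i j" "d \<in> blk_carrier (bs ! s)" "in_blocks bs t k l"
      "d' \<in> blk_carrier (bs ! t)"
  shows "matsum_mult bs (mat_unit s i j d) (mat_unit t k l d') =
    (if s = t \<and> j = k then mat_unit s i l (blk_mult (bs ! s) d d') else 0)"
proof -
  have "blk_mult (bs ! s) d 0 = 0"
    using blk assms(1,2) by (auto simp: divblk_def in_blocks_def)
  then show ?thesis
    using assms
    by (subst mat_unit_mult_left[OF assms(1,2) mat_unit_carrier[OF assms(3,4)]])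
       (auto simp: mat_unit_def in_blocks_def fun_eq_iff)
qed

end

context based_algebra
begin

text \<open>The matrix entries of \<open>v\<close> are \<open>a s i \<cdot> v \<cdot> b s j\<close>,
  read in the given division algebras through \<open>\<theta> s\<close>. Injectivity comes from the
  Peirce decomposition, multiplicativity from inserting the unit between the two factors.\<close>

lemma iso_if_frame:
  fixes sD :: "'k \<Rightarrow> 'd::ab_group_add \<Rightarrow> 'd"
  assumes sD: "\<And>t. sD t 0 = 0"
    and fr: "frame (length bs) (\<lambda>s. blk_size (bs ! s)) a b c"
    and iso: "\<And>s. s < length bs \<Longrightarrow>
      alg_iso scale (corner (c s)) x sD (blk_carrier (bs ! s)) (blk_mult (bs ! s))"
  shows "alg_iso scale UNIV x (matsum_scale sD) (matsum_carrier bs) (matsum_mult bs)"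
proof -
  let ?D = "\<lambda>s. blk_carrier (bs ! s)" and ?m = "\<lambda>s. blk_mult (bs ! s)"
  define r where "r s = blk_size (bs ! s)" for s
  obtain u where u: "is_unit u" and F0: "pframe u (length bs) r a b c"
    using fr unfolding frame_def r_def by blast
  note F = pframeD[OF F0]
  let ?P = "\<lambda>s f. bij_betw f (corner (c s)) (?D s) \<and>
      (\<forall>v\<in>corner (c s). \<forall>w\<in>corner (c s). f (v + w) = f v + f w) \<and>
      (\<forall>t. \<forall>v\<in>corner (c s). f (scale t v) = sD t (f v)) \<and>
      (\<forall>v\<in>corner (c s). \<forall>w\<in>corner (c s). f (v \<cdot> w) = ?m s (f v) (f w))"
  have "\<forall>s. \<exists>f. s < length bs \<longrightarrow> ?P s f"
    using iso unfolding alg_iso_def by simp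
  from choice[OF this] obtain \<theta> where \<theta>': "\<forall>s. s < length bs \<longrightarrow> ?P s (\<theta> s)" ..
  have \<theta>: "bij_betw (\<theta> s) (corner (c s)) (?D s)"
    "v \<in> corner (c s) \<Longrightarrow> w \<in> corner (c s) \<Longrightarrow> \<theta> s (v + w) = \<theta> s v + \<theta> s w"
    "v \<in> corner (c s) \<Longrightarrow> \<theta> s (scale t v) = sD t (\<theta> s v)"
    "v \<in> corner (c s) \<Longrightarrow> w \<in> corner (c s) \<Longrightarrow> \<theta> s (v \<cdot> w) = ?m s (\<theta> s v) (\<theta> s w)"
    if "s < length bs" for s v w t
    using \<theta>' that by simp_all
  have cor: "a s i \<cdot> v \<cdot> b s j \<in> corner (c s)" if "s < length bs" "i < r s" "j < r s" for s i j v
    using that F by (simp add: corner_def assoc)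
  have \<theta>0: "\<theta> s 0 = 0" if "s < length bs" for s
    using \<theta>(2)[OF that, of 0 0] by (simp add: corner_def)
  have \<theta>_sum: "(\<Sum>i\<in>I. f i) \<in> corner (c s) \<and> \<theta> s (\<Sum>i\<in>I. f i) = (\<Sum>i\<in>I. \<theta> s (f i))"
    if "s < length bs" "finite I" "\<And>i. i \<in> I \<Longrightarrow> f i \<in> corner (c s)" for s f and I :: "nat set"
    using that(2,3)
    by (induction I) (auto simp: \<theta>0 \<theta>(2) that(1) subspace_corner subspace_0 subspace_add)
  have mult: "a s i \<cdot> (v \<cdot> w) \<cdot> b s j = (\<Sum>l<r s. (a s i \<cdot> v \<cdot> b s l) \<cdot> (a s l \<cdot> w \<cdot> b s j))"
    if s: "s < length bs" "i < r s" "j < r s" for s i j v w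
  proof -
    have "a s i \<cdot> (v \<cdot> w) \<cdot> b s j = a s i \<cdot> v \<cdot> (u \<cdot> (w \<cdot> b s j))"
      using u by (simp add: assoc is_unit_def)
    also have "\<dots> = (\<Sum>t<length bs. \<Sum>l<r t. (a s i \<cdot> v \<cdot> b t l) \<cdot> (a t l \<cdot> w \<cdot> b s j))"
      unfolding F(11) by (simp add: mult_sum_l mult_sum_r assoc)
    also have "\<dots> = (\<Sum>t<length bs. if s = t then \<Sum>l<r t. (a s i \<cdot> v \<cdot> b t l) \<cdot> (a t l \<cdot> w \<cdot> b s j)
        else 0)"
    proof (intro sum.cong refl)
      fix t assume t: "t \<in> {..<length bs}"
      have "a s i \<cdot> v \<cdot> b t l = c s \<cdot> ((a s i \<cdot> v \<cdot> b t l) \<cdot> c t)" if "l < r t" for l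
        using that t s F(4)[of t l] F(5)[of s i] by (simp add: assoc)
      then show "(\<Sum>l<r t. (a s i \<cdot> v \<cdot> b t l) \<cdot> (a t l \<cdot> w \<cdot> b s j)) =
          (if s = t then \<Sum>l<r t. (a s i \<cdot> v \<cdot> b t l) \<cdot> (a t l \<cdot> w \<cdot> b s j) else 0)"
        using F(9)[OF s(1)] t by (auto intro!: sum.neutral)
    qed
    finally show ?thesis using s by simp
  qed
  define \<Phi> where "\<Phi> v = (\<lambda>s i j. if in_blocks bs s i j then \<theta> s (a s i \<cdot> v \<cdot> b s j) else 0)" for v
  have ib: "in_blocks bs s i j \<longleftrightarrow> s < length bs \<and> i < r s \<and> j < r s" for s i j
    by (simp add: in_blocks_def r_def)
  have "bij_betw \<Phi> UNIV (matsum_carrier bs)"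
  proof (rule bij_betw_imageI)
    show "inj \<Phi>"
    proof (rule injI)
      fix v w assume eq: "\<Phi> v = \<Phi> w"
      have "a s i \<cdot> v \<cdot> b s j = a s i \<cdot> w \<cdot> b s j" if "s < length bs" "i < r s" "j < r s" for s i j
      proof -
        have "\<theta> s (a s i \<cdot> v \<cdot> b s j) = \<theta> s (a s i \<cdot> w \<cdot> b s j)"
          using fun_cong[OF fun_cong[OF fun_cong[OF eq, of s], of i], of j] that by
              (simp add: \<Phi>_def ib)
        then show ?thesis
          using \<theta>(1)[OF that(1)] cor[OF that] by (auto simp: bij_betw_def inj_on_def)
      qed
      then have "(\<Sum>s<length bs. \<Sum>i<r s. \<Sum>j<r s. b s i \<cdot> (a s i \<cdot> v \<cdot> b s j) \<cdot> a s j) =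
          (\<Sum>s<length bs. \<Sum>i<r s. \<Sum>j<r s. b s i \<cdot> (a s i \<cdot> w \<cdot> b s j) \<cdot> a s j)"
        by simp
      then show "v = w" using frame_expand[OF u F0] by metis
    qed
    show "\<Phi> ` UNIV = matsum_carrier bs"
    proof safe
      fix v
      show "\<Phi> v \<in> matsum_carrier bs"
        using bij_betw_apply[OF \<theta>(1)] cor by (simp add: matsum_carrier_def \<Phi>_def ib)
    next
      fix M assume M: "M \<in> matsum_carrier bs"
      have "\<exists>w. w \<in> corner (c s) \<and> \<theta> s w = M s i j" if "s < length bs" "i < r s" "j < r s" for s i j
      proof -
        have "M s i j \<in> ?D s" using M that by (auto simp: matsum_carrier_def ib)
        then show ?thesis using \<theta>(1)[OF that(1)] unfolding bij_betw_def by (metis imageE)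
      qed
      then obtain w where w: "\<And>s i j. s < length bs \<Longrightarrow> i < r s \<Longrightarrow> j < r s \<Longrightarrow>
          w s i j \<in> corner (c s) \<and> \<theta> s (w s i j) = M s i j"
        by metis
      \<comment> \<open>The preimage of \<open>M\<close> is assembled from matrix units; multiplying
        by \<open>a s i\<close> and \<open>b s j\<close> on the two sides extracts a single
        summand.\<close>
      define v where "v = (\<Sum>t<length bs. \<Sum>k<r t. \<Sum>l<r t. b t k \<cdot> w t k l \<cdot> a t l)"
      have "a s i \<cdot> v \<cdot> b s j = w s i j" if s: "s < length bs" "i < r s" "j < r s" for s i j
      proof -
        have "a s i \<cdot> v \<cdot> b s j = (\<Sum>t<length bs. \<Sum>k<r t. \<Sum>l<r t. a s i \<cdot> (b t k \<cdot> (w t k l \<cdot> (a t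
            l \<cdot> b s j))))"
          by (simp add: v_def mult_sum_l mult_sum_r assoc)
        also have "\<dots> = (\<Sum>t<length bs. \<Sum>k<r t. \<Sum>l<r t. if l = j then
            (if s = t \<and> i = k then w s i j else 0) else 0)"
          using s w F by (intro sum.cong refl) (auto simp: cornerD corner_absorb)
        also have "\<dots> = (\<Sum>t<length bs. \<Sum>k<r t. if k = i then (if s = t then w s i j else 0) else 0)"
          using s by (intro sum.cong refl) (auto simp: if_distrib cong: if_cong)
        also have "\<dots> = (\<Sum>t<length bs. if s = t then w s i j else 0)"
          using s by (intro sum.cong refl) (auto)
        also have "\<dots> = w s i j" using s by simp
        finally show ?thesis .
      qed
      then have "\<Phi> v = M"
        using w M by (auto simp: \<Phi>_def ib fun_eq_iff matsum_carrier_def)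
      then show "M \<in> range \<Phi>" by blast
    qed
  qed
  moreover have "\<Phi> (v + w) = \<Phi> v + \<Phi> w" for v w
    by (auto simp: \<Phi>_def fun_eq_iff ib mult_distrib \<theta>(2) cor)
  moreover have "\<Phi> (scale t v) = matsum_scale sD t (\<Phi> v)" for t v
    by (auto simp: \<Phi>_def fun_eq_iff ib mult_distrib \<theta>(3) cor matsum_scale_def sD)
  moreover have "\<Phi> (v \<cdot> w) = matsum_mult bs (\<Phi> v) (\<Phi> w)" for v w
  proof (intro ext)
    fix s i j
    show "\<Phi> (v \<cdot> w) s i j = matsum_mult bs (\<Phi> v) (\<Phi> w) s i j"
    proof (cases "in_blocks bs s i j")
      case True
      then have s: "s < length bs" "i < r s" "j < r s" by (auto simp: ib)
      have "\<theta> s (\<Sum>l<r s. (a s i \<cdot> v \<cdot> b s l) \<cdot> (a s l \<cdot> w \<cdot> b s j)) =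
          (\<Sum>l<r s. \<theta> s ((a s i \<cdot> v \<cdot> b s l) \<cdot> (a s l \<cdot> w \<cdot> b s j)))"
        using s by (intro \<theta>_sum[THEN conjunct2] corner_mult cor) auto
      then have "\<theta> s (a s i \<cdot> (v \<cdot> w) \<cdot> b s j) =
          (\<Sum>l<r s. ?m s (\<theta> s (a s i \<cdot> v \<cdot> b s l)) (\<theta> s (a s l \<cdot> w \<cdot> b s j)))"
        unfolding mult[OF s] using s by (simp add: \<theta>(4) cor)
      then show ?thesis using s by (simp add: \<Phi>_def matsum_mult_def ib flip: r_def)
    qed (simp add: \<Phi>_def matsum_mult_def)
  qed
  ultimately show ?thesis unfolding alg_iso_def by blast
qed

text \<open>The matrix units are pulled back to elements \<open>E s i j\<close>. Row 0 supplies the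
  \<open>a s i\<close>, column 0 the \<open>b s i\<close> and the entry at (0, 0) the
  \<open>c s\<close>; \<open>pos\<close> guarantees that the index 0 exists in each block.\<close>

lemma frame_if_iso:
  fixes sD :: "'k \<Rightarrow> 'd::ab_group_add \<Rightarrow> 'd"
  assumes blk: "\<And>s. s < length bs \<Longrightarrow> divblk (blk_carrier (bs ! s)) (blk_mult (bs ! s))"
    and pos: "\<And>s. s < length bs \<Longrightarrow> 0 < blk_size (bs ! s)"
    and iso: "alg_iso scale UNIV x (matsum_scale sD) (matsum_carrier bs) (matsum_mult bs)"
  shows "\<exists>a b c. frame (length bs) (\<lambda>s. blk_size (bs ! s)) a b c \<and>
    (\<forall>s<length bs. alg_iso scale (corner (c s)) x sD (blk_carrier (bs ! s)) (blk_mult (bs ! s)))"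
proof -
  let ?D = "\<lambda>s. blk_carrier (bs ! s)" and ?m = "\<lambda>s. blk_mult (bs ! s)"
  define r where "r s = blk_size (bs ! s)" for s
  have ib: "in_blocks bs s i j \<longleftrightarrow> s < length bs \<and> i < r s \<and> j < r s" for s i j
    by (simp add: in_blocks_def r_def)
  have r0: "0 < r s" if "s < length bs" for s using pos that by (simp add: r_def)
  obtain \<phi> where \<phi>: "bij_betw \<phi> UNIV (matsum_carrier bs)" "\<And>v w. \<phi> (v + w) = \<phi> v + \<phi> w"
    "\<And>t v. \<phi> (scale t v) = matsum_scale sD t (\<phi> v)" "\<And>v w. \<phi> (v \<cdot> w) = matsum_mult bs (\<phi> v) (\<phi> w)"
    using iso unfolding alg_iso_def by auto
  define \<psi> where "\<psi> = inv_into UNIV \<phi>"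
  have \<phi>\<psi>: "\<phi> (\<psi> M) = M" if "M \<in> matsum_carrier bs" for M
    using bij_betw_inv_into_right[OF \<phi>(1) that] by (simp add: \<psi>_def)
  have \<phi>C: "\<phi> v \<in> matsum_carrier bs" for v using \<phi>(1) by (auto simp: bij_betw_def)
  have \<phi>eq: "\<phi> v = \<phi> w \<longleftrightarrow> v = w" for v w using \<phi>(1) by (auto simp: bij_betw_def inj_on_def)
  have \<phi>0: "\<phi> 0 = 0" using \<phi>(2)[of 0 0] by simp
  have \<phi>_sum: "\<phi> (\<Sum>i\<in>I. f i) = (\<Sum>i\<in>I. \<phi> (f i))" for f and I :: "nat set"
    by (induction I rule: infinite_finite_induct) (simp_all add: \<phi>0 \<phi>(2))
  let ?P = "\<lambda>s u. u \<in> ?D s \<and> u \<noteq> 0 \<and>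
     (\<forall>d\<in>?D s. ?m s u d = d \<and> ?m s d u = d) \<and>
     (\<forall>d\<in>?D s. d \<noteq> 0 \<longrightarrow>
       (\<exists>d'\<in>?D s. ?m s d d' = u \<and> ?m s d' d = u))"
  have "\<forall>s. \<exists>u. s < length bs \<longrightarrow> ?P s u"
    using blk unfolding divblk_def Bex_def by simp
  from choice[OF this] obtain u where u': "\<forall>s. s < length bs \<longrightarrow> ?P s (u s)" ..
  have u: "u s \<in> ?D s" "u s \<noteq> 0"
    "d \<in> ?D s \<Longrightarrow> ?m s (u s) d = d"
    "d \<in> ?D s \<Longrightarrow> ?m s d (u s) = d"
    "d \<in> ?D s \<Longrightarrow> d \<noteq> 0 \<Longrightarrow>
       \<exists>d'\<in>?D s. ?m s d d' = u s \<and> ?m s d' d = u s"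
    if "s < length bs" for s d
    using u' that by simp_all
  define E where "E s i j = \<psi> (mat_unit s i j (u s))" for s i j
  have \<phi>E: "\<phi> (E s i j) = mat_unit s i j (u s)" if "s < length bs" "i < r s" "j < r s" for s i j
    using that u(1) by (simp add: E_def \<phi>\<psi> mat_unit_carrier[OF blk] ib)
  have EE: "E s i j \<cdot> E t k l = (if s = t \<and> j = k then E s i l else 0)"
    if "s < length bs" "i < r s" "j < r s" "t < length bs" "k < r t" "l < r t" for s i j t k l
  proof -
    have "\<phi> (E s i j \<cdot> E t k l) = \<phi> (if s = t \<and> j = k then E s i l else 0)"
      using that u by (cases "s = t \<and> j = k") (auto simp: \<phi>(4) \<phi>E \<phi>0 mat_unit_mult[OF blk] ib)
    then show ?thesis by (simp only: \<phi>eq)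
  qed
  have left: "\<phi> (E s i j \<cdot> v) = (\<lambda>s' i' j'. if s' = s \<and> i' = i \<and>
      in_blocks bs s i j' then \<phi> v s j j' else 0)"
    if "s < length bs" "i < r s" "j < r s" for s i j v
  proof -
    have "\<phi> v s j j' \<in> ?D s" if "in_blocks bs s i j'" for j'
      using \<phi>C[of v] that \<open>j < r s\<close> by (auto simp: matsum_carrier_def ib)
    then show ?thesis
      using that u(1,3)
      by (auto simp: \<phi>(4) \<phi>E mat_unit_mult_left[OF blk] ib \<phi>C fun_eq_iff)
  qed
  have right: "\<phi> (v \<cdot> E s i j) = (\<lambda>s' i' j'. if s' = s \<and> j' = j \<and>
      in_blocks bs s i' j then \<phi> v s i' i else 0)"
    if "s < length bs" "i < r s" "j < r s" for s i j v
  proof -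
    have "\<phi> v s i' i \<in> ?D s" if "in_blocks bs s i' j" for i'
      using \<phi>C[of v] that \<open>i < r s\<close> by (auto simp: matsum_carrier_def ib)
    then show ?thesis
      using that u(1,4)
      by (auto simp: \<phi>(4) \<phi>E mat_unit_mult_right[OF blk] ib \<phi>C fun_eq_iff)
  qed
  let ?c = "\<lambda>s. E s 0 0"
  have corner: "v \<in> corner (?c s) \<longleftrightarrow> \<phi> v = mat_unit s 0 0 (\<phi> v s 0 0)" if s: "s < length bs" for s v
  proof
    assume "v \<in> corner (?c s)"
    then have "?c s \<cdot> (v \<cdot> ?c s) = v" by (simp add: corner_def)
    then have "\<phi> v = \<phi> (?c s \<cdot> (v \<cdot> ?c s))" by simp
    also have "\<dots> = mat_unit s 0 0 (\<phi> v s 0 0)"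
      using s r0[OF s] by (auto simp: left right mat_unit_def fun_eq_iff ib)
    finally show "\<phi> v = mat_unit s 0 0 (\<phi> v s 0 0)" .
  next
    assume *: "\<phi> v = mat_unit s 0 0 (\<phi> v s 0 0)"
    then have z: "\<phi> v s' i' j' = 0" if "\<not> (s' = s \<and> i' = 0 \<and> j' = 0)" for s' i' j'
    proof -
      have "\<phi> v s' i' j' = mat_unit s 0 0 (\<phi> v s 0 0) s' i' j'"
        by (rule fun_cong[OF fun_cong[OF fun_cong[OF *]]])
      also have "\<dots> = 0" using that by (auto simp: mat_unit_def)
      finally show ?thesis .
    qed
    have "\<phi> (?c s \<cdot> v) = \<phi> v" "\<phi> (v \<cdot> ?c s) = \<phi> v"
      using s r0[OF s] z by (auto simp: left right fun_eq_iff ib)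
    then show "v \<in> corner (?c s)" by (simp add: \<phi>eq corner_def)
  qed
  have div: "division_idem (?c s)" if s: "s < length bs" for s
    unfolding division_idem_def
  proof (intro conjI ballI impI)
    show "?c s \<cdot> ?c s = ?c s" using EE[of s 0 0 s 0 0] s r0[OF s] by simp
    show "?c s \<noteq> 0"
    proof
      assume "?c s = 0"
      then have "mat_unit s 0 0 (u s) = 0" using \<phi>E[OF s r0[OF s] r0[OF s]] \<phi>0 by simp
      then have "mat_unit s 0 0 (u s) s 0 0 = 0" by simp
      then show False using u(2)[OF s] by (simp add: mat_unit_def)
    qed
    fix d assume d: "d \<in> corner (?c s)" "d \<noteq> 0"
    let ?d = "\<phi> d s 0 0"
    have \<phi>d: "\<phi> d = mat_unit s 0 0 ?d" using corner[OF s] d(1) by blast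
    have "?d \<noteq> 0"
    proof
      assume "?d = 0"
      then have "\<phi> d = 0" using \<phi>d by (auto simp: mat_unit_def fun_eq_iff)
      then show False using d(2) \<phi>eq[of d 0] \<phi>0 by simp
    qed
    moreover have dD: "?d \<in> ?D s"
      using \<phi>C[of d] s r0[OF s] by (auto simp: matsum_carrier_def ib)
    ultimately obtain d' where d': "d' \<in> ?D s" "?m s ?d d' = u s"
      "?m s d' ?d = u s"
      using u(5)[OF s] by blast
    let ?e = "\<psi> (mat_unit s 0 0 d')"
    have ibs: "in_blocks bs s 0 0" using s r0[OF s] by (simp add: ib)
    have \<phi>e: "\<phi> ?e = mat_unit s 0 0 d'"
      by (rule \<phi>\<psi>[OF mat_unit_carrier[OF blk ibs d'(1)]])
    then have "?e \<in> corner (?c s)" by (simp add: corner[OF s] mat_unit_def)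
    moreover have "\<phi> (d \<cdot> ?e) = mat_unit s 0 0 (u s)"
      unfolding \<phi>(4) \<phi>e by (subst \<phi>d) (simp add: mat_unit_mult[OF blk ibs dD ibs d'(1)] d')
    moreover have "\<phi> (?e \<cdot> d) = mat_unit s 0 0 (u s)"
      unfolding \<phi>(4) \<phi>e by (subst \<phi>d) (simp add: mat_unit_mult[OF blk ibs d'(1) ibs dD] d')
    ultimately show "\<exists>d'\<in>corner (?c s). d \<cdot> d' = ?c s \<and> d' \<cdot> d = ?c s"
      using \<phi>E[OF s r0[OF s] r0[OF s]] \<phi>eq by metis
  qed
  let ?u = "\<Sum>s<length bs. \<Sum>i<r s. E s i 0 \<cdot> E s 0 i"
  have u_eq: "?u = (\<Sum>s<length bs. \<Sum>i<r s. E s i i)"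
    using r0 by (intro sum.cong refl) (simp add: EE)
  have "is_unit ?u"
    unfolding is_unit_def
  proof
    fix v
    have "\<phi> (?u \<cdot> v) = \<phi> v"
    proof (intro ext)
      fix s i j
      have "\<phi> (?u \<cdot> v) s i j = (\<Sum>t<length bs. \<Sum>k<r t. \<phi> (E t k k \<cdot> v) s i j)"
        by (simp add: u_eq mult_sum_l \<phi>_sum sum_fun_eval)
      also have "\<dots> = (\<Sum>t<length bs. \<Sum>k<r t. if k = i then (if t = s then \<phi> v s i j else 0) else 0)"
        using \<phi>C[of v] by (intro sum.cong refl) (auto simp: left ib matsum_carrier_def)
      also have "\<dots> = (\<Sum>t<length bs. if t = s then (if i < r s then \<phi> v s i j else 0) else 0)"
        by (intro sum.cong refl) auto
      also have "\<dots> = \<phi> v s i j"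
        using \<phi>C[of v] by (auto simp: matsum_carrier_def ib)
      finally show "\<phi> (?u \<cdot> v) s i j = \<phi> v s i j" .
    qed
    moreover have "\<phi> (v \<cdot> ?u) = \<phi> v"
    proof (intro ext)
      fix s i j
      have "\<phi> (v \<cdot> ?u) s i j = (\<Sum>t<length bs. \<Sum>k<r t. \<phi> (v \<cdot> E t k k) s i j)"
        by (simp add: u_eq mult_sum_r \<phi>_sum sum_fun_eval)
      also have "\<dots> = (\<Sum>t<length bs. \<Sum>k<r t. if k = j then (if t = s then \<phi> v s i j else 0) else 0)"
        using \<phi>C[of v] by (intro sum.cong refl) (auto simp: right ib matsum_carrier_def)
      also have "\<dots> = (\<Sum>t<length bs. if t = s then (if j < r s then \<phi> v s i j else 0) else 0)"
        by (intro sum.cong refl) auto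
      also have "\<dots> = \<phi> v s i j"
        using \<phi>C[of v] by (auto simp: matsum_carrier_def ib)
      finally show "\<phi> (v \<cdot> ?u) s i j = \<phi> v s i j" .
    qed
    ultimately show "?u \<cdot> v = v \<and> v \<cdot> ?u = v" by (simp add: \<phi>eq)
  qed
  moreover have "pframe ?u (length bs) r (\<lambda>s i. E s 0 i) (\<lambda>s i. E s i 0) ?c"
    unfolding pframe_def
  proof (intro conjI allI impI)
    fix s t v assume "s < length bs" "t < length bs" "s \<noteq> t"
    then show "?c s \<cdot> (v \<cdot> ?c t) = 0"
      using r0 by (subst \<phi>eq[symmetric]) (auto simp: left right \<phi>0 fun_eq_iff)
  qed (use div r0 EE in auto)
  moreover have "alg_iso scale (corner (?c s)) x sD (?D s) (?m s)"
    if s: "s < length bs" for s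
    unfolding alg_iso_def
  proof (intro exI[of _ "\<lambda>v. \<phi> v s 0 0"] conjI ballI allI)
    have ibs: "in_blocks bs s 0 0" using s r0[OF s] by (simp add: ib)
    have \<phi>D: "\<phi> v s 0 0 \<in> ?D s" for v
      using \<phi>C[of v] ibs by (auto simp: matsum_carrier_def)
    show "bij_betw (\<lambda>v. \<phi> v s 0 0) (corner (?c s)) (?D s)"
    proof (rule bij_betw_imageI)
      show "inj_on (\<lambda>v. \<phi> v s 0 0) (corner (?c s))"
      proof (rule inj_onI)
        fix v w assume vw: "v \<in> corner (?c s)" "w \<in> corner (?c s)" and eq: "\<phi> v s 0 0 = \<phi> w s 0 0"
        have "\<phi> v = mat_unit s 0 0 (\<phi> v s 0 0)" using corner[OF s] vw(1) by blast
        also have "\<dots> = mat_unit s 0 0 (\<phi> w s 0 0)" by (simp only: eq)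
        also have "\<dots> = \<phi> w" using corner[OF s] vw(2) by (metis (no_types))
        finally show "v = w" by (simp only: \<phi>eq)
      qed
      show "(\<lambda>v. \<phi> v s 0 0) ` corner (?c s) = ?D s"
      proof safe
        fix d assume d: "d \<in> ?D s"
        let ?e = "\<psi> (mat_unit s 0 0 d)"
        have \<phi>e: "\<phi> ?e = mat_unit s 0 0 d"
          by (rule \<phi>\<psi>[OF mat_unit_carrier[OF blk ibs d]])
        then have "?e \<in> corner (?c s)" by (simp add: corner[OF s] mat_unit_def)
        moreover have "\<phi> ?e s 0 0 = d" unfolding \<phi>e by (simp add: mat_unit_def)
        ultimately show "d \<in> (\<lambda>v. \<phi> v s 0 0) ` corner (?c s)" by force
      qed (use \<phi>D in auto)
    qed
    fix v w assume vw: "v \<in> corner (?c s)" "w \<in> corner (?c s)"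
    show "\<phi> (v \<cdot> w) s 0 0 = ?m s (\<phi> v s 0 0) (\<phi> w s 0 0)"
      unfolding \<phi>(4)
      by (subst corner[OF s, THEN iffD1, OF vw(1)], subst corner[OF s, THEN iffD1, OF vw(2)])
         (simp add: mat_unit_mult[OF blk ibs \<phi>D ibs \<phi>D], simp add: mat_unit_def)
  qed (simp_all add: \<phi>(2,3) matsum_scale_def)
  ultimately show ?thesis unfolding frame_def r_def by blast
qed

end

subsection \<open>Wedderburn types\<close>

text \<open>Types are compared as multisets while frames are indexed by numbers; this translates
  between the two kinds of matching.\<close>

lemma rel_mset_iff_bij:
  "rel_mset R (mset xs) (mset ys) \<longleftrightarrow>
    (\<exists>\<pi>. bij_betw \<pi> {..<length xs} {..<length ys} \<and> (\<forall>s<length xs. R (xs ! s) (ys ! \<pi> s)))"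
proof
  assume "rel_mset R (mset xs) (mset ys)"
  then obtain xs' ys' where "list_all2 R xs' ys'" "mset xs = mset xs'" "mset ys' = mset ys"
    unfolding rel_mset_def by metis
  then obtain zs where zs: "list_all2 R xs zs" "mset zs = mset ys"
    using list_all2_reorder_left_invariance by metis
  obtain \<pi> where \<pi>: "bij_betw \<pi> {..<length zs} {..<length ys}" "\<forall>i<length zs. zs ! i = ys ! \<pi> i"
    using permutation_Ex_bij[OF zs(2)] by blast
  then show "\<exists>\<pi>. bij_betw \<pi> {..<length xs} {..<length ys} \<and> (\<forall>s<length xs. R (xs ! s) (ys ! \<pi> s))"
    using zs(1) by (auto simp: list_all2_conv_all_nth)
next
  assume "\<exists>\<pi>. bij_betw \<pi> {..<length xs} {..<length ys} \<and> (\<forall>s<length xs. R (xs ! s) (ys ! \<pi> s))"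
  then obtain \<pi> where \<pi>: "bij_betw \<pi> {..<length xs} {..<length ys}"
    "\<forall>s<length xs. R (xs ! s) (ys ! \<pi> s)" by blast
  let ?zs = "map (\<lambda>s. ys ! \<pi> s) [0..<length xs]"
  have "mset ?zs = image_mset (\<lambda>s. ys ! s) (image_mset \<pi> (mset_set {..<length xs}))"
    by (simp add: image_mset.compositionality comp_def lessThan_atLeast0)
  also have "image_mset \<pi> (mset_set {..<length xs}) = mset_set {..<length ys}"
    using \<pi>(1) by (simp add: image_mset_mset_set bij_betw_def)
  also have "image_mset (\<lambda>s. ys ! s) (mset_set {..<length ys}) =
      mset (map ((!) ys) [0..<length ys])"
    by (simp add: lessThan_atLeast0)
  also have "\<dots> = mset ys" by (simp only: map_nth)
  finally have "mset ?zs = mset ys" .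
  moreover have "list_all2 R xs ?zs"
    using \<pi>(2) by (simp add: list_all2_conv_all_nth)
  ultimately show "rel_mset R (mset xs) (mset ys)"
    unfolding rel_mset_def by blast
qed

lemma kspace_closed:
  "0 \<in> kspace d" "a \<in> kspace d \<Longrightarrow> b \<in> kspace d \<Longrightarrow> a + b \<in> kspace d" "a \<in> kspace d \<Longrightarrow>
      kscale t a \<in> kspace d"
  by (auto simp: kspace_def kscale_def)

lemma kspace_sum: "(\<And>i. i \<in> I \<Longrightarrow> f i \<in> kspace d) \<Longrightarrow> (\<Sum>i\<in>I. f i) \<in> kspace d"
  by (induction I rule: infinite_finite_induct) (auto simp: kspace_closed)

definition kunit :: "nat \<Rightarrow> nat \<Rightarrow> 'k::field" where
  "kunit j = (\<lambda>i. if i = j then 1 else 0)"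

lemma kunit_kspace: "j < d \<Longrightarrow> kunit j \<in> kspace d"
  by (auto simp: kunit_def kspace_def)

lemma kspace_expand: "a \<in> kspace d \<Longrightarrow> a = (\<Sum>j<d. kscale (a j) (kunit j))"
  by (auto simp: fun_eq_iff sum_fun_eval kscale_def kunit_def kspace_def if_distrib cong: if_cong)

lemma divblk_field: "divblk (UNIV :: 'k::field set) (*)"
proof -
  have "\<exists>d'. d * d' = 1 \<and> d' * d = 1" if "d \<noteq> 0" for d :: 'k
    using that by (intro exI[of _ "inverse d"]) simp
  then show ?thesis unfolding divblk_def by (simp del: mult_cancel_left mult_cancel_right)
      (metis mult_1 mult_1_right zero_neq_one)
qed

locale division_alg =
  fixes d :: nat and m :: "(nat \<Rightarrow> 'k::field) \<Rightarrow> (nat \<Rightarrow> 'k) \<Rightarrow> (nat \<Rightarrow> 'k)"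
  assumes division: "division_algebra d m"
begin

lemma closed: "a \<in> kspace d \<Longrightarrow> b \<in> kspace d \<Longrightarrow> m a b \<in> kspace d"
  and add_l: "a \<in> kspace d \<Longrightarrow> b \<in> kspace d \<Longrightarrow> c \<in> kspace d \<Longrightarrow> m (a + b) c = m a c + m b c"
  and add_r: "a \<in> kspace d \<Longrightarrow> b \<in> kspace d \<Longrightarrow> c \<in> kspace d \<Longrightarrow> m a (b + c) = m a b + m a c"
  and m_assoc: "a \<in> kspace d \<Longrightarrow> b \<in> kspace d \<Longrightarrow> c \<in> kspace d \<Longrightarrow> m (m a b) c = m a (m b c)"
  and scale_l: "a \<in> kspace d \<Longrightarrow> b \<in> kspace d \<Longrightarrow> m (kscale t a) b = kscale t (m a b)"
  and scale_r: "a \<in> kspace d \<Longrightarrow> b \<in> kspace d \<Longrightarrow> m a (kscale t b) = kscale t (m a b)"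
  using division unfolding division_algebra_def by blast+

lemma zero_l: "a \<in> kspace d \<Longrightarrow> m 0 a = 0"
  using add_l[of 0 0 a] by (simp add: kspace_closed)

lemma zero_r: "a \<in> kspace d \<Longrightarrow> m a 0 = 0"
  using add_r[of a 0 0] by (simp add: kspace_closed)

lemma sum_l: "(\<And>i. i \<in> I \<Longrightarrow> f i \<in> kspace d) \<Longrightarrow> a \<in> kspace d \<Longrightarrow> m (\<Sum>i\<in>I. f i) a = (\<Sum>i\<in>I. m (f i) a)"
  by (induction I rule: infinite_finite_induct) (auto simp: zero_l add_l kspace_sum)

lemma sum_r: "(\<And>i. i \<in> I \<Longrightarrow> f i \<in> kspace d) \<Longrightarrow> a \<in> kspace d \<Longrightarrow> m a (\<Sum>i\<in>I. f i) = (\<Sum>i\<in>I. m a (f i))"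
  by (induction I rule: infinite_finite_induct) (auto simp: zero_r add_r kspace_sum)

lemma divblk: "divblk (kspace d) m"
  using division zero_l zero_r unfolding divblk_def division_algebra_def
  by (auto simp: kspace_closed)

text \<open>An eigenvalue of the left multiplication by \<open>a\<close> makes \<open>a\<close> a scalar.\<close>

lemma alg_closed_trivial:
  assumes ac: "is_alg_closed TYPE('k)"
  shows "d = 1" "alg_iso (*) UNIV (*) kscale (kspace d) m"
proof -
  obtain u where u: "u \<in> kspace d" "u \<noteq> 0" "\<And>a. a \<in> kspace d \<Longrightarrow> m u a = a"
    "\<And>a. a \<in> kspace d \<Longrightarrow> m a u = a"
    "\<And>a. a \<in> kspace d \<Longrightarrow> a \<noteq> 0 \<Longrightarrow> \<exists>b\<in>kspace d. m a b = u \<and> m b a = u"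
    using division unfolding division_algebra_def by blast
  have "d \<noteq> 0"
    using u(1,2) by (auto simp: kspace_def fun_eq_iff)
  have scalar: "\<exists>t. a = kscale t u" if a: "a \<in> kspace d" for a
  proof -
    \<comment> \<open>The matrix of left multiplication by \<open>a\<close> in the standard basis;
      \<open>w\<close> below is an eigenvector of it, extended by 0.\<close>
    let ?A = "mat d d (\<lambda>(i, j). m a (kunit j) i)"
    have A: "?A \<in> carrier_mat d d" by simp
    obtain t where "poly (char_poly ?A) t = 0"
    proof -
      have "degree (char_poly ?A) > 0" using degree_monic_char_poly[OF A] \<open>d \<noteq> 0\<close> by simp
      then show ?thesis using ac that unfolding is_alg_closed_def by blast
    qed
    then have "eigenvalue ?A t"
      using eigenvalue_root_char_poly[OF A] by blast
    then obtain v where v: "v \<in> carrier_vec d" "v \<noteq> 0\<^sub>v d" "?A *\<^sub>v v = t \<cdot>\<^sub>v v"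
      by (auto simp: eigenvalue_def eigenvector_def)
    define w where "w i = (if i < d then v $ i else 0)" for i
    have w: "w \<in> kspace d" by (simp add: w_def kspace_def)
    have "w \<noteq> 0"
    proof
      assume "w = 0"
      then have "v $ i = 0" if "i < d" for i using that by (metis w_def zero_fun_apply)
      then show False using v(1,2) by (auto intro!: eq_vecI)
    qed
    have aw: "m a w = kscale t w"
    proof
      fix i
      have "m a w = (\<Sum>j<d. kscale (w j) (m a (kunit j)))"
        by (subst kspace_expand[OF w], subst sum_r)
           (auto simp: a scale_r kunit_kspace kspace_closed)
      then have *: "m a w i = (\<Sum>j<d. w j * m a (kunit j) i)"
        by (simp add: sum_fun_eval kscale_def)
      show "m a w i = kscale t w i"
      proof (cases "i < d")
        case True
        then have "(?A *\<^sub>v v) $ i = (\<Sum>j<d. m a (kunit j) i * v $ j)"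
          using v(1) by (simp add: scalar_prod_def lessThan_atLeast0)
        moreover have "(?A *\<^sub>v v) $ i = t * v $ i"
          using v(1,3) True by simp
        ultimately show ?thesis
          using True unfolding * by (simp add: kscale_def w_def mult.commute)
      next
        case False
        then show ?thesis using closed[OF a w] by (simp add: kspace_def kscale_def w_def)
      qed
    qed
    \<comment> \<open>\<open>a\<close> minus \<open>t\<close> times the unit kills the nonzero
      \<open>w\<close>, so it has no inverse and must be 0.\<close>
    let ?b = "a + kscale (- t) u"
    have b: "?b \<in> kspace d" by (simp add: kspace_closed a u)
    have "m ?b w = 0"
      by (simp add: add_l a u kspace_closed w aw scale_l) (simp add: fun_eq_iff kscale_def)
    moreover have "m b' (m ?b w) = w" if "b' \<in> kspace d" "m b' ?b = u" for b'
      using m_assoc[OF that(1) b w] that(2) u(3)[OF w] by simp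
    ultimately have "?b = 0"
      using u(5)[OF b] zero_r \<open>w \<noteq> 0\<close> by metis
    then have "a = kscale t u"
      by (auto simp: fun_eq_iff kscale_def)
    then show ?thesis by blast
  qed
  show "d = 1"
  proof (rule ccontr)
    assume "d \<noteq> 1"
    then have d: "0 < d" "1 < d" using \<open>d \<noteq> 0\<close> by auto
    obtain t where t: "kunit 0 = kscale t u" using scalar kunit_kspace[OF d(1)] by blast
    obtain t' where t': "kunit 1 = kscale t' u" using scalar kunit_kspace[OF d(2)] by blast
    have "t * u 0 = 1" "t * u 1 = 0" "t' * u 1 = 1"
      using fun_cong[OF t, of 0] fun_cong[OF t, of 1] fun_cong[OF t', of 1]
      by (simp_all add: kunit_def kscale_def)
    then show False by auto
  qed
  show "alg_iso (*) UNIV (*) kscale (kspace d) m"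
    unfolding alg_iso_def
  proof (intro exI[of _ "\<lambda>t. kscale t u"] conjI ballI allI)
    show "bij_betw (\<lambda>t. kscale t u) UNIV (kspace d)"
    proof (rule bij_betw_imageI)
      obtain i where "u i \<noteq> 0" using u(2) by (auto simp: fun_eq_iff)
      then show "inj (\<lambda>t. kscale t u)"
        by (intro injI) (metis kscale_def mult_right_cancel)
      show "range (\<lambda>t. kscale t u) = kspace d"
        using scalar u(1) by (auto simp: kspace_closed)
    qed
    fix a b :: 'k
    show "kscale (a * b) u = m (kscale a u) (kscale b u)"
      using u by (simp add: scale_l scale_r kspace_closed)
          (simp add: kscale_def mult.assoc fun_eq_iff)
  qed (auto simp: kscale_def fun_eq_iff algebra_simps)
qed

end

lemma wtype_blocks_nth:
  assumes "s < length W"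
  shows "blk_size (wtype_blocks W ! s) = fst (W ! s)"
    "blk_carrier (wtype_blocks W ! s) = kspace (fst (snd (W ! s)))"
    "blk_mult (wtype_blocks W ! s) = snd (snd (W ! s))"
  using assms by (auto simp: wtype_blocks_def blk_size_def blk_carrier_def blk_mult_def split:
      prod.split)

lemma length_wtype_blocks [simp]: "length (wtype_blocks W) = length W"
  by (simp add: wtype_blocks_def)

lemma scalar_blocks_nth:
  assumes "s < length rs"
  shows "blk_size (scalar_blocks rs ! s) = rs ! s"
    "blk_carrier (scalar_blocks rs ! s) = UNIV" "blk_mult (scalar_blocks rs ! s) = (*)"
  using assms by (auto simp: scalar_blocks_def blk_size_def blk_carrier_def blk_mult_def)

lemma length_scalar_blocks [simp]: "length (scalar_blocks rs) = length rs"
  by (simp add: scalar_blocks_def)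

lemma wtypes_iff:
  "W \<in> wtypes n \<longleftrightarrow> (\<forall>s<length W. 0 < fst (W ! s) \<and> division_algebra (fst (snd (W ! s))) (snd (snd
      (W ! s)))) \<and>
    (\<Sum>s<length W. (fst (W ! s))\<^sup>2 * fst (snd (W ! s))) = n"
proof -
  have "(\<Sum>(r, d, m)\<leftarrow>W. r\<^sup>2 * d) = (\<Sum>s<length W. (fst (W ! s))\<^sup>2 * fst (snd (W ! s)))"
    by (simp add: sum_list_sum_nth case_prod_unfold lessThan_atLeast0)
  moreover have "(\<forall>(r, d, m)\<in>set W. r > 0 \<and> division_algebra d m) \<longleftrightarrow>
      (\<forall>s<length W. 0 < fst (W ! s) \<and> division_algebra (fst (snd (W ! s))) (snd (snd (W ! s))))"
    by (simp add: all_set_conv_all_nth case_prod_unfold)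
  ultimately show ?thesis by (simp add: wtypes_def)
qed

section \<open>Strata of the separable locus described by frames\<close>

context based_algebra
begin

lemma corner_closed:
  "v \<in> corner c \<Longrightarrow> w \<in> corner c \<Longrightarrow> v + w \<in> corner c" "v \<in> corner c \<Longrightarrow> scale t v \<in> corner c"
  "v \<in> corner c \<Longrightarrow> w \<in> corner c \<Longrightarrow> v \<cdot> w \<in> corner c"
  by (auto simp: subspace_corner subspace_add subspace_scale corner_mult)

text \<open>Membership becomes the existence of a frame with prescribed sizes and corners, so that
  uniqueness and reordering can be settled on frames.\<close>

lemma wedderburn_stratum_iff:
  assumes W: "W \<in> wtypes N"
  shows "x \<in> wstratum W \<longleftrightarrow>
    (\<exists>a b c. frame (length W) (\<lambda>s. fst (W ! s)) a b c \<and>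
      (\<forall>s<length W. alg_iso scale (corner (c s)) x kscale (kspace (fst (snd (W ! s)))) (snd (snd
          (W ! s)))))"
    (is "?L \<longleftrightarrow> ?R")
proof -
  have fr: "frame (length W) (\<lambda>s. blk_size (wtype_blocks W ! s)) a b c \<longleftrightarrow>
      frame (length W) (\<lambda>s. fst (W ! s)) a b c" for a b c
    by (simp add: frame_def pframe_def wtype_blocks_nth cong: conj_cong)
  show ?thesis
  proof
    assume ?L
    then have iso: "alg_iso scale UNIV x (matsum_scale kscale) (matsum_carrier (wtype_blocks W))
        (matsum_mult (wtype_blocks W))"
      by (simp add: wedderburn_stratum_def)
    have "\<exists>a b c. frame (length (wtype_blocks W)) (\<lambda>s. blk_size (wtype_blocks W ! s)) a b c \<and>
      (\<forall>s<length (wtype_blocks W). alg_iso scale (corner (c s)) x kscale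
        (blk_carrier (wtype_blocks W ! s)) (blk_mult (wtype_blocks W ! s)))"
      using W by (intro frame_if_iso iso)
        (auto simp: wtypes_iff wtype_blocks_nth intro!: division_alg.divblk division_alg.intro)
    then show ?R by (simp add: wtype_blocks_nth fr)
  next
    assume ?R
    then obtain a b c where *: "frame (length W) (\<lambda>s. fst (W ! s)) a b c"
      "\<And>s. s < length W \<Longrightarrow> alg_iso scale (corner (c s)) x kscale (kspace (fst (snd (W ! s)))) (snd
          (snd (W ! s)))"
      by blast
    have "alg_iso scale UNIV x (matsum_scale kscale) (matsum_carrier (wtype_blocks W))
        (matsum_mult (wtype_blocks W))"
      by (rule iso_if_frame[of kscale _ a b c]) (use * in \<open>auto simp: kscale_def fr
          wtype_blocks_nth fun_eq_iff\<close>)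
    then show ?L by (simp add: wedderburn_stratum_def alg)
  qed
qed

lemma profile_stratum_iff:
  assumes \<rho>: "0 \<notin># \<rho>"
  shows "x \<in> pstratum \<rho> \<longleftrightarrow>
    (\<exists>rs a b c. mset rs = \<rho> \<and> frame (length rs) (\<lambda>s. rs ! s) a b c \<and>
      (\<forall>s<length rs. alg_iso scale (corner (c s)) x (*) (UNIV :: 'k set) (*)))"
    (is "?L \<longleftrightarrow> ?R")
proof -
  have fr: "frame (length rs) (\<lambda>s. blk_size ((scalar_blocks rs :: 'k block list) ! s)) a b c \<longleftrightarrow>
      frame (length rs) (\<lambda>s. rs ! s) a b c" for a b c rs
    by (simp add: frame_def pframe_def scalar_blocks_nth cong: conj_cong)
  show ?thesis
  proof
    assume ?L
    then obtain rs where rs: "mset rs = \<rho>"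
      and iso: "alg_iso scale UNIV x (matsum_scale (*)) (matsum_carrier (scalar_blocks rs :: 'k
          block list)) (matsum_mult (scalar_blocks rs))"
      by (auto simp: profile_stratum_def)
    have "rs ! s \<noteq> 0" if "s < length rs" for s
      using \<rho> that rs by (metis nth_mem set_mset_mset)
    moreover note divblk_field
    ultimately have "\<exists>a b c. frame (length (scalar_blocks rs :: 'k block list)) (\<lambda>s. blk_size
        ((scalar_blocks rs :: 'k block list) ! s)) a b c \<and>
      (\<forall>s<length (scalar_blocks rs :: 'k block list). alg_iso scale (corner (c s)) x (*)
        (blk_carrier ((scalar_blocks rs :: 'k block list) ! s)) (blk_mult (scalar_blocks rs ! s)))"
      by (intro frame_if_iso iso) (auto simp: scalar_blocks_nth)
    then show ?R using rs by (auto simp: scalar_blocks_nth fr)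
  next
    assume ?R
    then obtain rs a b c where *: "frame (length rs) (\<lambda>s. rs ! s) a b c" "mset rs = \<rho>"
      "\<And>s. s < length rs \<Longrightarrow> alg_iso scale (corner (c s)) x (*) (UNIV :: 'k set) (*)"
      by blast
    have "alg_iso scale UNIV x (matsum_scale (*)) (matsum_carrier (scalar_blocks rs :: 'k block
        list)) (matsum_mult (scalar_blocks rs))"
      by (rule iso_if_frame[of "(*)" _ a b c]) (use * in \<open>auto simp: fr scalar_blocks_nth\<close>)
    then show ?L using * by (auto simp: profile_stratum_def alg)
  qed
qed

text \<open>Coordinates \<open>\<theta>\<close> with inverse \<open>\<eta>\<close> transport the
  product of the corner to \<open>kspace d\<close>. The functionals \<open>\<phi>\<close> and the
  basis \<open>\<beta>\<close> are exported too, because the dimension count in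
  \<open>frame_dim\<close> runs over them.\<close>

lemma corner_kspace:
  assumes c: "division_idem c"
  shows "\<exists>d m \<phi> \<beta>. division_algebra d m \<and> alg_iso scale (corner c) x kscale (kspace d) m \<and>
    (\<forall>k<d. linf (\<phi> k)) \<and> (\<forall>k<d. \<beta> k \<in> corner c) \<and> (\<forall>k<d. \<phi> k (\<beta> k) = 1) \<and>
    (\<forall>w\<in>corner c. w = (\<Sum>k<d. scale (\<phi> k w) (\<beta> k)))"
proof -
  obtain d :: nat and \<beta> \<phi> where *: "\<And>i. i < d \<Longrightarrow> linf (\<phi> i)" "\<And>i. i < d \<Longrightarrow> \<beta> i \<in> corner c"
    "\<And>i j. i < d \<Longrightarrow> j < d \<Longrightarrow> \<phi> i (\<beta> j) = (if i = j then 1 else 0)"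
    "\<And>w. w \<in> corner c \<Longrightarrow> w = (\<Sum>i<d. scale (\<phi> i w) (\<beta> i))"
    by (rule subspace_coords[OF subspace_corner[of c]]) blast
  define \<theta> where "\<theta> v = (\<lambda>k. if k < d then \<phi> k v else 0)" for v
  define \<eta> where "\<eta> w = (\<Sum>k<d. scale (w k) (\<beta> k))" for w
  define m where "m a b = \<theta> (\<eta> a \<cdot> \<eta> b)" for a b
  have \<theta>D: "\<theta> v \<in> kspace d" for v by (simp add: \<theta>_def kspace_def)
  have \<eta>C: "\<eta> w \<in> corner c" for w
    unfolding \<eta>_def by (intro subspace_sum subspace_scale subspace_corner) (use *(2) in auto)
  have \<eta>\<theta>: "\<eta> (\<theta> v) = v" if "v \<in> corner c" for v
    using *(4)[OF that] by (simp add: \<eta>_def \<theta>_def)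
  have \<theta>\<eta>: "\<theta> (\<eta> w) = w" if "w \<in> kspace d" for w
    using that by (auto simp: fun_eq_iff \<theta>_def \<eta>_def linf_sum[OF *(1)] linf_scale[OF *(1)] *(3)
        kspace_def if_distrib cong: if_cong)
  have \<theta>_add: "\<theta> (v + w) = \<theta> v + \<theta> w" for v w
    by (auto simp: fun_eq_iff \<theta>_def linf_add[OF *(1)])
  have \<theta>_scale: "\<theta> (scale t v) = kscale t (\<theta> v)" for t v
    by (auto simp: fun_eq_iff \<theta>_def linf_scale[OF *(1)] kscale_def)
  have \<eta>_add: "\<eta> (v + w) = \<eta> v + \<eta> w" for v w
    by (simp add: \<eta>_def scale_left_distrib sum.distrib)
  have \<eta>_scale: "\<eta> (kscale t v) = scale t (\<eta> v)" for t v
    by (simp add: \<eta>_def kscale_def scale_sum_right)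
  have "alg_iso scale (corner c) x kscale (kspace d) m"
    unfolding alg_iso_def
  proof (intro exI[of _ \<theta>] conjI ballI allI)
    show "bij_betw \<theta> (corner c) (kspace d)"
      by (rule bij_betw_byWitness[where f' = \<eta>]) (auto simp: \<eta>\<theta> \<theta>\<eta> \<theta>D \<eta>C)
  qed (auto simp: \<theta>_add \<theta>_scale m_def \<eta>\<theta>)
  moreover have "division_algebra d m"
    unfolding division_algebra_def
  proof (intro conjI ballI allI)
    show "\<exists>u\<in>kspace d. u \<noteq> 0 \<and> (\<forall>a\<in>kspace d. m u a = a \<and> m a u = a) \<and>
        (\<forall>a\<in>kspace d. a \<noteq> 0 \<longrightarrow> (\<exists>b\<in>kspace d. m a b = u \<and> m b a = u))"
    proof (rule bexI[of _ "\<theta> c"], intro conjI ballI impI)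
      have cc: "c \<in> corner c" using c by (rule division_idemD)
      have \<eta>0: "\<eta> 0 = 0" by (simp add: \<eta>_def)
      show "\<theta> c \<noteq> 0" using \<eta>\<theta>[OF cc] \<eta>0 division_idemD(3)[OF c] by metis
      show "m (\<theta> c) a = a" "m a (\<theta> c) = a" if "a \<in> kspace d" for a :: "nat \<Rightarrow> 'k"
        using that by (simp_all add: m_def \<eta>\<theta> cc cornerD[OF \<eta>C] \<theta>\<eta>)
      fix a :: "nat \<Rightarrow> 'k" assume a: "a \<in> kspace d" "a \<noteq> 0"
      have "\<theta> 0 = 0" using \<theta>_scale[of 0 0] by (auto simp: kscale_def fun_eq_iff)
      then have "\<eta> a \<noteq> 0" using \<theta>\<eta>[OF a(1)] a(2) by metis
      then obtain d' where "d' \<in> corner c" "\<eta> a \<cdot> d' = c" "d' \<cdot> \<eta> a = c"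
        using c \<eta>C[of a] by (auto simp: division_idem_def)
      then show "\<exists>b\<in>kspace d. m a b = \<theta> c \<and> m b a = \<theta> c"
        by (intro bexI[of _ "\<theta> d'"]) (simp_all add: m_def \<eta>\<theta> \<theta>D)
    qed (rule \<theta>D)
  qed (simp_all add: m_def \<theta>D \<eta>_add \<eta>_scale mult_distrib \<theta>_add \<theta>_scale \<eta>\<theta> corner_mult \<eta>C assoc)
  moreover have "\<forall>k<d. \<phi> k (\<beta> k) = 1" using *(3) by simp
  ultimately show ?thesis
    using *(1,2,4) by (intro exI[of _ d] exI[of _ m] exI[of _ \<phi>] exI[of _ \<beta>]) blast
qed

lemma wedderburn_exists:
  assumes disc: "\<Delta> x \<noteq> 0"
  shows "\<exists>W\<in>wtypes n. x \<in> wstratum W"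
proof -
  interpret disc_algebra scale n e x by unfold_locales (rule disc)
  have reg: regular using separable by (rule separable_imp_regular)
  have u: "is_unit unit" by (simp add: is_unit_def unit_l unit_r)
  obtain M r a b c where fr: "frame M r a b c" using frame_exists[OF reg u] by blast
  then obtain u' where u': "is_unit u'" "pframe u' M r a b c" by (auto simp: frame_def)
  let ?P = "\<lambda>s (d, m, \<phi>, \<beta>). division_algebra d m \<and> alg_iso scale (corner (c s)) x kscale (kspace
      d) m \<and>
    (\<forall>k<d. linf (\<phi> k)) \<and> (\<forall>k<d. \<beta> k \<in> corner (c s)) \<and> (\<forall>k<d. \<phi> k (\<beta> k) = 1) \<and>
    (\<forall>w\<in>corner (c s). w = (\<Sum>k<d. scale (\<phi> k w) (\<beta> k)))"
  have "\<forall>s. \<exists>p. s < M \<longrightarrow> ?P s p"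
  proof
    fix s
    show "\<exists>p. s < M \<longrightarrow> ?P s p"
    proof (cases "s < M")
      case True
      then show ?thesis
        using corner_kspace[OF pframeD(1)[OF u'(2) True]] unfolding split_paired_Ex prod.case
            by blast
    qed simp
  qed
  from choice[OF this] obtain p where p: "\<forall>s. s < M \<longrightarrow> ?P s (p s)" ..
  define d where "d s = fst (p s)" for s
  define m where "m s = fst (snd (p s))" for s
  define \<phi> where "\<phi> s = fst (snd (snd (p s)))" for s
  define \<beta> where "\<beta> s = snd (snd (snd (p s)))" for s
  have P: "division_algebra (d s) (m s)" "alg_iso scale (corner (c s)) x kscale (kspace (d s)) (m
      s)"
    "k < d s \<Longrightarrow> linf (\<phi> s k)" "k < d s \<Longrightarrow> \<beta> s k \<in> corner (c s)" "k < d s \<Longrightarrow> \<phi> s k (\<beta> s k) = 1"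
    "w \<in> corner (c s) \<Longrightarrow> w = (\<Sum>k<d s. scale (\<phi> s k w) (\<beta> s k))" if "s < M" for s k w
    using p that by (simp_all add: d_def m_def \<phi>_def \<beta>_def case_prod_unfold)
  let ?W = "map (\<lambda>s. (r s, d s, m s)) [0..<M]"
  have "n = (\<Sum>s<M. (r s)\<^sup>2 * d s)"
    by (rule frame_dim[OF u', where \<phi> = \<phi> and \<beta> = \<beta>]) (use P in auto)
  then have W: "?W \<in> wtypes n"
    using pframeD(2)[OF u'(2)] P(1) by (simp add: wtypes_iff)
  moreover have "frame M (\<lambda>s. fst (?W ! s)) a b c"
    using fr by (simp add: frame_def pframe_def cong: conj_cong)
  ultimately have "x \<in> wstratum ?W"
    unfolding wedderburn_stratum_iff[OF W] using P(2) by
        (intro exI[of _ a] exI[of _ b] exI[of _ c]) simp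
  then show ?thesis using W by blast
qed

lemma wedderburn_disc:
  "W \<in> wtypes N \<Longrightarrow> x \<in> wstratum W \<Longrightarrow> \<Delta> x \<noteq> 0"
  using iffD1[OF wedderburn_stratum_iff] frame_disc by metis

lemma frames_bij:
  assumes "frame M r a b c" "frame M' r' a' b' c'"
  shows "\<exists>\<pi>. bij_betw \<pi> {..<M} {..<M'} \<and>
    (\<forall>s<M. r s = r' (\<pi> s) \<and> alg_iso scale (corner (c s)) x scale (corner (c' (\<pi> s))) x)"
proof -
  interpret disc_algebra scale n e x by unfold_locales (rule frame_disc[OF assms(1)])
  have reg: regular using separable by (rule separable_imp_regular)
  obtain u u' where u: "is_unit u" "pframe u M r a b c" and u': "is_unit u'"
      "pframe u' M' r' a' b' c'"
    using assms by (auto simp: frame_def)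
  have "u = u'" using u(1) u'(1) by (metis is_unit_def)
  then show ?thesis using frame_unique[OF reg u(1,2)] u'(2) by blast
qed

lemma wedderburn_same:
  assumes W: "W \<in> wtypes N" "x \<in> wstratum W"
    and W': "W' \<in> wtypes N'" "x \<in> wstratum W'"
  shows "same_wtype W W'"
proof -
  obtain a b c where F: "frame (length W) (\<lambda>s. fst (W ! s)) a b c"
    "\<forall>s<length W. alg_iso scale (corner (c s)) x kscale (kspace (fst (snd (W ! s)))) (snd (snd (W
        ! s)))"
    using iffD1[OF wedderburn_stratum_iff[OF W(1)] W(2)]
    by (elim exE conjE) (rule that)
  obtain a' b' c' where F': "frame (length W') (\<lambda>s. fst (W' ! s)) a' b' c'"
    "\<forall>s<length W'. alg_iso scale (corner (c' s)) x kscale (kspace (fst (snd (W' ! s)))) (snd (snd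
        (W' ! s)))"
    using iffD1[OF wedderburn_stratum_iff[OF W'(1)] W'(2)]
    by (elim exE conjE) (rule that)
  obtain \<pi> where \<pi>0: "bij_betw \<pi> {..<length W} {..<length W'} \<and> (\<forall>s<length W.
      fst (W ! s) = fst (W' ! (\<pi> s)) \<and> alg_iso scale (corner (c s)) x scale (corner (c' (\<pi> s))) x)"
    using frames_bij[OF F(1) F'(1)] ..
  then have \<pi>: "bij_betw \<pi> {..<length W} {..<length W'}"
    "\<And>s. s < length W \<Longrightarrow> fst (W ! s) = fst (W' ! (\<pi> s))"
    "\<And>s. s < length W \<Longrightarrow> alg_iso scale (corner (c s)) x scale (corner (c' (\<pi> s))) x"
    by simp_all
  have "alg_iso kscale (kspace (fst (snd (W ! s)))) (snd (snd (W ! s))) kscale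
      (kspace (fst (snd (W' ! \<pi> s)))) (snd (snd (W' ! \<pi> s)))" if s: "s < length W" for s
  proof -
    have "alg_iso kscale (kspace (fst (snd (W ! s)))) (snd (snd (W ! s))) scale (corner (c s)) x"
      by (rule alg_iso_sym[OF F(2)[rule_format, OF s]]) (auto simp: corner_closed)
    moreover have "\<pi> s < length W'" using \<pi>(1) s by (auto simp: bij_betw_def)
    ultimately show ?thesis
      using alg_iso_trans[OF _ alg_iso_trans[OF \<pi>(3)[OF s]]] F'(2) by blast
  qed
  then show ?thesis
    unfolding same_wtype_def rel_mset_iff_bij using \<pi>(1,2)
    by (intro exI[of _ \<pi>]) (simp add: case_prod_unfold)
qed

lemma frame_reindex:
  assumes "frame M r a b c" and \<pi>: "bij_betw \<pi> {..<M'} {..<M}"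
  shows "frame M' (r \<circ> \<pi>) (a \<circ> \<pi>) (b \<circ> \<pi>) (c \<circ> \<pi>)"
proof -
  obtain u where u: "is_unit u" "pframe u M r a b c" using assms by (auto simp: frame_def)
  note F = pframeD[OF u(2)]
  have \<pi>': "\<pi> s < M" if "s < M'" for s using \<pi> that by (auto simp: bij_betw_def)
  have \<pi>i: "\<pi> s = \<pi> t \<longleftrightarrow> s = t" if "s < M'" "t < M'" for s t
    using \<pi> that by (auto simp: bij_betw_def inj_on_def)
  have "u = (\<Sum>s<M'. \<Sum>i<(r \<circ> \<pi>) s. (b \<circ> \<pi>) s i \<cdot> (a \<circ> \<pi>) s i)"
    unfolding F(11) using sum.reindex_bij_betw[OF \<pi>, of "\<lambda>s. \<Sum>i<r s. b s i \<cdot> a s i"] by simp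
  then have "pframe u M' (r \<circ> \<pi>) (a \<circ> \<pi>) (b \<circ> \<pi>) (c \<circ> \<pi>)"
    unfolding pframe_def using F \<pi>' \<pi>i by simp
  then show ?thesis using u(1) by (auto simp: frame_def)
qed

lemma same_wtype_stratum:
  assumes W: "W \<in> wtypes N" and W': "W' \<in> wtypes N" and same: "same_wtype W' W"
    and xW: "x \<in> wstratum W"
  shows "x \<in> wstratum W'"
proof -
  obtain a b c where F: "frame (length W) (\<lambda>s. fst (W ! s)) a b c"
    "\<forall>s<length W. alg_iso scale (corner (c s)) x kscale (kspace (fst (snd (W ! s)))) (snd (snd (W
        ! s)))"
    using iffD1[OF wedderburn_stratum_iff[OF W] xW]
    by (elim exE conjE) (rule that)
  obtain \<pi> where \<pi>: "bij_betw \<pi> {..<length W'} {..<length W}"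
    "\<And>s. s < length W' \<Longrightarrow> fst (W' ! s) = fst (W ! (\<pi> s)) \<and>
      alg_iso kscale (kspace (fst (snd (W' ! s)))) (snd (snd (W' ! s))) kscale
        (kspace (fst (snd (W ! \<pi> s)))) (snd (snd (W ! \<pi> s)))"
    using same unfolding same_wtype_def rel_mset_iff_bij by (auto simp: case_prod_unfold)
  have "frame (length W') (\<lambda>s. fst (W' ! s)) (a \<circ> \<pi>) (b \<circ> \<pi>) (c \<circ> \<pi>)"
    using frame_reindex[OF F(1) \<pi>(1)] \<pi>(2)
    by (simp add: frame_def pframe_def cong: conj_cong)
  moreover have "alg_iso scale (corner ((c \<circ> \<pi>) s)) x kscale (kspace (fst (snd (W' ! s)))) (snd
      (snd (W' ! s)))"
    if s: "s < length W'" for s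
  proof -
    interpret division_alg "fst (snd (W' ! s))" "snd (snd (W' ! s))"
      using W' s by unfold_locales (simp add: wtypes_iff)
    have "alg_iso kscale (kspace (fst (snd (W ! \<pi> s)))) (snd (snd (W ! \<pi> s))) kscale
        (kspace (fst (snd (W' ! s)))) (snd (snd (W' ! s)))"
      by (rule alg_iso_sym[OF conjunct2[OF \<pi>(2)[OF s]]]) (auto simp: kspace_closed closed)
    moreover have "\<pi> s < length W" using \<pi>(1) s by (auto simp: bij_betw_def)
    ultimately show ?thesis
      using alg_iso_trans[OF F(2)[rule_format, of "\<pi> s"]] by simp
  qed
  ultimately show ?thesis
    unfolding wedderburn_stratum_iff[OF W'] by blast
qed

lemma profile_if_wedderburn:
  assumes W: "W \<in> wtypes N" "x \<in> wstratum W"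
    and triv: "\<And>s. s < length W \<Longrightarrow>
      alg_iso (*) (UNIV :: 'k set) (*) kscale (kspace (fst (snd (W ! s)))) (snd (snd (W ! s)))"
  shows "x \<in> pstratum (mset (map fst W))"
proof -
  obtain a b c where F: "frame (length W) (\<lambda>s. fst (W ! s)) a b c"
    "\<forall>s<length W. alg_iso scale (corner (c s)) x kscale (kspace (fst (snd (W ! s)))) (snd (snd (W
        ! s)))"
    using iffD1[OF wedderburn_stratum_iff[OF W(1)] W(2)]
    by (elim exE conjE) (rule that)
  have nz: "0 \<notin># mset (map fst W)"
    using W(1) by (force simp: wtypes_def)
  have "frame (length (map fst W)) (\<lambda>s. map fst W ! s) a b c"
    using F(1) by (simp add: frame_def pframe_def cong: conj_cong)
  moreover have "alg_iso scale (corner (c s)) x (*) (UNIV :: 'k set) (*)" if "s < length W" for s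
    by (rule alg_iso_trans[OF F(2)[rule_format, OF that] alg_iso_sym[OF triv[OF that]]]) auto
  ultimately show ?thesis
    unfolding profile_stratum_iff[OF nz] by (intro exI[of _ "map fst W"]) auto
qed

lemma profile_unique:
  assumes "0 \<notin># \<rho>" "x \<in> pstratum \<rho>" "0 \<notin># \<rho>'" "x \<in> pstratum \<rho>'"
  shows "\<rho> = \<rho>'"
proof -
  obtain rs a b c where F: "mset rs = \<rho>" "frame (length rs) (\<lambda>s. rs ! s) a b c"
    using iffD1[OF profile_stratum_iff[OF assms(1)] assms(2)]
    by (elim exE conjE) (rule that)
  obtain rs' a' b' c' where F': "mset rs' = \<rho>'" "frame (length rs') (\<lambda>s. rs' ! s) a' b' c'"
    using iffD1[OF profile_stratum_iff[OF assms(3)] assms(4)]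
    by (elim exE conjE) (rule that)
  have "rel_mset (=) (mset rs) (mset rs')"
    unfolding rel_mset_iff_bij using frames_bij[OF F(2) F'(2)] by blast
  then show ?thesis using F(1) F'(1) by (simp add: multiset.rel_eq)
qed

end

subsection \<open>Polynomial functions and the Zariski topology\<close>

definition monom_eval :: "('i \<Rightarrow> 'k::comm_ring_1) \<Rightarrow> ('i \<Rightarrow>\<^sub>0 nat) \<Rightarrow> 'k" where
  "monom_eval s m = (\<Prod>v\<in>Poly_Mapping.keys m. s v ^ Poly_Mapping.lookup m v)"

definition poly_eval :: "('i \<Rightarrow> 'k::comm_ring_1) \<Rightarrow> (('i \<Rightarrow>\<^sub>0 nat) \<Rightarrow>\<^sub>0 'k) \<Rightarrow> 'k" where
  "poly_eval s p = (\<Sum>m\<in>Poly_Mapping.keys p. Poly_Mapping.lookup p m * monom_eval s m)"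

lemma sc_eval_poly_eval: "sc_eval scale n e p x = poly_eval (struct_const scale n e x) p"
  by (simp add: sc_eval_def poly_eval_def monom_eval_def)

lemma monom_eval_superset:
  "finite A \<Longrightarrow> Poly_Mapping.keys m \<subseteq> A \<Longrightarrow> monom_eval s m = (\<Prod>v\<in>A. s v ^ Poly_Mapping.lookup m v)"
  unfolding monom_eval_def by (rule prod.mono_neutral_left) (auto simp: in_keys_iff)

lemma monom_eval_add: "monom_eval s (m + m') = monom_eval s m * monom_eval s m'"
proof -
  let ?A = "Poly_Mapping.keys m \<union> Poly_Mapping.keys m'"
  have "monom_eval s (m + m') = (\<Prod>v\<in>?A. s v ^ Poly_Mapping.lookup (m + m') v)"
    by (rule monom_eval_superset) (auto dest: subsetD[OF keys_add])
  also have "\<dots> = (\<Prod>v\<in>?A. s v ^ Poly_Mapping.lookup m v) * (\<Prod>v\<in>?A. s v ^ Poly_Mapping.lookup m' v)"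
    by (simp add: lookup_add power_add prod.distrib)
  also have "\<dots> = monom_eval s m * monom_eval s m'"
    by (simp add: monom_eval_superset[of ?A])
  finally show ?thesis .
qed

lemma poly_eval_superset:
  "finite A \<Longrightarrow> Poly_Mapping.keys p \<subseteq> A \<Longrightarrow>
    poly_eval s p = (\<Sum>m\<in>A. Poly_Mapping.lookup p m * monom_eval s m)"
  unfolding poly_eval_def by (rule sum.mono_neutral_left) (auto simp: in_keys_iff)

lemma poly_eval_add: "poly_eval s (p + q) = poly_eval s p + poly_eval s q"
proof -
  let ?A = "Poly_Mapping.keys p \<union> Poly_Mapping.keys q"
  have "poly_eval s (p + q) = (\<Sum>m\<in>?A. Poly_Mapping.lookup (p + q) m * monom_eval s m)"
    by (rule poly_eval_superset) (auto dest: subsetD[OF keys_add])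
  also have "\<dots> = poly_eval s p + poly_eval s q"
    by (simp add: poly_eval_superset[of ?A] lookup_add distrib_right sum.distrib)
  finally show ?thesis .
qed

lemma poly_eval_single: "poly_eval s (Poly_Mapping.single m a) = a * monom_eval s m"
  by (subst poly_eval_superset[of "{m}"]) (auto simp: in_keys_iff lookup_single when_def)

lemma poly_eval_sum: "poly_eval s (\<Sum>i\<in>I. f i) = (\<Sum>i\<in>I. poly_eval s (f i))"
  by (induction I rule: infinite_finite_induct) (auto simp: poly_eval_add, auto simp: poly_eval_def)

lemma sum_single_keys:
  "p = (\<Sum>m\<in>Poly_Mapping.keys p. Poly_Mapping.single m (Poly_Mapping.lookup p m))"
  by (rule poly_mapping_eqI) (auto simp: lookup_sum lookup_single when_def in_keys_iff)

lemma poly_eval_mult: "poly_eval s (p * q) = poly_eval s p * poly_eval s q"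
proof -
  have "p * q = (\<Sum>m\<in>Poly_Mapping.keys p. \<Sum>m'\<in>Poly_Mapping.keys q.
      Poly_Mapping.single (m + m') (Poly_Mapping.lookup p m * Poly_Mapping.lookup q m'))"
    by (subst (1) sum_single_keys[of p], subst (1) sum_single_keys[of q])
       (simp only: sum_product mult_single)
  then have "poly_eval s (p * q) = (\<Sum>m\<in>Poly_Mapping.keys p. \<Sum>m'\<in>Poly_Mapping.keys q.
      Poly_Mapping.lookup p m * Poly_Mapping.lookup q m' * (monom_eval s m * monom_eval s m'))"
    by (simp only: poly_eval_sum poly_eval_single monom_eval_add)
  also have "\<dots> = poly_eval s p * poly_eval s q"
    by (simp add: poly_eval_def sum_product mult_ac)
  finally show ?thesis .
qed

lemma poly_eval_one: "poly_eval s 1 = 1"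
  using poly_eval_single[of s 0 1] by (simp add: monom_eval_def)

text \<open>This is what carries minors of a matrix of polynomials to minors of its value at
  \<open>x\<close>.\<close>

lemma comm_ring_hom_sc_eval: "comm_ring_hom (\<lambda>p. sc_eval scale n e p x)"
  unfolding sc_eval_poly_eval
  by unfold_locales (simp_all add: poly_eval_add poly_eval_mult poly_eval_one,
      simp add: poly_eval_def)

context based_space
begin

lemmas sc_eval_hom = comm_ring_hom_sc_eval[of scale n e]

text \<open>Being polynomial is treated as a property of functions with closure rules, so that
  hardly any polynomial has to be written down. Agreement is asked on \<open>V21\<close> only, since
  elsewhere a product is not determined by its structure constants.\<close>

definition polyfun :: "(('v \<Rightarrow> 'v \<Rightarrow> 'v) \<Rightarrow> 'k) \<Rightarrow> bool" where
  "polyfun f \<longleftrightarrow> (\<exists>p. \<forall>x\<in>V21 scale. f x = ev p x)"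

definition polyvec :: "(('v \<Rightarrow> 'v \<Rightarrow> 'v) \<Rightarrow> 'v) \<Rightarrow> bool" where
  "polyvec w \<longleftrightarrow> (\<forall>k<n. polyfun (\<lambda>x. crd k (w x)))"

lemma polyfun_const: "polyfun (\<lambda>x. t)"
  unfolding polyfun_def
  by (rule exI[of _ "Poly_Mapping.single 0 t"]) (simp add: sc_eval_poly_eval poly_eval_single
      monom_eval_def)

lemma polyfun_add:
  assumes "polyfun f" "polyfun g"
  shows "polyfun (\<lambda>x. f x + g x)"
proof -
  obtain p where p: "\<forall>x\<in>V21 scale. f x = ev p x"
    using assms(1) unfolding polyfun_def ..
  obtain q where q: "\<forall>x\<in>V21 scale. g x = ev q x"
    using assms(2) unfolding polyfun_def ..
  from p q have "\<forall>x\<in>V21 scale. f x + g x = ev (p + q) x"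
    by (simp add: sc_eval_poly_eval poly_eval_add)
  then show ?thesis unfolding polyfun_def by (rule exI)
qed

lemma polyfun_mult:
  assumes "polyfun f" "polyfun g"
  shows "polyfun (\<lambda>x. f x * g x)"
proof -
  obtain p where p: "\<forall>x\<in>V21 scale. f x = ev p x"
    using assms(1) unfolding polyfun_def ..
  obtain q where q: "\<forall>x\<in>V21 scale. g x = ev q x"
    using assms(2) unfolding polyfun_def ..
  from p q have "\<forall>x\<in>V21 scale. f x * g x = ev (p * q) x"
    by (simp add: sc_eval_poly_eval poly_eval_mult)
  then show ?thesis unfolding polyfun_def by (rule exI)
qed

lemma polyfun_diff:
  assumes "polyfun f" "polyfun g"
  shows "polyfun (\<lambda>x. f x - g x)"
proof -
  have "polyfun (\<lambda>x. f x + (- 1) * g x)"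
    by (rule polyfun_add[OF assms(1) polyfun_mult[OF polyfun_const assms(2)]])
  then show ?thesis by simp
qed

lemma polyfun_sum: "(\<And>i. i \<in> I \<Longrightarrow> polyfun (f i)) \<Longrightarrow> polyfun (\<lambda>x. \<Sum>i\<in>I. f i x)"
proof (induction I rule: infinite_finite_induct)
  case (insert i I)
  then show ?case by (simp add: polyfun_add)
qed (simp_all add: polyfun_const)

lemma polyfun_prod: "(\<And>i. i \<in> I \<Longrightarrow> polyfun (f i)) \<Longrightarrow> polyfun (\<lambda>x. \<Prod>i\<in>I. f i x)"
proof (induction I rule: infinite_finite_induct)
  case (insert i I)
  then show ?case by (simp add: polyfun_mult)
qed (simp_all add: polyfun_const)

lemma polyfun_det:
  assumes "\<And>i j. i < k \<Longrightarrow> j < k \<Longrightarrow> polyfun (f i j)"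
  shows "polyfun (\<lambda>x. det (mat k k (\<lambda>(i, j). f i j x)))"
proof -
  have "polyfun (\<lambda>x. \<Sum>p\<in>{p. p permutes {0..<k}}. signof p * (\<Prod>i = 0..<k. f i (p i) x))"
    using assms
    by (auto intro!: polyfun_sum polyfun_mult polyfun_const polyfun_prod
        simp: permutes_in_image)
  moreover have "det (mat k k (\<lambda>(i, j). f i j x)) =
      (\<Sum>p\<in>{p. p permutes {0..<k}}. signof p * (\<Prod>i = 0..<k. f i (p i) x))" for x
    unfolding det_def by (auto intro!: sum.cong prod.cong arg_cong2[of _ _ _ _ "(*)"])
  ultimately show ?thesis by simp
qed

lemma polyfun_struct_const: "polyfun (\<lambda>x. struct_const scale n e x v)"
  unfolding polyfun_def
  by (rule exI[of _ "Poly_Mapping.single (Poly_Mapping.single v 1) 1"])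
     (simp add: sc_eval_poly_eval poly_eval_single monom_eval_superset[of "{v}"])

lemma polyvec_const: "polyvec (\<lambda>x. v)"
  by (simp add: polyvec_def polyfun_const)

lemma polyvec_add: "polyvec v \<Longrightarrow> polyvec w \<Longrightarrow> polyvec (\<lambda>x. v x + w x)"
  by (simp add: polyvec_def crd_add polyfun_add)

lemma polyvec_diff: "polyvec v \<Longrightarrow> polyvec w \<Longrightarrow> polyvec (\<lambda>x. v x - w x)"
proof -
  have "crd k (a - b) = crd k a - crd k b" for k a b
    using crd_add[of k "a - b" b] by simp
  then show "polyvec v \<Longrightarrow> polyvec w \<Longrightarrow> polyvec (\<lambda>x. v x - w x)"
    by (simp add: polyvec_def polyfun_diff)
qed

lemma polyvec_scale: "polyfun f \<Longrightarrow> polyvec v \<Longrightarrow> polyvec (\<lambda>x. scale (f x) (v x))"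
  by (simp add: polyvec_def crd_scale polyfun_mult)

lemma polyvec_sum: "(\<And>i. i \<in> I \<Longrightarrow> polyvec (f i)) \<Longrightarrow> polyvec (\<lambda>x. \<Sum>i\<in>I. f i x)"
  by (auto simp: polyvec_def crd_sum intro: polyfun_sum)

lemma V21_expand:
  assumes "x \<in> V21 scale"
  shows "x a b = (\<Sum>i<n. \<Sum>j<n. scale (crd i a * crd j b) (x (e i) (e j)))"
proof -
  have l: "lin (\<lambda>a. x a b)" "lin (\<lambda>b. x a b)" for a b using assms by (auto simp: V21_def)
  have "x a b = (\<Sum>i<n. scale (crd i a) (x (e i) b))"
    by (subst (1) expand[of a]) (simp add: lin_sum[OF l(1)] lin_scale[OF l(1)])
  also have "\<dots> = (\<Sum>i<n. \<Sum>j<n. scale (crd i a * crd j b) (x (e i) (e j)))"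
    by (subst (1) expand[of b]) (simp add: lin_sum[OF l(2)] lin_scale[OF l(2)] scale_sum_right)
  finally show ?thesis .
qed

text \<open>The multiplication is that of the varying point \<open>x\<close>. Its structure
  constants are the indeterminates, so the result is polynomial in the point as well as in the two
  factors.\<close>

lemma polyvec_mult:
  assumes "polyvec v" "polyvec w"
  shows "polyvec (\<lambda>x. x (v x) (w x))"
  unfolding polyvec_def
proof (intro allI impI)
  fix k assume k: "k < n"
  have "polyfun (\<lambda>x. \<Sum>i<n. \<Sum>j<n. crd i (v x) * crd j (w x) * struct_const scale n e x (i, j, k))"
    using assms by (auto intro!: polyfun_sum polyfun_mult polyfun_struct_const simp: polyvec_def)
  moreover have "crd k (x (v x) (w x)) =
      (\<Sum>i<n. \<Sum>j<n. crd i (v x) * crd j (w x) * struct_const scale n e x (i, j, k))"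
    if "x \<in> V21 scale" for x
    using k by (subst V21_expand[OF that]) (simp add: crd_sum crd_scale struct_const_def)
  ultimately show "polyfun (\<lambda>x. crd k (x (v x) (w x)))"
    by (simp add: polyfun_def)
qed

lemma polyfun_tr: "(\<And>i. i < n \<Longrightarrow> polyvec (\<lambda>x. F x (e i))) \<Longrightarrow> polyfun (\<lambda>x. tr (F x))"
  by (auto simp: trace_map_def polyvec_def intro!: polyfun_sum)

lemma polyfun_disc: "polyfun (\<Delta>)"
  unfolding discriminant_def[abs_def]
  by (intro polyfun_det polyfun_tr polyvec_mult polyvec_const)

lemma Alg_V21: "x \<in> Alg scale \<Longrightarrow> x \<in> V21 scale"
  by (simp add: Alg_def)

lemma polyfun_sc_eval: "polyfun (ev p)"
  by (auto simp: polyfun_def)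

text \<open>A generated topology lives on the union of its generators, and the principal open set of
  the constant 1 is already \<open>V21\<close>.\<close>

lemma topspace_zariski_Alg: "topspace (zariskiA) = Alg scale"
proof -
  have "V21 scale = {x \<in> V21 scale. ev 1 x \<noteq> 0}"
    by (simp add: sc_eval_poly_eval poly_eval_one)
  then have "V21 scale \<in> range (\<lambda>p. {x \<in> V21 scale. ev p x \<noteq> 0})"
    by (rule range_eqI)
  then have "V21 scale \<subseteq> topspace (zariski scale n e)"
    unfolding zariski_def topology_generated_by_topspace by (rule Union_upper)
  then have "Alg scale \<subseteq> topspace (zariski scale n e)"
    using Alg_V21 by blast
  then show ?thesis
    unfolding zariski_Alg_def topspace_subtopology by (rule inf_absorb2)
qed

lemma openin_nonzero:
  assumes "polyfun f"
  shows "openin (zariskiA) {x \<in> Alg scale. f x \<noteq> 0}"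
proof -
  obtain p where p: "\<And>x. x \<in> V21 scale \<Longrightarrow> f x = ev p x"
    using assms by (auto simp: polyfun_def)
  have "openin (zariski scale n e) {x \<in> V21 scale. ev p x \<noteq> 0}"
    unfolding zariski_def by (rule topology_generated_by_Basis) blast
  moreover have "{x \<in> Alg scale. f x \<noteq> 0} = {x \<in> V21 scale. ev p x \<noteq> 0} \<inter> Alg scale"
    using p Alg_V21 by auto
  ultimately show ?thesis
    unfolding zariski_Alg_def openin_subtopology by blast
qed

lemma closedin_zero:
  assumes "polyfun f"
  shows "closedin (zariskiA) {x \<in> Alg scale. f x = 0}"
proof -
  have "Alg scale - {x \<in> Alg scale. f x = 0} = {x \<in> Alg scale. f x \<noteq> 0}" by blast
  then show ?thesis
    using openin_nonzero[OF assms] by (auto simp: closedin_def topspace_zariski_Alg)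
qed

lemma closedin_zeros:
  assumes "\<And>f. f \<in> F \<Longrightarrow> polyfun f"
  shows "closedin (zariskiA) {x \<in> Alg scale. \<forall>f\<in>F. f x = 0}"
proof (cases "F = {}")
  case True
  then show ?thesis using closedin_topspace[of "zariskiA"] by (simp add: topspace_zariski_Alg)
next
  case False
  then have "{x \<in> Alg scale. \<forall>f\<in>F. f x = 0} = (\<Inter>f\<in>F. {x \<in> Alg scale. f x = 0})" by blast
  then show ?thesis using False assms by (auto intro!: closedin_Inter closedin_zero)
qed

lemma openin_some_nonzero:
  assumes "\<And>f. f \<in> F \<Longrightarrow> polyfun f"
  shows "openin (zariskiA) {x \<in> Alg scale. \<exists>f\<in>F. f x \<noteq> 0}"
proof -
  have "{x \<in> Alg scale. \<exists>f\<in>F. f x \<noteq> 0} = (\<Union>f\<in>F. {x \<in> Alg scale. f x \<noteq> 0})" by blast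
  then show ?thesis using assms by (auto intro!: openin_Union openin_nonzero)
qed

lemma openin_separable_locus: "openin (zariskiA) (locus)"
  unfolding separable_locus_def by (rule openin_nonzero[OF polyfun_disc])

end

subsection \<open>The action of the general linear group\<close>

context based_space
begin

lemma GL_inv:
  assumes "g \<in> GL scale"
  shows "inv_into UNIV g \<in> GL scale" "g (inv_into UNIV g a) = a" "inv_into UNIV g (g a) = a"
proof -
  have g: "lin g" "bij g" using assms by (auto simp: GL_def)
  show *: "g (inv_into UNIV g a) = a" "inv_into UNIV g (g a) = a" for a
    using g(2) by (auto simp: bij_def surj_f_inv_f)
  have "lin (inv_into UNIV g)"
    by (rule linI; rule injD[OF bij_is_inj[OF g(2)]]) (simp_all add: * lin_add[OF g(1)]
        lin_scale[OF g(1)])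
  then show "inv_into UNIV g \<in> GL scale"
    using g(2) by (simp add: GL_def bij_imp_bij_inv)
qed

lemma act_eval: "g \<in> GL scale \<Longrightarrow> act g x (g a) (g b) = g (x a b)"
  by (simp add: act_def GL_inv)

lemma act_Alg:
  assumes g: "g \<in> GL scale" and x: "x \<in> Alg scale"
  shows "act g x \<in> Alg scale"
proof -
  have lg: "lin g" "lin (inv_into UNIV g)" using g GL_inv(1)[OF g] by (auto simp: GL_def)
  have lx: "lin (\<lambda>a. x a b)" "lin (\<lambda>b. x a b)" for a b using x by (auto simp: Alg_def V21_def)
  have "x (x a b) c = x a (x b c)" for a b c using x by (simp add: Alg_def)
  then show ?thesis
    unfolding Alg_def V21_def
    by (auto intro!: linI simp: act_def GL_inv[OF g] lin_add[OF lg(1)] lin_add[OF lg(2)]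
        lin_scale[OF lg(1)]
        lin_scale[OF lg(2)] lin_add[OF lx(1)] lin_add[OF lx(2)] lin_scale[OF lx(1)] lin_scale[OF
            lx(2)])
qed

lemma act_iso:
  assumes g: "g \<in> GL scale"
  shows "alg_iso scale UNIV x scale UNIV (act g x)"
proof -
  have "lin g" "bij g" using g by (auto simp: GL_def)
  then show ?thesis
    unfolding alg_iso_def
    by (intro exI[of _ g]) (simp add: lin_add[of g] lin_scale[of g] act_eval[OF g])
qed

lemma act_iso_sym: "g \<in> GL scale \<Longrightarrow> alg_iso scale UNIV (act g x) scale UNIV x"
  by (rule alg_iso_sym[OF act_iso]) auto

lemma orbit_eq_iso_class:
  assumes x: "x \<in> Alg scale"
  shows "orbit scale x = iso_class scale x"
proof
  show "orbit scale x \<subseteq> iso_class scale x"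
    using x by (auto simp: orbit_def iso_class_def act_Alg act_iso)
  show "iso_class scale x \<subseteq> orbit scale x"
  proof
    fix y assume "y \<in> iso_class scale x"
    then obtain \<phi> where \<phi>: "bij \<phi>" "\<And>a b. \<phi> (a + b) = \<phi> a + \<phi> b" "\<And>t a. \<phi> (scale t a) =
        scale t (\<phi> a)"
      "\<And>a b. \<phi> (x a b) = y (\<phi> a) (\<phi> b)"
      by (auto simp: iso_class_def alg_iso_def)
    have g: "\<phi> \<in> GL scale" using \<phi> by (auto simp: GL_def intro: linI)
    have "act \<phi> x = y"
      by (intro ext) (simp add: act_def \<phi>(4) GL_inv[OF g])
    then show "y \<in> orbit scale x" using g by (auto simp: orbit_def)
  qed
qed

lemma iso_class_refl: "x \<in> Alg scale \<Longrightarrow> x \<in> iso_class scale x"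
  by (simp add: iso_class_def alg_iso_refl)

lemma iso_class_mono:
  assumes "z \<in> iso_class scale x" "z \<in> iso_class scale y"
  shows "iso_class scale x \<subseteq> iso_class scale y"
proof
  fix w assume "w \<in> iso_class scale x"
  then have w: "w \<in> Alg scale" "alg_iso scale UNIV x scale UNIV w" by (auto simp: iso_class_def)
  have "alg_iso scale UNIV z scale UNIV x"
    by (rule alg_iso_sym) (use assms(1) in \<open>auto simp: iso_class_def\<close>)
  moreover have "alg_iso scale UNIV y scale UNIV z"
    using assms(2) by (simp add: iso_class_def)
  ultimately have "alg_iso scale UNIV y scale UNIV w"
    using alg_iso_trans[OF alg_iso_trans w(2)] by blast
  then show "w \<in> iso_class scale y" using w(1) by (simp add: iso_class_def)
qed

lemma orbits_partition: "partition_on (Alg scale) (orbit scale ` Alg scale)"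
proof -
  have eq: "iso_class scale x = iso_class scale y"
    if "z \<in> iso_class scale x" "z \<in> iso_class scale y" for x y z
    using iso_class_mono[OF that] iso_class_mono[OF that(2,1)] by blast
  show ?thesis
  proof (rule partition_onI)
    show "\<Union> (orbit scale ` Alg scale) = Alg scale"
      using iso_class_refl by (auto simp: orbit_eq_iso_class) (auto simp: iso_class_def)
    show "disjnt p q" if "p \<in> orbit scale ` Alg scale" "q \<in> orbit scale ` Alg scale" "p \<noteq> q" for p q
      using that eq by (auto simp: orbit_eq_iso_class disjnt_def)
    show "{} \<notin> orbit scale ` Alg scale"
      using iso_class_refl orbit_eq_iso_class by (metis emptyE imageE)
  qed
qed

lemma act_iso_to:
  "g \<in> GL scale \<Longrightarrow> alg_iso scale UNIV x sB B mB \<Longrightarrow> alg_iso scale UNIV (act g x) sB B mB"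
  by (rule alg_iso_trans[OF act_iso_sym])

lemma wedderburn_GL_stable: "GL_stable scale (wstratum W)"
  by (auto simp: GL_stable_def wedderburn_stratum_def act_Alg intro: act_iso_to)

lemma profile_GL_stable: "GL_stable scale (pstratum \<rho>)"
  by (auto simp: GL_stable_def profile_stratum_def act_Alg intro: act_iso_to)

lemma wedderburn_strata_eq:
  assumes "x \<in> wstratum W" "x \<in> wstratum W'"
  shows "wstratum W = wstratum W'"
proof -
  have *: "wstratum W \<subseteq> wstratum W'"
    if "x \<in> wstratum W" "x \<in> wstratum W'" for W W'
  proof
    fix y assume y: "y \<in> wstratum W"
    have iso: "alg_iso (matsum_scale kscale) (matsum_carrier (wtype_blocks W)) (matsum_mult
        (wtype_blocks W))
        scale UNIV x"
      by (rule alg_iso_sym) (use that(1) in \<open>auto simp: wedderburn_stratum_def\<close>)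
    show "y \<in> wstratum W'"
      using y that(2) alg_iso_trans[OF alg_iso_trans[OF _ iso]] by
          (auto simp: wedderburn_stratum_def)
  qed
  show ?thesis using *[OF assms] *[OF assms(2,1)] by blast
qed

text \<open>The sum of matrix algebras has one scalar coordinate for each block, row, column and
  coordinate of the division algebra, altogether \<open>n\<close>. A bijection of these with the
  indices of \<open>e\<close> transports the product to V.\<close>

lemma wedderburn_nonempty:
  assumes W: "W \<in> wtypes n"
  shows "\<exists>x. x \<in> wstratum W"
proof -
  define r where "r s = fst (W ! s)" for s
  define d where "d s = fst (snd (W ! s))" for s
  define m where "m s = snd (snd (W ! s))" for s
  let ?bs = "wtype_blocks W"
  let ?C = "matsum_carrier ?bs"
  let ?M = "matsum_mult ?bs"
  have div: "division_alg (d s) (m s)" if "s < length W" for s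
    using W that by unfold_locales (auto simp: wtypes_iff d_def m_def)
  have ib: "in_blocks ?bs s i j \<longleftrightarrow> s < length W \<and> i < r s \<and> j < r s" for s i j
    by (auto simp: in_blocks_def wtype_blocks_nth r_def)
  have C_iff: "A \<in> ?C \<longleftrightarrow> (\<forall>s i j k. \<not> (s < length W \<and> i < r s \<and> j < r s \<and> k < d s) \<longrightarrow> A s i j k =
      0)" for A
  proof -
    have "A \<in> ?C \<longleftrightarrow> (\<forall>s i j. if in_blocks ?bs s i j then A s i j \<in> kspace (d s) else A s i j = 0)"
      by (simp add: matsum_carrier_def wtype_blocks_nth d_def ib cong: conj_cong)
    moreover have "(if in_blocks ?bs s i j then A s i j \<in> kspace (d s) else A s i j = 0) \<longleftrightarrow>
        (\<forall>k. \<not> (s < length W \<and> i < r s \<and> j < r s \<and> k < d s) \<longrightarrow> A s i j k = 0)" for s i j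
      by (auto simp: ib kspace_def fun_eq_iff not_less)
    ultimately show ?thesis by (simp only:)
  qed
  have CD: "A s i j \<in> kspace (d s)" if "A \<in> ?C" for A s i j
    using that by (auto simp: C_iff kspace_def)
  have M_eval: "?M A B s i j = (if in_blocks ?bs s i j then \<Sum>l<r s. m s (A s i l) (B s l j) else
      0)" for A B s i j
    by (auto simp: matsum_mult_def ib wtype_blocks_nth r_def m_def)
  have M_closed: "?M A B \<in> ?C" if AB: "A \<in> ?C" "B \<in> ?C" for A B
  proof -
    have "?M A B s i j \<in> kspace (d s)" if "in_blocks ?bs s i j" for s i j
    proof -
      interpret division_alg "d s" "m s" using div that by (simp add: ib)
      show ?thesis using that by (simp add: M_eval) (intro kspace_sum closed CD AB)
    qed
    moreover have "?M A B s i j = 0" if "\<not> in_blocks ?bs s i j" for s i j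
      using that by (simp add: M_eval)
    ultimately show ?thesis
      by (simp add: matsum_carrier_def ib wtype_blocks_nth d_def)
  qed
  have M_add: "?M (A + B) C = ?M A C + ?M B C" "?M C (A + B) = ?M C A + ?M C B"
    if ABC: "A \<in> ?C" "B \<in> ?C" "C \<in> ?C" for A B C
  proof -
    have "?M (A + B) C s i j = (?M A C + ?M B C) s i j \<and> ?M C (A + B) s i j =
        (?M C A + ?M C B) s i j" for s i j
    proof (cases "in_blocks ?bs s i j")
      case True
      interpret division_alg "d s" "m s" using div True by (simp add: ib)
      show ?thesis using True by (simp add: M_eval add_l add_r CD ABC sum.distrib)
    qed (simp add: M_eval)
    then show "?M (A + B) C = ?M A C + ?M B C" "?M C (A + B) = ?M C A + ?M C B" by
        (simp_all add: fun_eq_iff)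
  qed
  have kscale_sum: "kscale t (\<Sum>l\<in>L. f l) = (\<Sum>l\<in>L. kscale t (f l))"
      for t :: 'k and f and L :: "nat set"
    by (simp add: kscale_def fun_eq_iff sum_fun_eval sum_distrib_left)
  have M_scale: "?M (matsum_scale kscale t A) C = matsum_scale kscale t (?M A C)"
    "?M C (matsum_scale kscale t A) = matsum_scale kscale t (?M C A)"
    if AC: "A \<in> ?C" "C \<in> ?C" for A C t
  proof -
    have "?M (matsum_scale kscale t A) C s i j = matsum_scale kscale t (?M A C) s i j \<and>
        ?M C (matsum_scale kscale t A) s i j = matsum_scale kscale t (?M C A) s i j" for s i j
    proof (cases "in_blocks ?bs s i j")
      case True
      interpret division_alg "d s" "m s" using div True by (simp add: ib)
      show ?thesis using True by (simp add: M_eval matsum_scale_def kscale_sum scale_l scale_r CD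
          AC)
    qed (simp add: M_eval matsum_scale_def kscale_def fun_eq_iff)
    then show "?M (matsum_scale kscale t A) C = matsum_scale kscale t (?M A C)"
      "?M C (matsum_scale kscale t A) = matsum_scale kscale t (?M C A)" by
          (simp_all add: fun_eq_iff)
  qed
  have M_assoc: "?M (?M A B) C = ?M A (?M B C)" if ABC: "A \<in> ?C" "B \<in> ?C" "C \<in> ?C" for A B C
  proof (intro ext)
    fix s i j k
    show "?M (?M A B) C s i j k = ?M A (?M B C) s i j k"
    proof (cases "in_blocks ?bs s i j")
      case True
      then have s: "s < length W" "i < r s" "j < r s" by (auto simp: ib)
      interpret division_alg "d s" "m s" using div[OF s(1)] .
      have "?M (?M A B) C s i j = (\<Sum>l<r s. \<Sum>p<r s. m s (m s (A s i p) (B s p l)) (C s l j))"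
        using s ABC by (simp add: M_eval[of "?M A B"] ib) (simp add: M_eval ib sum_l closed CD)
      also have "\<dots> = (\<Sum>p<r s. \<Sum>l<r s. m s (A s i p) (m s (B s p l) (C s l j)))"
        by (subst sum.swap) (simp add: m_assoc CD ABC)
      also have "\<dots> = ?M A (?M B C) s i j"
        using s ABC by (simp add: M_eval[of A] ib) (simp add: M_eval ib sum_r closed CD)
      finally show ?thesis by simp
    qed (simp add: M_eval)
  qed
  let ?I = "SIGMA s:{..<length W}. {..<r s} \<times> {..<r s} \<times> {..<d s}"
  have "card ?I = n"
    using W by (simp add: wtypes_iff r_def d_def card_SigmaI card_cartesian_product
        power2_eq_square mult.assoc)
  moreover have "finite ?I" by simp
  ultimately obtain h where h: "bij_betw h {..<n} ?I"
    using ex_bij_betw_nat_finite[of ?I] by (auto simp: atLeast0LessThan)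
  define g where "g = inv_into {..<n} h"
  have gh: "g (h q) = q" if "q < n" for q
    using bij_betw_inv_into_left[OF h, of q] that by (simp add: g_def)
  have hg: "h (g p) = p" "g p < n" if "p \<in> ?I" for p
    using bij_betw_inv_into_right[OF h that] bij_betw_apply[OF bij_betw_inv_into[OF h] that] by
        (auto simp: g_def)
  define \<phi> where "\<phi> v = (\<lambda>s i j k. if (s, i, j, k) \<in> ?I then crd (g (s, i, j, k)) v else 0)" for v
  define \<psi> where "\<psi> A = (\<Sum>q<n. scale (case h q of (s, i, j, k) \<Rightarrow> A s i j k) (e q))" for A
  have \<phi>C: "\<phi> v \<in> ?C" for v by (auto simp: C_iff \<phi>_def)
  have \<phi>\<psi>: "\<phi> (\<psi> A) = A" if "A \<in> ?C" for A
  proof (intro ext)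
    fix s i j k
    show "\<phi> (\<psi> A) s i j k = A s i j k"
    proof (cases "(s, i, j, k) \<in> ?I")
      case True
      then have "crd (g (s, i, j, k)) (\<psi> A) = (case h (g (s, i, j, k)) of (s, i, j, k) \<Rightarrow> A s i j k)"
        using hg(2)[OF True] by (simp add: \<psi>_def crd_sum crd_scale crd_e if_distrib cong: if_cong)
      then show ?thesis using True hg(1)[OF True] by (simp add: \<phi>_def)
    qed (use that in \<open>auto simp: \<phi>_def C_iff\<close>)
  qed
  have \<psi>\<phi>: "\<psi> (\<phi> v) = v" for v
  proof -
    have "(case h q of (s, i, j, k) \<Rightarrow> \<phi> v s i j k) = crd q v" if "q < n" for q
    proof -
      have "h q \<in> ?I" using h that by (auto simp: bij_betw_def)
      then show ?thesis using gh[OF that] by (cases "h q") (auto simp: \<phi>_def)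
    qed
    then show ?thesis by (simp add: \<psi>_def expand[symmetric])
  qed
  have \<phi>_add: "\<phi> (v + w) = \<phi> v + \<phi> w" for v w by (auto simp: \<phi>_def fun_eq_iff crd_add)
  have \<phi>_scale: "\<phi> (scale t v) = matsum_scale kscale t (\<phi> v)" for t v
    by (auto simp: \<phi>_def fun_eq_iff crd_scale matsum_scale_def kscale_def)
  have \<phi>_inj: "v = w" if "\<phi> v = \<phi> w" for v w using that \<psi>\<phi> by metis
  define x where "x v w = \<psi> (?M (\<phi> v) (\<phi> w))" for v w
  have \<phi>x: "\<phi> (x v w) = ?M (\<phi> v) (\<phi> w)" for v w
    by (simp add: x_def \<phi>\<psi> M_closed \<phi>C)
  have "x \<in> Alg scale"
    unfolding Alg_def V21_def
    by (auto intro!: linI \<phi>_inj simp: \<phi>x \<phi>_add \<phi>_scale M_add M_scale M_assoc \<phi>C)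
  moreover have "bij_betw \<phi> UNIV ?C"
    by (rule bij_betw_byWitness[where f' = \<psi>]) (auto simp: \<phi>\<psi> \<psi>\<phi> \<phi>C)
  ultimately have "x \<in> wstratum W"
    unfolding wedderburn_stratum_def alg_iso_def
    by (auto intro!: exI[of _ \<phi>] simp: \<phi>x \<phi>_add \<phi>_scale)
  then show ?thesis by blast
qed

end

subsection \<open>Rank strata\<close>

lemma bij_betw_pick:
  assumes "finite I"
  shows "bij_betw (pick I) {..<card I} I"
proof (rule bij_betw_imageI)
  show inj: "inj_on (pick I) {..<card I}"
    by (rule linorder_inj_onI) (auto dest: pick_mono_le)
  show "pick I ` {..<card I} = I"
  proof (rule card_subset_eq[OF assms])
    show "pick I ` {..<card I} \<subseteq> I" using pick_in_set_le by auto
    show "card (pick I ` {..<card I}) = card I" using card_image[OF inj] by simp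
  qed
qed

lemma submatrix_mat:
  assumes "I \<subseteq> {..<R}" "J \<subseteq> {..<N}"
  shows "submatrix (mat R N f) I J = mat (card I) (card J) (\<lambda>(a, b). f (pick I a, pick J b))"
proof -
  have "{i. i < R \<and> i \<in> I} = I" "{j. j < N \<and> j \<in> J} = J" using assms by auto
  moreover have "pick I a < R" if "a < card I" for a using pick_in_set_le[OF that] assms by auto
  moreover have "pick J b < N" if "b < card J" for b using pick_in_set_le[OF that] assms by auto
  ultimately show ?thesis by (auto simp: submatrix_def intro!: eq_matI)
qed

section \<open>The dimension of a span in terms of minors\<close>

context vector_space
begin

text \<open>In the application the vectors are functions of three arguments, in a space for which no
  finite basis is given. Finitely many functionals \<open>\<psi> i\<close> that separate the span of
  the \<open>w j\<close> take the place of coordinates.\<close>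

context
  fixes w :: "nat \<Rightarrow> 'b" and \<psi> :: "nat \<Rightarrow> 'b \<Rightarrow> 'a" and R N :: nat
  assumes lin: "\<And>i. i < R \<Longrightarrow> Vector_Spaces.linear scale (*) (\<psi> i)"
    and sep: "\<And>v. v \<in> span (w ` {..<N}) \<Longrightarrow> (\<And>i. i < R \<Longrightarrow> \<psi> i v = 0) \<Longrightarrow> v = 0"
begin

lemma functional_add: "i < R \<Longrightarrow> \<psi> i (a + b) = \<psi> i a + \<psi> i b"
  and functional_scale: "i < R \<Longrightarrow> \<psi> i (scale t a) = t * \<psi> i a"
  using lin by (auto simp: Vector_Spaces.linear_iff)

lemma functional_sum: "i < R \<Longrightarrow> \<psi> i (\<Sum>j\<in>J. f j) = (\<Sum>j\<in>J. \<psi> i (f j))"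
  using functional_scale[of i 0 0] by (induction J rule: infinite_finite_induct)
      (auto simp: functional_add)

lemma functional_diff: "i < R \<Longrightarrow> \<psi> i (a - b) = \<psi> i a - \<psi> i b"
  using functional_add[of i "a - b" b] by simp

lemma minor_mult_vec:
  assumes "I \<subseteq> {..<R}" "J \<subseteq> {..<N}" "card I = r" "card J = r"
  shows "mat r r (\<lambda>(a, b). \<psi> (pick I a) (w (pick J b))) *\<^sub>v vec r c =
    vec r (\<lambda>a. \<psi> (pick I a) (\<Sum>b<r. scale (c b) (w (pick J b))))"
proof -
  have "pick I a < R" if "a < r" for a using pick_in_set_le[of a I] assms that by auto
  then show ?thesis
    by (intro eq_vecI) (auto simp: scalar_prod_def functional_sum functional_scale
        lessThan_atLeast0 mult.commute)
qed

text \<open>A linear relation among the selected vectors would put its coefficients into the kernel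
  of the minor, so these vectors are distinct and independent.\<close>

lemma minor_le_dim:
  assumes IJ: "I \<subseteq> {..<R}" "J \<subseteq> {..<N}" "card I = r" "card J = r"
    and det: "det (submatrix (mat R N (\<lambda>(i, j). \<psi> i (w j))) I J) \<noteq> 0"
  shows "r \<le> dim (span (w ` {..<N}))"
proof -
  let ?A = "mat r r (\<lambda>(a, b). \<psi> (pick I a) (w (pick J b)))"
  let ?y = "\<lambda>b. w (pick J b)"
  have A: "?A \<in> carrier_mat r r" by simp
  have detA: "det ?A \<noteq> 0"
    using det by (simp add: submatrix_mat IJ)
  have pickR: "pick I a < R" if "a < r" for a using pick_in_set_le[of a I] IJ that by auto
  have zero: "c b = 0" if "(\<Sum>b<r. scale (c b) (?y b)) = 0" "b < r" for c b
  proof -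
    have "\<psi> (pick I a) 0 = 0" if "a < r" for a
      using functional_scale[OF pickR[OF that], of 0 0] by simp
    then have "?A *\<^sub>v vec r c = 0\<^sub>v r"
      by (subst minor_mult_vec[OF IJ]) (auto simp: that(1))
    then have "vec r c = 0\<^sub>v r"
      using detA det_0_iff_vec_prod_zero_field[OF A] by (metis vec_carrier)
    then show ?thesis using that(2) by (metis index_vec index_zero_vec(1))
  qed
  have inj: "inj_on ?y {..<r}"
  proof (rule inj_onI, rule ccontr)
    fix a b assume ab: "a \<in> {..<r}" "b \<in> {..<r}" "?y a = ?y b" "a \<noteq> b"
    \<comment> \<open>Two equal vectors satisfy the relation with coefficients 1 and - 1.\<close>
    let ?c = "\<lambda>i. if i = a then 1 else if i = b then - 1 else 0 :: 'a"
    have "(\<Sum>i<r. scale (?c i) (?y i)) = (\<Sum>i<r. (if i = a then ?y i else 0) - (if i =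
        b then ?y i else 0))"
      using ab(4) by (intro sum.cong) auto
    also have "\<dots> = ?y a - ?y b" using ab(1,2) by (simp add: sum_subtractf)
    finally have "?c a = 0" using ab by (intro zero) auto
    then show False by simp
  qed
  have "independent (?y ` {..<r})"
  proof (rule independent_if_scalars_zero)
    fix f v assume *: "(\<Sum>v\<in>?y ` {..<r}. scale (f v) v) = 0" "v \<in> ?y ` {..<r}"
    then obtain b where "b < r" "v = ?y b" by auto
    then show "f v = 0"
      using zero[of "\<lambda>b. f (?y b)" b] *(1) by (simp add: sum.reindex[OF inj])
  qed simp
  moreover obtain B where B: "B \<subseteq> span (w ` {..<N})" "independent B" "span (w ` {..<N}) \<subseteq> span B"
    "card B = dim (span (w ` {..<N}))"
    by (rule basis_exists)
  moreover have "finite B"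
    using independent_span_bound[of "w ` {..<N}" B] B by simp
  moreover have "?y ` {..<r} \<subseteq> span B"
  proof -
    have "pick J b < N" if "b < r" for b using pick_in_set_le[of b J] IJ that by auto
    then have "?y ` {..<r} \<subseteq> span (w ` {..<N})" by (auto intro: span_base)
    then show ?thesis using B(3) by blast
  qed
  ultimately have "card (?y ` {..<r}) \<le> dim (span (w ` {..<N}))"
    using independent_span_bound by metis
  then show ?thesis by (simp add: card_image[OF inj])
qed

text \<open>A minimal set of functionals separating the span of independent vectors has a dual basis,
  hence as many elements as there are vectors.\<close>

lemma minor_exists:
  assumes J: "J \<subseteq> {..<N}" "inj_on w J" "independent (w ` J)"
  shows "\<exists>I\<subseteq>{..<R}. card I = card J \<and> det (submatrix (mat R N (\<lambda>(i, j). \<psi> i (w j))) I J) \<noteq> 0"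
proof -
  define V where "V = span (w ` J)"
  have VW: "V \<subseteq> span (w ` {..<N})" unfolding V_def using J(1) by (intro span_mono) auto
  have finJ: "finite J" using J(1) finite_subset by blast
  define separates where "separates I \<longleftrightarrow> (\<forall>v\<in>V. (\<forall>i\<in>I. \<psi> i v = 0) \<longrightarrow> v = 0)" for I
  have "separates {..<R}" using sep VW by (auto simp: separates_def)
  then obtain I where I: "I \<subseteq> {..<R}" "separates I"
    and min: "\<And>I'. I' \<subseteq> {..<R} \<Longrightarrow> separates I' \<Longrightarrow> card I \<le> card I'"
    using ex_has_least_nat[of "\<lambda>I. I \<subseteq> {..<R} \<and> separates I" "{..<R}" card] by auto
  have finI: "finite I" using I(1) finite_subset by blast
  have IR: "i < R" if "i \<in> I" for i using I(1) that by auto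
  \<comment> \<open>By minimality, separation fails once \<open>i\<close> is dropped. A vector
    witnessing this is killed by all other functionals of \<open>I\<close>, hence is dual to
    \<open>\<psi> i\<close> up to a nonzero factor.\<close>
  have "\<forall>i. \<exists>v. i \<in> I \<longrightarrow> v \<in> V \<and> v \<noteq> 0 \<and> (\<forall>i'\<in>I - {i}. \<psi> i' v = 0)"
  proof
    fix i
    show "\<exists>v. i \<in> I \<longrightarrow> v \<in> V \<and> v \<noteq> 0 \<and> (\<forall>i'\<in>I - {i}. \<psi> i' v = 0)"
    proof (cases "i \<in> I")
      case True
      then have "card (I - {i}) < card I" using finI by (intro psubset_card_mono) auto
      then have "\<not> separates (I - {i})" using min[of "I - {i}"] I(1) by auto
      then show ?thesis unfolding separates_def by blast
    qed simp
  qed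
  from choice[OF this] obtain \<phi> where \<phi>: "\<forall>i. i \<in> I \<longrightarrow> \<phi> i \<in> V \<and> \<phi> i \<noteq> 0 \<and>
      (\<forall>i'\<in>I - {i}. \<psi> i' (\<phi> i) = 0)" ..
  have \<phi>V: "\<phi> i \<in> V" if "i \<in> I" for i using \<phi> that by blast
  have off: "\<psi> i' (\<phi> i) = 0" if "i \<in> I" "i' \<in> I" "i' \<noteq> i" for i i' using \<phi> that by blast
  have diag: "\<psi> i (\<phi> i) \<noteq> 0" if "i \<in> I" for i
    using I(2) \<phi> that unfolding separates_def by blast
  have eval: "\<psi> i (\<Sum>j\<in>I. scale (c j) (\<phi> j)) = c i * \<psi> i (\<phi> i)" if "i \<in> I" for i c
  proof -
    have "\<psi> i (\<Sum>j\<in>I. scale (c j) (\<phi> j)) = (\<Sum>j\<in>I. c j * \<psi> i (\<phi> j))"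
      by (simp add: functional_sum functional_scale IR that)
    also have "\<dots> = (\<Sum>j\<in>I. if j = i then c i * \<psi> i (\<phi> i) else 0)"
      using off that by (intro sum.cong) auto
    finally show ?thesis using that finI by simp
  qed
  have inj: "inj_on \<phi> I"
    by (rule inj_onI) (metis off diag)
  have ind: "independent (\<phi> ` I)"
  proof (rule independent_if_scalars_zero)
    fix f v assume *: "(\<Sum>v\<in>\<phi> ` I. scale (f v) v) = 0" "v \<in> \<phi> ` I"
    then obtain i where i: "i \<in> I" "v = \<phi> i" by auto
    have "\<psi> i 0 = 0" using functional_scale[OF IR[OF i(1)], of 0 0] by simp
    then show "f v = 0"
      using eval[OF i(1), of "\<lambda>j. f (\<phi> j)"] * diag[OF i(1)] by (simp add: sum.reindex[OF inj] i(2))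
  qed (simp add: finI)
  have "V \<subseteq> span (\<phi> ` I)"
  proof
    fix v assume v: "v \<in> V"
    let ?s = "\<Sum>j\<in>I. scale (\<psi> j v / \<psi> j (\<phi> j)) (\<phi> j)"
    have "v - ?s \<in> V"
      unfolding V_def by (intro span_diff span_sum span_scale) (use v \<phi>V V_def in auto)
    moreover have "\<psi> i (v - ?s) = 0" if "i \<in> I" for i
      using eval[OF that] diag[OF that] by (simp add: functional_diff IR that)
    ultimately have "v - ?s = 0" using I(2) unfolding separates_def by blast
    moreover have "?s \<in> span (\<phi> ` I)" by (intro span_sum span_scale span_base) auto
    ultimately show "v \<in> span (\<phi> ` I)" by simp
  qed
  then have "dim V = card (\<phi> ` I)"
    using \<phi>V ind by (intro dim_unique[of "\<phi> ` I"]) auto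
  moreover have "dim V = card (w ` J)"
    unfolding V_def by (rule dim_span_eq_card_independent[OF J(3)])
  ultimately have card: "card I = card J"
    by (simp add: card_image inj J(2))
  let ?r = "card J"
  let ?A = "mat ?r ?r (\<lambda>(a, b). \<psi> (pick I a) (w (pick J b)))"
  have A: "?A \<in> carrier_mat ?r ?r" by simp
  \<comment> \<open>A kernel vector of the minor would combine the \<open>w j\<close> to a vector
    \<open>y\<close> on which all functionals of \<open>I\<close> vanish. Then \<open>y = 0\<close>,
    against independence.\<close>
  have "det ?A \<noteq> 0"
  proof
    assume "det ?A = 0"
    then obtain v where v: "v \<in> carrier_vec ?r" "v \<noteq> 0\<^sub>v ?r" "?A *\<^sub>v v = 0\<^sub>v ?r"
      using det_0_iff_vec_prod_zero_field[OF A] by blast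
    define y where "y = (\<Sum>b<?r. scale (v $ b) (w (pick J b)))"
    have v': "v = vec ?r (\<lambda>b. v $ b)" using v(1) by auto
    have "vec ?r (\<lambda>a. \<psi> (pick I a) y) = 0\<^sub>v ?r"
      unfolding y_def using minor_mult_vec[OF I(1) J(1) card refl, of "\<lambda>b. v $ b"] v(3) v' by simp
    then have "\<psi> (pick I a) y = 0" if "a < ?r" for a using that by
        (metis index_vec index_zero_vec(1))
    then have "\<psi> i y = 0" if "i \<in> pick I ` {..<card I}" for i
      using that card by auto
    then have "\<psi> i y = 0" if "i \<in> I" for i
      using that bij_betw_imp_surj_on[OF bij_betw_pick[OF finI]] by simp
    moreover have "y \<in> V"
      unfolding V_def y_def by (intro span_sum span_scale span_base) (auto simp: pick_in_set_le)
    ultimately have "y = 0" using I(2) unfolding separates_def by blast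
    have bij: "bij_betw (\<lambda>b. w (pick J b)) {..<?r} (w ` J)"
      using bij_betw_trans[OF bij_betw_pick[OF finJ] inj_on_imp_bij_betw[OF J(2)]] by
          (simp add: comp_def)
    define f where "f u = v $ (inv_into {..<?r} (\<lambda>b. w (pick J b)) u)" for u
    have f: "f (w (pick J b)) = v $ b" if "b < ?r" for b
      using bij_betw_inv_into_left[OF bij, of b] that by (simp add: f_def)
    have "(\<Sum>u\<in>w ` J. scale (f u) u) = y"
      unfolding y_def sum.reindex_bij_betw[OF bij, symmetric] by (simp add: f)
    then have "f u = 0" if "u \<in> w ` J" for u
      using J(3) \<open>y = 0\<close> that finJ unfolding independent_explicit_finite_subsets by blast
    then have "v $ b = 0" if "b < ?r" for b
      using f[OF that] pick_in_set_le[OF that] by auto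
    then show False using v(1,2) by (auto intro!: eq_vecI)
  qed
  then show ?thesis using I(1) card by (intro exI[of _ I]) (simp add: submatrix_mat J(1))
qed

text \<open>A nonzero minor of size \<open>k\<close> exists exactly if \<open>k\<close> is at most
  the dimension; the claim combines the cases \<open>r\<close> and \<open>Suc r\<close>.\<close>

lemma dim_eq_iff_minors:
  "dim (span (w ` {..<N})) = r \<longleftrightarrow>
    (\<forall>f\<in>minors (Suc r) (mat R N (\<lambda>(i, j). \<psi> i (w j))). f = 0) \<and>
    (\<exists>f\<in>minors r (mat R N (\<lambda>(i, j). \<psi> i (w j))). f \<noteq> 0)"
proof -
  let ?d = "dim (span (w ` {..<N}))"
  have "(\<exists>f\<in>minors k (mat R N (\<lambda>(i, j). \<psi> i (w j))). f \<noteq> 0) \<longleftrightarrow> k \<le> ?d" for k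
  proof
    assume "\<exists>f\<in>minors k (mat R N (\<lambda>(i, j). \<psi> i (w j))). f \<noteq> 0"
    then show "k \<le> ?d" using minor_le_dim by (auto simp: minors_def)
  next
    assume k: "k \<le> ?d"
    obtain B where B: "B \<subseteq> w ` {..<N}" "independent B" "w ` {..<N} \<subseteq> span B" "card B =
        dim (w ` {..<N})"
      by (rule basis_exists)
    then obtain B' where B': "B' \<subseteq> B" "card B' = k"
      using k obtain_subset_with_card_n[of k B] by (metis dim_span)
    then obtain J where J: "J \<subseteq> {..<N}" "inj_on w J" "w ` J = B'"
      using B(1) subset_image_inj[of B' w "{..<N}"] by blast
    have ind: "independent (w ` J)" using B(2) B'(1) J(3) independent_mono by blast
    have k: "card J = k" using B'(2) J(3) card_image[OF J(2)] by simp
    obtain I where I: "I \<subseteq> {..<R}" "card I = card J"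
      "det (submatrix (mat R N (\<lambda>(i, j). \<psi> i (w j))) I J) \<noteq> 0"
      using minor_exists[OF J(1,2) ind] by (elim exE conjE) (rule that)
    have "det (submatrix (mat R N (\<lambda>(i, j). \<psi> i (w j))) I J) \<in> minors k (mat R N (\<lambda>(i,
        j). \<psi> i (w j)))"
      unfolding minors_def using I(1,2) J(1) k by (intro CollectI exI[of _ I] exI[of _ J]) simp
    then show "\<exists>f\<in>minors k (mat R N (\<lambda>(i, j). \<psi> i (w j))). f \<noteq> 0"
      using I(3) by blast
  qed
  from this[of r] this[of "Suc r"] show ?thesis by force
qed

end

end

lemma (in comm_ring_hom) minors_map_mat: "minors r (map_mat hom M) = hom ` minors r M"
proof -
  have sub: "submatrix (map_mat hom M) I J = map_mat hom (submatrix M I J)" for I J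
    by (rule eq_matI) (auto simp: submatrix_def pick_le)
  show ?thesis
    unfolding minors_def by (auto simp: sub)
qed

section \<open>The Hochschild differential as a matrix of polynomials\<close>

context based_space
begin

definition scale3 :: "'k \<Rightarrow> ('v \<Rightarrow> 'v \<Rightarrow> 'v \<Rightarrow> 'v) \<Rightarrow> 'v \<Rightarrow> 'v \<Rightarrow> 'v \<Rightarrow> 'v" where
  "scale3 t \<phi> = (\<lambda>a b c. scale t (\<phi> a b c))"

lemma vs3: "vector_space scale3"
  by unfold_locales (auto simp: scale3_def fun_eq_iff scale_right_distrib scale_left_distrib)

interpretation V3: vector_space scale3 by (rule vs3)

lemma rk_d_V3: "rk_d scale x = V3.dim (hochschild_d x ` V21 scale)"
  by (simp add: rk_d_def scale3_def[abs_def])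

definition elem :: "nat \<times> nat \<times> nat \<Rightarrow> 'v \<Rightarrow> 'v \<Rightarrow> 'v" where
  "elem = (\<lambda>(i, j, k) a b. scale (crd i a * crd j b) (e k))"

definition entry :: "nat \<times> nat \<times> nat \<times> nat \<Rightarrow> ('v \<Rightarrow> 'v \<Rightarrow> 'v \<Rightarrow> 'v) \<Rightarrow> 'k" where
  "entry = (\<lambda>(i, j, k, l) \<phi>. crd l (\<phi> (e i) (e j) (e k)))"

definition trilinear :: "('v \<Rightarrow> 'v \<Rightarrow> 'v \<Rightarrow> 'v) \<Rightarrow> bool" where
  "trilinear \<phi> \<longleftrightarrow> (\<forall>b c. lin (\<lambda>a. \<phi> a b c)) \<and> (\<forall>a c. lin (\<lambda>b. \<phi> a b c)) \<and> (\<forall>a b. lin (\<lambda>c. \<phi> a b c))"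

lemma elem_V21: "elem p \<in> V21 scale"
  by (cases p) (auto simp: elem_def V21_def crd_add crd_scale algebra_simps scale_left_distrib
      intro!: linI)

lemma V21_lin: "x \<in> V21 scale \<Longrightarrow> lin (\<lambda>a. x a b)" "x \<in> V21 scale \<Longrightarrow> lin (\<lambda>b. x a b)"
  by (auto simp: V21_def)

lemmas V21_simps = lin_add[OF V21_lin(1)] lin_add[OF V21_lin(2)] lin_scale[OF V21_lin(1)]
    lin_scale[OF V21_lin(2)]

lemma hochschild_trilinear:
  assumes "x \<in> V21 scale" "f \<in> V21 scale"
  shows "trilinear (hochschild_d x f)"
  unfolding trilinear_def hochschild_d_def
  by (auto intro!: linI simp: V21_simps[OF assms(1)] V21_simps[OF assms(2)] scale_right_distrib
      scale_right_diff_distrib)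

text \<open>This provides the separation required for the minors. The entries separate trilinear
  maps but not arbitrary functions of three arguments, so \<open>span_trilinear\<close> has to
  accompany it.\<close>

lemma trilinear_eqI:
  assumes "trilinear \<phi>" "\<And>i j k l. i < n \<Longrightarrow> j < n \<Longrightarrow> k < n \<Longrightarrow> l < n \<Longrightarrow> entry (i, j, k, l) \<phi> = 0"
  shows "\<phi> = 0"
proof -
  have l: "lin (\<lambda>a. \<phi> a b c)" "lin (\<lambda>b. \<phi> a b c)" "lin (\<lambda>c. \<phi> a b c)" for a b c
    using assms(1) by (auto simp: trilinear_def)
  have lin0: "lin (\<lambda>a. 0)" by (rule linI) auto
  have 1: "\<phi> (e i) (e j) (e k) = 0" if "i < n" "j < n" "k < n" for i j k
    using assms(2)[OF that] by (intro crd_eqI) (simp add: entry_def crd_zero)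
  have 2: "\<phi> (e i) (e j) c = 0" if "i < n" "j < n" for i j c
    by (rule lin_eqI[OF l(3) lin0]) (simp add: 1 that)
  have 3: "\<phi> (e i) b c = 0" if "i < n" for i b c
    by (rule lin_eqI[OF l(2) lin0]) (simp add: 2 that)
  have "\<phi> a b c = 0" for a b c
    by (rule lin_eqI[OF l(1) lin0]) (simp add: 3)
  then show ?thesis by (simp add: fun_eq_iff)
qed

lemma linear_entry: "Vector_Spaces.linear scale3 (*) (entry p)"
  by (cases p) (simp add: Vector_Spaces.linear_iff vs3 vs_mult entry_def crd_add crd_scale
      scale3_def)

text \<open>The differential is linear in its argument and the maps \<open>elem p\<close> span
  \<open>V21\<close>. The enumeration \<open>h\<close> of the index triples turns them into a family
  indexed by numbers, as the lemmas on minors expect.\<close>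

lemma span_image_hochschild:
  assumes x: "x \<in> V21 scale" and h: "h ` {..<N} = {..<n} \<times> {..<n} \<times> {..<n}"
  shows "V3.span (hochschild_d x ` V21 scale) = V3.span ((\<lambda>q. hochschild_d x (elem (h q))) `
      {..<N})"
proof (rule V3.span_eq[THEN iffD2], intro conjI subsetI)
  fix \<phi> assume "\<phi> \<in> (\<lambda>q. hochschild_d x (elem (h q))) ` {..<N}"
  then show "\<phi> \<in> V3.span (hochschild_d x ` V21 scale)"
    by (auto intro!: V3.span_base elem_V21)
next
  fix \<phi> assume "\<phi> \<in> hochschild_d x ` V21 scale"
  then obtain f where f: "f \<in> V21 scale" "\<phi> = hochschild_d x f" by blast
  let ?c = "\<lambda>(i, j, k). crd k (f (e i) (e j))"
  let ?I = "{..<n} \<times> {..<n} \<times> {..<n}"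
  have fe: "f a b = (\<Sum>p\<in>?I. scale (?c p) (elem p a b))" for a b
  proof -
    have "f a b = (\<Sum>i<n. \<Sum>j<n. \<Sum>k<n. scale (?c (i, j, k)) (elem (i, j, k) a b))"
      by (subst V21_expand[OF f(1)], intro sum.cong refl, subst expand)
         (simp add: elem_def scale_sum_right mult.commute)
    then show ?thesis by (simp add: sum.cartesian_product case_prod_unfold)
  qed
  have "\<phi> = (\<Sum>p\<in>?I. scale3 (?c p) (hochschild_d x (elem p)))"
  proof (intro ext)
    fix a b c
    have "x a (f b c) = (\<Sum>p\<in>?I. scale (?c p) (x a (elem p b c)))"
      by (subst fe) (simp only: lin_sum[OF V21_lin(2)[OF x]] lin_scale[OF V21_lin(2)[OF x]])
    moreover have "x (f a b) c = (\<Sum>p\<in>?I. scale (?c p) (x (elem p a b) c))"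
      by (subst fe) (simp only: lin_sum[OF V21_lin(1)[OF x]] lin_scale[OF V21_lin(1)[OF x]])
    ultimately have "hochschild_d x f a b c = (\<Sum>p\<in>?I. scale (?c p) (hochschild_d x (elem p) a b c))"
      unfolding hochschild_d_def by (subst fe[of "x a b" c], subst fe[of a "x b c"])
        (simp only: scale_right_distrib scale_right_diff_distrib sum.distrib sum_subtractf)
    then show "\<phi> a b c = (\<Sum>p\<in>?I. scale3 (?c p) (hochschild_d x (elem p))) a b c"
      by (simp add: f(2) sum_fun_eval scale3_def)
  qed
  also have "\<dots> \<in> V3.span ((\<lambda>q. hochschild_d x (elem (h q))) ` {..<N})"
  proof (intro V3.span_sum V3.span_scale V3.span_base)
    fix p assume "p \<in> ?I"
    then have "p \<in> h ` {..<N}" by (simp only: h)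
    then show "hochschild_d x (elem p) \<in> (\<lambda>q. hochschild_d x (elem (h q))) ` {..<N}" by auto
  qed
  finally show "\<phi> \<in> V3.span ((\<lambda>q. hochschild_d x (elem (h q))) ` {..<N})" .
qed

lemma span_trilinear:
  assumes x: "x \<in> V21 scale" and \<phi>: "\<phi> \<in> V3.span (hochschild_d x ` V21 scale)"
  shows "trilinear \<phi>"
  using \<phi>
proof (induction rule: V3.span_induct_alt)
  case base
  then show ?case by (auto simp: trilinear_def intro!: linI)
next
  case (step c \<eta> \<zeta>)
  then have "trilinear \<eta>" using hochschild_trilinear[OF x] by auto
  then show ?case using step
    unfolding trilinear_def scale3_def
    by (auto intro!: linI simp: Vector_Spaces.linear_iff scale_right_distrib algebra_simps)
qed

lemma polyfun_hochschild_entry: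
  assumes "i < n" "j < n" "k < n" "l < n" "p = (a, b, c)" "a < n" "b < n" "c < n"
  shows "polyfun (\<lambda>x. entry (i, j, k, l) (hochschild_d x (elem p)))"
proof -
  have *: "polyfun (\<lambda>x. crd q (x (e r) (e s)))" if "q < n" for q r s
    using polyvec_mult[OF polyvec_const polyvec_const, of "e r" "e s"] that by
        (simp add: polyvec_def)
  have "polyvec (\<lambda>x. hochschild_d x (elem p) (e i) (e j) (e k))"
    unfolding hochschild_d_def assms(5) elem_def prod.case
    by (intro polyvec_diff polyvec_add polyvec_mult polyvec_const polyvec_scale polyfun_mult
        polyfun_const *)
       (use assms in auto)
  then show ?thesis using assms(4) by (simp add: polyvec_def entry_def)
qed

text \<open>A single matrix of polynomials must serve all points. Its columns belong to the
  elementary bilinear maps and its rows to the entries of a trilinear map; evaluated at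
  \<open>x\<close> it is the matrix of the differential of \<open>x\<close>.\<close>

lemma determinantal_rank: "determinantal scale n e (Alg scale) (rstratum)"
proof -
  let ?I3 = "{..<n} \<times> {..<n} \<times> {..<n}"
  let ?I4 = "{..<n} \<times> {..<n} \<times> {..<n} \<times> {..<n}"
  obtain h where h: "bij_betw h {0..<card ?I3} ?I3"
    using ex_bij_betw_nat_finite[of ?I3] by auto
  obtain g where g: "bij_betw g {0..<card ?I4} ?I4"
    using ex_bij_betw_nat_finite[of ?I4] by auto
  define N where "N = card ?I3"
  define R where "R = card ?I4"
  have hI: "h ` {..<N} = ?I3" using h by (simp add: bij_betw_def N_def atLeast0LessThan)
  have gI: "g ` {..<R} = ?I4" using g by (simp add: bij_betw_def R_def atLeast0LessThan)
  let ?w = "\<lambda>x q. hochschild_d x (elem (h q))"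
  have poly: "polyfun (\<lambda>x. entry (g p) (?w x q))" if pq: "p < R" "q < N" for p q
  proof -
    have "g p \<in> ?I4" "h q \<in> ?I3" using gI hI pq by blast+
    then obtain i j k l a b c where gp: "g p = (i, j, k, l)" "i < n" "j < n" "k < n" "l < n"
      and hq: "h q = (a, b, c)" "a < n" "b < n" "c < n"
      by (cases "g p", cases "h q") auto
    show ?thesis unfolding gp(1) by (rule polyfun_hochschild_entry[OF gp(2-5) hq])
  qed
  have "\<forall>pq. \<exists>f. fst pq < R \<and> snd pq < N \<longrightarrow>
      (\<forall>x\<in>V21 scale. entry (g (fst pq)) (?w x (snd pq)) = ev f x)"
    using poly unfolding polyfun_def by blast
  from choice[OF this] obtain P where P: "\<forall>pq. fst pq < R \<and> snd pq < N \<longrightarrow>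
      (\<forall>x\<in>V21 scale. entry (g (fst pq)) (?w x (snd pq)) = ev (P pq) x)" ..
  define M where "M = mat R N P"
  have main: "rk_d scale x = r \<longleftrightarrow> (\<forall>f\<in>minors (Suc r) M. ev f x = 0) \<and>
      (\<exists>f\<in>minors r M. ev f x \<noteq> 0)" if x: "x \<in> V21 scale" for x r
  proof -
    interpret hom: comm_ring_hom "\<lambda>p. ev p x" by (rule sc_eval_hom)
    have M: "map_mat (\<lambda>p. ev p x) M = mat R N (\<lambda>(p, q). entry (g p) (?w x q))"
      using P x by (intro eq_matI) (auto simp: M_def)
    have span: "V3.span (hochschild_d x ` V21 scale) = V3.span (?w x ` {..<N})"
      by (rule span_image_hochschild[OF x hI])
    have "V3.dim (V3.span (?w x ` {..<N})) = r \<longleftrightarrow>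
        (\<forall>f\<in>minors (Suc r) (mat R N (\<lambda>(p, q). entry (g p) (?w x q))). f = 0) \<and>
        (\<exists>f\<in>minors r (mat R N (\<lambda>(p, q). entry (g p) (?w x q))). f \<noteq> 0)"
    proof (rule V3.dim_eq_iff_minors)
      fix \<phi> assume \<phi>: "\<phi> \<in> V3.span (?w x ` {..<N})" "\<And>p. p < R \<Longrightarrow> entry (g p) \<phi> = 0"
      show "\<phi> = 0"
      proof (rule trilinear_eqI)
        show "trilinear \<phi>" using \<phi>(1) span_trilinear[OF x] span by simp
        fix i j k l assume "i < n" "j < n" "k < n" "l < n"
        then have "(i, j, k, l) \<in> g ` {..<R}" by (simp add: gI)
        then show "entry (i, j, k, l) \<phi> = 0" using \<phi>(2) by auto
      qed
    qed (rule linear_entry)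
    moreover have "rk_d scale x = V3.dim (V3.span (?w x ` {..<N}))"
      by (simp only: rk_d_V3 span[symmetric] V3.dim_span)
    ultimately show ?thesis
      unfolding M[symmetric] hom.minors_map_mat by auto
  qed
  show ?thesis
    unfolding determinantal_def
    by (rule exI[of _ M]) (simp add: rank_stratum_def main Alg_V21 cong: conj_cong)
qed

lemma rank_stratum_locally_closed:
  "locally_closed_in (zariskiA) (rstratum r)"
proof -
  obtain M :: "'k sc_poly mat" where M: "\<forall>r. rstratum r =
      {x \<in> Alg scale. (\<forall>f\<in>minors (Suc r) M. ev f x = 0) \<and>
      (\<exists>f\<in>minors r M. ev f x \<noteq> 0)}"
    using determinantal_rank unfolding determinantal_def ..
  let ?W = "{x \<in> Alg scale. \<exists>f\<in>ev ` minors r M. f x \<noteq> 0}"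
  let ?C = "{x \<in> Alg scale. \<forall>f\<in>ev ` minors (Suc r) M. f x = 0}"
  have "rstratum r = ?W \<inter> ?C" using M by auto
  moreover have "openin (zariskiA) ?W"
    by (rule openin_some_nonzero) (auto simp: polyfun_sc_eval)
  moreover have "closedin (zariskiA) ?C"
    by (rule closedin_zeros) (auto simp: polyfun_sc_eval)
  ultimately show ?thesis unfolding locally_closed_in_def by blast
qed

lemma finite_rank_strata: "finite {r. rstratum r \<noteq> {}}"
proof -
  obtain M :: "'k sc_poly mat" where M: "\<forall>r. rstratum r =
      {x \<in> Alg scale. (\<forall>f\<in>minors (Suc r) M. ev f x = 0) \<and>
      (\<exists>f\<in>minors r M. ev f x \<noteq> 0)}"
    using determinantal_rank unfolding determinantal_def ..
  have "{r. rstratum r \<noteq> {}} \<subseteq> {..dim_row M}"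
  proof
    fix r assume "r \<in> {r. rstratum r \<noteq> {}}"
    then obtain x where "x \<in> rstratum r" by auto
    then have "\<exists>f\<in>minors r M. ev f x \<noteq> 0" unfolding M[rule_format] by simp
    then obtain I where "I \<subseteq> {..<dim_row M}" "card I = r" unfolding minors_def by blast
    then show "r \<in> {..dim_row M}" using card_mono[of "{..<dim_row M}" I] by simp
  qed
  then show ?thesis by (rule finite_subset) simp
qed

lemma act_V21:
  assumes g: "g \<in> GL scale" and f: "f \<in> V21 scale"
  shows "act g f \<in> V21 scale"
proof -
  have lg: "lin g" "lin (inv_into UNIV g)" using g GL_inv(1)[OF g] by (auto simp: GL_def)
  show ?thesis
    unfolding V21_def act_def
    by (auto intro!: linI simp: lin_add[OF lg(1)] lin_add[OF lg(2)] lin_scale[OF lg(1)]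
        lin_scale[OF lg(2)] V21_simps[OF f])
qed

text \<open>The differential is equivariant: conjugation \<open>C\<close> by \<open>g\<close> is
  linear and injective and carries the image of the differential of \<open>x\<close> onto that of
  \<open>act g x\<close>.\<close>

lemma rk_d_act:
  assumes g: "g \<in> GL scale"
  shows "rk_d scale (act g x) = rk_d scale x"
proof -
  let ?g' = "inv_into UNIV g"
  have lg: "lin g" "lin ?g'" using g GL_inv(1)[OF g] by (auto simp: GL_def)
  have gg: "g (?g' a) = a" "?g' (g a) = a" for a using GL_inv[OF g] by auto
  have g_diff: "g (a - b) = g a - g b" for a b using lin_add[OF lg(1), of "a - b" b] by simp
  define C where "C \<phi> = (\<lambda>a b c. g (\<phi> (?g' a) (?g' b) (?g' c)))" for \<phi> :: "'v \<Rightarrow> 'v \<Rightarrow> 'v \<Rightarrow> 'v"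
  have linC: "Vector_Spaces.linear scale3 scale3 C"
    by (simp add: Vector_Spaces.linear_iff vs3 C_def fun_eq_iff scale3_def lin_add[OF lg(1)]
        lin_scale[OF lg(1)])
  have injC: "inj C"
  proof (rule injI)
    fix \<phi> \<eta> assume eq: "C \<phi> = C \<eta>"
    have "\<phi> a b c = \<eta> a b c" for a b c
    proof -
      have "C \<phi> (g a) (g b) (g c) = C \<eta> (g a) (g b) (g c)" by (simp only: eq)
      then have "g (\<phi> a b c) = g (\<eta> a b c)" by (simp add: C_def gg)
      then show ?thesis by (metis gg(2))
    qed
    then show "\<phi> = \<eta>" by (simp add: fun_eq_iff)
  qed
  have conj: "hochschild_d (act g x) (act g f) = C (hochschild_d x f)" for f
    by (simp add: hochschild_d_def act_def C_def fun_eq_iff gg lin_add[OF lg(1)] g_diff)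
  have "act g ` V21 scale = V21 scale"
  proof
    show "act g ` V21 scale \<subseteq> V21 scale" using act_V21[OF g] by blast
    show "V21 scale \<subseteq> act g ` V21 scale"
    proof
      fix f assume f: "f \<in> V21 scale"
      have "f = act g (\<lambda>a b. ?g' (f (g a) (g b)))" by (simp add: act_def gg)
      moreover have "(\<lambda>a b. ?g' (f (g a) (g b))) \<in> V21 scale"
        unfolding V21_def
        by (auto intro!: linI simp: lin_add[OF lg(1)] lin_add[OF lg(2)] lin_scale[OF lg(1)]
            lin_scale[OF lg(2)] V21_simps[OF f])
      ultimately show "f \<in> act g ` V21 scale" by blast
    qed
  qed
  then have "hochschild_d (act g x) ` V21 scale = hochschild_d (act g x) ` (act g ` V21 scale)"
      by simp
  also have "\<dots> = C ` (hochschild_d x ` V21 scale)" by (simp add: image_image conj)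
  finally have img: "hochschild_d (act g x) ` V21 scale = C ` (hochschild_d x ` V21 scale)" .
  interpret pair: vector_space_pair scale3 scale3 by unfold_locales
  obtain B where B: "B \<subseteq> hochschild_d x ` V21 scale" "V3.independent B"
    "hochschild_d x ` V21 scale \<subseteq> V3.span B" "card B = V3.dim (hochschild_d x ` V21 scale)"
    by (rule V3.basis_exists)
  have "V3.dim (C ` (hochschild_d x ` V21 scale)) = card B"
  proof (rule V3.dim_unique)
    show "C ` B \<subseteq> C ` (hochschild_d x ` V21 scale)" using B(1) by blast
    show "V3.independent (C ` B)" by (rule pair.linear_independent_injective_image[OF linC B(2)
        inj_on_subset[OF injC subset_UNIV]])
    show "C ` (hochschild_d x ` V21 scale) \<subseteq> V3.span (C ` B)"
      unfolding pair.linear_span_image[OF linC] using B(3) by blast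
    show "card (C ` B) = card B" using injC by (simp add: card_image inj_on_def)
  qed
  then show ?thesis by (simp only: rk_d_V3 img B(4))
qed

lemma rank_stratification:
  "stratification scale n e (Alg scale) {r. rstratum r \<noteq> {}} (rstratum)"
proof -
  have "GL_stable scale (rstratum r)" for r
    by (auto simp: GL_stable_def rank_stratum_def act_Alg rk_d_act)
  then show ?thesis
    unfolding stratification_def
    by (auto simp: rank_stratum_locally_closed disjoint_family_on_def) (auto simp: rank_stratum_def)
qed

lemma orbits_refine:
  "refines (Alg scale) (orbit scale ` Alg scale) {rstratum r | r. rstratum r \<noteq> {}}"
proof -
  have "partition_on (Alg scale) {rstratum r | r. rstratum r \<noteq> {}}"
  proof (rule partition_onI)
    show "\<Union> {rstratum r | r. rstratum r \<noteq> {}} = Alg scale"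
      by (auto simp: rank_stratum_def)
  qed (auto simp: disjnt_def rank_stratum_def)
  moreover have "orbit scale x \<subseteq> rstratum (rk_d scale x)" "x \<in> rstratum (rk_d scale x)"
    if "x \<in> Alg scale" for x
    using that by (auto simp: orbit_def rank_stratum_def act_Alg rk_d_act)
  ultimately show ?thesis
    unfolding refines_def using orbits_partition by blast
qed

end

subsection \<open>Block sizes\<close>

context based_space
begin

text \<open>Up to the square of the discriminant, the element \<open>\<Sum>\<^sub>i\<^sub>j e\<^sub>i e\<^sub>j e\<^sup>i e\<^sup>j\<close>
  for dual bases \<open>e\<^sub>i\<close>, \<open>e\<^sup>i\<close> of the trace form. On a block \<open>M\<^sub>r(k)\<close> it acts as the scalar
  \<open>1 / r\<^sup>2\<close>, so it detects the block sizes.\<close>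

definition size_element :: "('v \<Rightarrow> 'v \<Rightarrow> 'v) \<Rightarrow> 'v" where
  "size_element x = (\<Sum>j<n. x (\<Sum>i<n. x (x (e i) (e j)) (edual x i)) (edual x j))"

text \<open>On a frame with scalar corners this multiplies a block of size r by
  \<open>(\<Delta> x)\<^sup>2 * (1 / r^2 - 1 / q^2)\<close>, so it annihilates the blocks of size
  \<open>q\<close>. In \<open>size_trace\<close> only the blocks with sizes outside the list
  survive.\<close>

definition size_shift :: "('v \<Rightarrow> 'v \<Rightarrow> 'v) \<Rightarrow> nat \<Rightarrow> 'v \<Rightarrow> 'v" where
  "size_shift x q w = x (size_element x) w - scale ((\<Delta> x)\<^sup>2 / of_nat (q\<^sup>2)) w"

definition size_trace :: "nat list \<Rightarrow> ('v \<Rightarrow> 'v \<Rightarrow> 'v) \<Rightarrow> 'k" where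
  "size_trace qs x = tr (\<lambda>w. foldr (size_shift x) qs w)"

text \<open>Entries of the adjugate are signed minors of the Gram matrix; the conditionals in the
  indices spell out the deletion of row \<open>j\<close> and column \<open>k\<close>.\<close>

lemma polyvec_edual:
  assumes "j < n"
  shows "polyvec (\<lambda>x. edual x j)"
  unfolding edual_def
proof (intro polyvec_sum polyvec_scale polyvec_const)
  fix k assume "k \<in> {..<n}"
  have "polyfun (\<lambda>x. (- 1) ^ (j + k) * det (mat (n - 1) (n - 1) (\<lambda>(i', j').
      tr (x (x (e (if i' < j then i' else Suc i')) (e (if j' < k then j' else Suc j')))))))"
    by (intro polyfun_mult polyfun_const polyfun_det polyfun_tr polyvec_mult polyvec_const)
  moreover have "mat_delete (mat n n (\<lambda>(i, j). tr (x (x (e i) (e j))))) j k =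
      mat (n - 1) (n - 1) (\<lambda>(i', j').
      tr (x (x (e (if i' < j then i' else Suc i')) (e (if j' < k then j' else Suc j')))))" for x
    using assms \<open>k \<in> {..<n}\<close> by (intro eq_matI) (auto simp: mat_delete_def)
  ultimately show "polyfun (\<lambda>x. adj_mat (mat n n (\<lambda>(i, j). tr (x (x (e i) (e j))))) $$ (k, j))"
    using assms \<open>k \<in> {..<n}\<close> by (simp add: adj_mat_def cofactor_def)
qed

lemma polyvec_size_element: "polyvec size_element"
  unfolding size_element_def[abs_def]
  by (intro polyvec_sum polyvec_mult polyvec_const polyvec_edual) auto

lemma polyfun_power: "polyfun f \<Longrightarrow> polyfun (\<lambda>x. f x ^ k)"
  by (induction k) (simp_all add: polyfun_const polyfun_mult)

lemma polyvec_size_shift: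
  assumes "polyvec w"
  shows "polyvec (\<lambda>x. size_shift x q (w x))"
proof -
  have "polyfun (\<lambda>x. (1 / of_nat (q\<^sup>2)) * (\<Delta> x)\<^sup>2)"
    by (intro polyfun_mult polyfun_const polyfun_power polyfun_disc)
  then have "polyfun (\<lambda>x. (\<Delta> x)\<^sup>2 / of_nat (q\<^sup>2))" by simp
  then show ?thesis
    unfolding size_shift_def by (intro polyvec_diff polyvec_mult polyvec_scale
        polyvec_size_element assms)
qed

lemma polyfun_size_trace: "polyfun (size_trace qs)"
proof -
  have "polyvec (\<lambda>x. foldr (size_shift x) qs v)" for v
  proof (induction qs)
    case Nil
    then show ?case by (simp add: polyvec_const)
  next
    case (Cons q qs)
    then show ?case using polyvec_size_shift[OF Cons] by simp
  qed
  then show ?thesis unfolding size_trace_def[abs_def] by (rule polyfun_tr)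
qed

end

context based_algebra
begin

lemma corner_scalar:
  assumes c: "division_idem c" and iso: "alg_iso scale (corner c) x (*) (UNIV :: 'k set) (*)"
    and v: "v \<in> corner c"
  shows "\<exists>t. v = scale t c"
proof -
  obtain \<theta> where \<theta>: "inj_on \<theta> (corner c)" "\<And>t v. v \<in> corner c \<Longrightarrow> \<theta> (scale t v) = t * \<theta> v"
    using iso unfolding alg_iso_def bij_betw_def by blast
  have cc: "c \<in> corner c" using c by (rule division_idemD)
  have "\<theta> c \<noteq> 0"
  proof
    assume "\<theta> c = 0"
    then have "\<theta> c = \<theta> (scale 0 c)" using \<theta>(2)[OF cc, of 0] by simp
    then have "c = scale 0 c" using \<theta>(1) cc corner_closed(2)[OF cc, of 0] by (meson inj_onD)
    then show False using division_idemD(3)[OF c] by simp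
  qed
  then have "\<theta> v = \<theta> (scale (\<theta> v / \<theta> c) c)" by (simp add: \<theta>(2) cc)
  then have "v = scale (\<theta> v / \<theta> c) c"
    using \<theta>(1) v corner_closed(2)[OF cc] by (meson inj_onD)
  then show ?thesis by blast
qed

end

section \<open>Dual bases in a frame with scalar corners\<close>

context disc_algebra
begin

context
  fixes u m r a b c
  assumes u: "is_unit u" and F0: "pframe u m r a b c"
    and scalar: "\<And>s v. s < m \<Longrightarrow> v \<in> corner (c s) \<Longrightarrow> \<exists>t. v = scale t (c s)"
begin

lemmas frame_facts = pframeD[OF F0]

text \<open>\<open>c s\<close> spans its corner, so sending \<open>v\<close> to
  \<open>c s \<cdot> v \<cdot> c s\<close> is a rank one projection and has trace 1;
  \<open>tr_corner\<close> supplies the factor \<open>r s\<close>.\<close>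

lemma trL_c:
  assumes s: "s < m"
  shows "trL (c s) = of_nat (r s)"
proof -
  have "\<forall>v. \<exists>t. c s \<cdot> v \<cdot> c s = scale t (c s)"
    using frame_facts(1)[OF s] by (intro allI scalar s) (simp add: corner_def assoc division_idemD)
  then obtain \<kappa> where \<kappa>: "\<And>v. c s \<cdot> v \<cdot> c s = scale (\<kappa> v) (c s)" by metis
  have nz: "c s \<noteq> 0" using frame_facts(1)[OF s] by (rule division_idemD)
  have "scale (\<kappa> (v + w)) (c s) = scale (\<kappa> v + \<kappa> w) (c s)" for v w
    unfolding \<kappa>[symmetric] scale_left_distrib by (simp add: mult_distrib)
  moreover have "scale (\<kappa> (scale t v)) (c s) = scale (t * \<kappa> v) (c s)" for t v
    unfolding \<kappa>[symmetric] scale_scale[symmetric] by (simp add: mult_distrib)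
  ultimately have "linf \<kappa>" using nz by (intro linfI) auto
  then have "tr (\<lambda>v. c s \<cdot> v \<cdot> c s) = \<kappa> (c s)"
    unfolding \<kappa> by (rule tr_rank_one)
  moreover have "scale (\<kappa> (c s)) (c s) = scale 1 (c s)"
    unfolding \<kappa>[symmetric] using frame_facts(1)[OF s] by (simp add: division_idemD)
  ultimately have "tr (\<lambda>v. c s \<cdot> v \<cdot> c s) = 1" using nz unfolding scale_cancel_right by simp
  then show ?thesis using tr_corner[OF F0 u s] by simp
qed

text \<open>The scalar is found by applying \<open>trL\<close>, whose value at \<open>c s\<close> is
  \<open>r s\<close>. In other words, the basis dual to the matrix units under the trace form
  consists of the transposed units divided by \<open>r s\<close>.\<close>

lemma frame_coord:
  assumes s: "s < m" "i < r s" "j < r s"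
  shows "a s i \<cdot> v \<cdot> b s j = scale (T v (b s j \<cdot> a s i) / of_nat (r s)) (c s)"
proof -
  have "a s i \<cdot> v \<cdot> b s j \<in> corner (c s)" using s frame_facts by (simp add: corner_def assoc)
  then obtain t where t: "a s i \<cdot> v \<cdot> b s j = scale t (c s)" using scalar[OF s(1)] by blast
  have "T v (b s j \<cdot> a s i) = T (a s i) (v \<cdot> b s j)"
    by (metis T_sym assoc)
  also have "\<dots> = t * of_nat (r s)"
    using t by (simp add: assoc[symmetric] trL_scale trL_c[OF s(1)])
  finally show ?thesis using t frame_facts(2)[OF s(1)] by simp
qed

lemma frame_expand_T:
  "v = (\<Sum>s<m. \<Sum>i<r s. \<Sum>j<r s. scale (T v (b s j \<cdot> a s i) / of_nat (r s)) (b s i \<cdot> a s j))"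
proof -
  have "v = (\<Sum>s<m. \<Sum>i<r s. \<Sum>j<r s. b s i \<cdot> (a s i \<cdot> v \<cdot> b s j) \<cdot> a s j)"
    by (rule frame_expand[OF u F0])
  also have "\<dots> = (\<Sum>s<m. \<Sum>i<r s. \<Sum>j<r s. scale (T v (b s j \<cdot> a s i) / of_nat (r s)) (b s i \<cdot> a s j))"
    by (intro sum.cong refl) (auto simp: frame_coord mult_distrib frame_facts)
  finally show ?thesis .
qed

text \<open>The tensor built from a basis and its dual basis does not depend on the basis: on the
  left it is written with \<open>e\<close>, on the right with the matrix units.\<close>

lemma casimir_frame:
  assumes \<beta>: "\<And>w. lin (\<lambda>v. \<beta> v w)" "\<And>v. lin (\<lambda>w. \<beta> v w)"
  shows "(\<Sum>k<n. \<beta> (e k) (dual k)) =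
    (\<Sum>s<m. \<Sum>i<r s. \<Sum>j<r s. scale (1 / of_nat (r s)) (\<beta> (b s i \<cdot> a s j) (b s j \<cdot> a s i)))"
proof -
  have "(\<Sum>k<n. \<beta> (e k) (dual k)) = (\<Sum>k<n. \<Sum>s<m. \<Sum>i<r s. \<Sum>j<r s.
      scale (T (e k) (b s j \<cdot> a s i) / of_nat (r s)) (\<beta> (b s i \<cdot> a s j) (dual k)))"
    by (rule sum.cong[OF refl], subst (1) frame_expand_T)
       (simp only: lin_sum[OF \<beta>(1)] lin_scale[OF \<beta>(1)])
  also have "\<dots> = (\<Sum>s<m. \<Sum>i<r s. \<Sum>j<r s. \<Sum>k<n.
      scale (T (e k) (b s j \<cdot> a s i) / of_nat (r s)) (\<beta> (b s i \<cdot> a s j) (dual k)))"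
    by (simp only: sum.swap[of _ _ "{..<n}"])
  also have "\<dots> = (\<Sum>s<m. \<Sum>i<r s. \<Sum>j<r s. scale (1 / of_nat (r s)) (\<beta> (b s i \<cdot> a s j) (b s j \<cdot> a s
      i)))"
  proof (intro sum.cong refl)
    fix s i j
    show "(\<Sum>k<n. scale (T (e k) (b s j \<cdot> a s i) / of_nat (r s)) (\<beta> (b s i \<cdot> a s j) (dual k))) =
        scale (1 / of_nat (r s)) (\<beta> (b s i \<cdot> a s j) (b s j \<cdot> a s i))"
      by (subst (2) expand_dual[of "b s j \<cdot> a s i"])
         (simp add: lin_sum[OF \<beta>(2)] lin_scale[OF \<beta>(2)] scale_sum_right T_sym[of "e _"])
  qed
  finally show ?thesis .
qed

text \<open>The averaging operator onto the centre: its values are central by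
  \<open>separability_identity\<close>.\<close>

definition cas :: "'v \<Rightarrow> 'v" where "cas v = (\<Sum>i<n. e i \<cdot> v \<cdot> dual i)"

lemma lin_cas: "lin cas"
  unfolding cas_def by (rule linI) (simp_all add: mult_distrib sum.distrib scale_sum_right)

text \<open>The product E_ij E_kl E_ji is E_ii if j = k = l and 0 otherwise;
  \<open>casimir_frame\<close> contributes the factor 1 / r.\<close>

lemma cas_matrix_unit:
  assumes t: "t < m" "k < r t" "l < r t"
  shows "cas (b t k \<cdot> a t l) = (if k = l then scale (1 / of_nat (r t)) (\<Sum>i<r t. b t i \<cdot> a t i)
      else 0)"
proof -
  have "cas (b t k \<cdot> a t l) = (\<Sum>s<m. \<Sum>i<r s. \<Sum>j<r s.
      scale (1 / of_nat (r s)) (b s i \<cdot> a s j \<cdot> (b t k \<cdot> a t l) \<cdot> (b s j \<cdot> a s i)))"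
    unfolding cas_def
    by (rule casimir_frame[of "\<lambda>v w. v \<cdot> (b t k \<cdot> a t l) \<cdot> w"]) (rule linI; simp add: mult_distrib)+
  also have "\<dots> = (\<Sum>s<m. \<Sum>i<r s. \<Sum>j<r s. if j = k then
      (if s = t then (if k = l then scale (1 / of_nat (r t)) (b t i \<cdot> a t i) else 0) else 0) else
          0)"
    using t frame_facts by (intro sum.cong refl) (auto simp: assoc)
  also have "\<dots> = (\<Sum>s<m. \<Sum>i<r s. if s = t then (if k = l then scale (1 / of_nat (r t)) (b t i \<cdot> a t
      i) else 0) else 0)"
    using t by (intro sum.cong refl) auto
  also have "\<dots> = (\<Sum>s<m. if s = t then (\<Sum>i<r t. if k = l then scale (1 / of_nat (r t)) (b t i \<cdot> a t
      i) else 0) else 0)"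
    by (intro sum.cong refl) auto
  also have "\<dots> = (if k = l then scale (1 / of_nat (r t)) (\<Sum>i<r t. b t i \<cdot> a t i) else 0)"
    using t by (auto simp: scale_sum_right)
  finally show ?thesis .
qed

lemma size_element_eq:
  "size_element x = scale ((\<Delta> x)\<^sup>2) (\<Sum>j<n. cas (e j) \<cdot> dual j)"
proof -
  have "edual x j = scale (\<Delta> x) (dual j)" for j
    using disc by (simp add: dual_def)
  then show ?thesis
    by (simp add: size_element_def cas_def mult_scale_r mult_scale_l scale_sum_right mult_sum_l
        power2_eq_square)
qed

text \<open>\<open>casimir_frame\<close> is applied a second time, now with \<open>cas\<close> known
  on matrix units. In the sum of cas(E_kl) E_lk / r only k = l survives, which leaves the identity
  of the block divided by r^2.\<close>

lemma size_element_block: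
  assumes s: "s < m" "i < r s" "j < r s"
  shows "size_element x \<cdot> (b s i \<cdot> a s j) =
    scale ((\<Delta> x)\<^sup>2 / of_nat ((r s)\<^sup>2)) (b s i \<cdot> a s j)"
proof -
  let ?w = "b s i \<cdot> a s j"
  have "(\<Sum>j<n. cas (e j) \<cdot> dual j) \<cdot> ?w = (\<Sum>k<n. cas (e k) \<cdot> dual k \<cdot> ?w)"
    by (simp add: mult_sum_l)
  also have "\<dots> = (\<Sum>t<m. \<Sum>k<r t. \<Sum>l<r t.
      scale (1 / of_nat (r t)) (cas (b t k \<cdot> a t l) \<cdot> (b t l \<cdot> a t k) \<cdot> ?w))"
    by (rule casimir_frame[of "\<lambda>v y. cas v \<cdot> y \<cdot> ?w"])
       (rule linI; simp add: mult_distrib lin_add[OF lin_cas] lin_scale[OF lin_cas])+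
  also have "\<dots> = (\<Sum>t<m. \<Sum>k<r t. \<Sum>l<r t. if l = k then (if t = s \<and> k = i then
      scale (1 / of_nat ((r s)\<^sup>2)) ?w else 0) else 0)"
  proof (intro sum.cong refl)
    fix t k l assume t: "t \<in> {..<m}" "k \<in> {..<r t}" "l \<in> {..<r t}"
    have "(\<Sum>h<r t. b t h \<cdot> a t h) \<cdot> (b t k \<cdot> v) = b t k \<cdot> v" for v
    proof -
      have "(\<Sum>h<r t. b t h \<cdot> a t h) \<cdot> (b t k \<cdot> v) = (\<Sum>h<r t. if h = k then b t k \<cdot> v else 0)"
        unfolding mult_sum_l using t frame_facts by (intro sum.cong refl) (auto simp: assoc)
      then show ?thesis using t by simp
    qed
    then show "scale (1 / of_nat (r t)) (cas (b t k \<cdot> a t l) \<cdot> (b t l \<cdot> a t k) \<cdot> ?w) =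
        (if l = k then (if t = s \<and> k = i then scale (1 / of_nat ((r s)\<^sup>2)) ?w else 0) else 0)"
      using t s frame_facts by (auto simp: cas_matrix_unit assoc mult_scale_l power2_eq_square)
  qed
  also have "\<dots> = (\<Sum>t<m. \<Sum>k<r t. if k = i then (if t = s then scale (1 / of_nat ((r s)\<^sup>2)) ?w else
      0) else 0)"
    by (intro sum.cong refl) auto
  also have "\<dots> = (\<Sum>t<m. if t = s then scale (1 / of_nat ((r s)\<^sup>2)) ?w else 0)"
    using s by (intro sum.cong refl) auto
  also have "\<dots> = scale (1 / of_nat ((r s)\<^sup>2)) ?w"
    using s by simp
  finally show ?thesis
    by (simp add: size_element_eq mult_scale_l)
qed

text \<open>The matrix units are a basis of common eigenvectors of all shifts, and a block of size r
  has r^2 of them.\<close>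

lemma size_trace_frame:
  "size_trace qs x = (\<Sum>s<m. of_nat ((r s)\<^sup>2) *
    (\<Prod>q\<leftarrow>qs. (\<Delta> x)\<^sup>2 * (1 / of_nat ((r s)\<^sup>2) - 1 / of_nat (q\<^sup>2))))"
proof -
  let ?D = "(\<Delta> x)\<^sup>2"
  let ?P = "\<lambda>qs s. (\<Prod>q\<leftarrow>qs. ?D * (1 / of_nat ((r s)\<^sup>2) - 1 / of_nat (q\<^sup>2)))"
  let ?I = "SIGMA s:{..<m}. {..<r s} \<times> {..<r s}"
  have shift: "lin (size_shift x q)" for q
    by (rule linI) (simp_all add: size_shift_def mult_distrib scale_right_distrib
        scale_right_diff_distrib mult.commute)
  have step: "lin (foldr (size_shift x) qs)" for qs
  proof (induction qs)
    case Nil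
    then show ?case by (simp add: linI)
  next
    case (Cons q qs)
    then show ?case
      by (intro linI) (simp_all add: lin_add[OF Cons] lin_scale[OF Cons] lin_add[OF shift]
          lin_scale[OF shift])
  qed
  have eig: "foldr (size_shift x) qs (b s i \<cdot> a s j) = scale (?P qs s) (b s i \<cdot> a s j)"
    if s: "s < m" "i < r s" "j < r s" for s i j qs
  proof (induction qs)
    case (Cons q qs)
    have "foldr (size_shift x) (q # qs) (b s i \<cdot> a s j) =
        scale (?P qs s) (scale (?D / of_nat ((r s)\<^sup>2)) (b s i \<cdot> a s j) - scale (?D / of_nat (q\<^sup>2))
            (b s i \<cdot> a s j))"
      using size_element_block[OF s]
      by (simp only: foldr.simps comp_apply Cons size_shift_def mult_scale_r
          scale_right_diff_distrib)
         (simp add: mult.commute)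
    also have "\<dots> = scale (?P (q # qs) s) (b s i \<cdot> a s j)"
      by (simp add: scale_left_diff_distrib[symmetric] right_diff_distrib mult_ac)
    finally show ?case .
  qed simp
  define \<Phi> where "\<Phi> = (\<lambda>(s, i, j) v. T v (b s j \<cdot> a s i) / of_nat (r s))"
  define B where "B = (\<lambda>(s, i, j). b s i \<cdot> a s j)"
  have "size_trace qs x = (\<Sum>p\<in>?I. \<Phi> p (foldr (size_shift x) qs (B p)))"
    unfolding size_trace_def
  proof (rule tr_decomp)
    fix p assume "p \<in> ?I"
    show "linf (\<Phi> p)"
      by (cases p) (auto intro!: linfI simp: \<Phi>_def mult_distrib trL_add trL_scale
          add_divide_distrib)
  next
    fix w
    show "w = (\<Sum>p\<in>?I. scale (\<Phi> p w) (B p))"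
      by (subst (1) frame_expand_T)
         (simp add: sum.Sigma sum.cartesian_product case_prod_unfold \<Phi>_def B_def)
  qed (rule step)
  also have "\<dots> = (\<Sum>(s, i, j)\<in>?I. ?P qs s)"
  proof (rule sum.cong[OF refl])
    fix p assume "p \<in> ?I"
    then obtain s i j where p: "p = (s, i, j)" and s: "s < m" "i < r s" "j < r s" by (cases p) auto
    have "T (b s i \<cdot> a s j) (b s j \<cdot> a s i) = T (b s i) (a s i)"
      using s frame_facts by (simp add: assoc)
    also have "\<dots> = T (a s i) (b s i)" by (rule T_sym)
    also have "\<dots> = of_nat (r s)" using s frame_facts by (simp add: trL_c)
    finally have "T (foldr (size_shift x) qs (b s i \<cdot> a s j)) (b s j \<cdot> a s i) / of_nat (r s) =
        ?P qs s"
      using frame_facts(2)[OF s(1)] unfolding eig[OF s] mult_scale_l trL_scale by simp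
    then show "\<Phi> p (foldr (size_shift x) qs (B p)) = (case p of (s, i, j) \<Rightarrow> ?P qs s)"
      unfolding p \<Phi>_def B_def prod.case .
  qed
  also have "\<dots> = (\<Sum>s<m. \<Sum>x\<in>{..<r s} \<times> {..<r s}. ?P qs s)"
    by (subst sum.Sigma) (auto simp: case_prod_unfold)
  also have "\<dots> = (\<Sum>s<m. of_nat ((r s)\<^sup>2) * ?P qs s)"
    by (simp add: card_cartesian_product power2_eq_square)
  finally show ?thesis .
qed

end

end

section \<open>Profiles, their strata and the separable locus\<close>

context based_space
begin

lemma profiles_le:
  assumes "\<rho> \<in> profiles n" "r \<in># \<rho>"
  shows "1 \<le> r" "r \<le> n"
proof -
  have "r \<noteq> 0" using assms by (cases "r = 0") (simp_all add: profiles_def)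
  then show "1 \<le> r" by simp
  obtain \<rho>' where "\<rho> = add_mset r \<rho>'" using assms(2) by (metis mset_add)
  then have "r\<^sup>2 \<le> n" using assms(1) by (auto simp: profiles_def)
  then show "r \<le> n" using \<open>1 \<le> r\<close> self_le_power[of r 2] by simp
qed

text \<open>Every block size contributes at least 1 to the sum of squares, so a profile has at most
  \<open>n\<close> members, each at most \<open>n\<close>.\<close>

lemma finite_profiles: "finite (profiles n)"
proof -
  have "profiles n \<subseteq> mset ` {rs. set rs \<subseteq> {..n} \<and> length rs \<le> n}"
  proof
    fix \<rho> assume \<rho>: "\<rho> \<in> profiles n"
    obtain rs where rs: "mset rs = \<rho>" using ex_mset by blast
    have "length rs = (\<Sum>r\<in>#\<rho>. 1)" using rs by (metis size_eq_sum_mset size_mset)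
    also have "\<dots> \<le> (\<Sum>r\<in>#\<rho>. r\<^sup>2)"
      by (rule sum_mset_mono) (use profiles_le(1)[OF \<rho>] in simp)
    also have "\<dots> = n" using \<rho> by (simp add: profiles_def)
    finally have "length rs \<le> n" .
    moreover have "set rs \<subseteq> {..n}" using profiles_le(2)[OF \<rho>] rs by auto
    ultimately show "\<rho> \<in> mset ` {rs. set rs \<subseteq> {..n} \<and> length rs \<le> n}" using rs by blast
  qed
  then show ?thesis by (rule finite_subset) (simp add: finite_lists_length_le)
qed

definition other_sizes :: "nat \<Rightarrow> nat list" where
  "other_sizes p = filter (\<lambda>q. q \<noteq> p) [1..<Suc n]"

text \<open>The contribution of one block of size \<open>p\<close> to
  \<open>size_trace (other_sizes p)\<close>, with \<open>d\<close> in the place of the discriminant.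
  For positive \<open>p\<close> and nonzero \<open>d\<close> it does not vanish, since distinct
  sizes have distinct squares in characteristic 0.\<close>

definition size_weight :: "nat \<Rightarrow> 'k \<Rightarrow> 'k" where
  "size_weight p d = of_nat (p\<^sup>2) * (\<Prod>q\<leftarrow>other_sizes p. d\<^sup>2 * (1 / of_nat (p\<^sup>2) - 1 / of_nat (q\<^sup>2)))"

lemma size_weight_nonzero:
  assumes "1 \<le> p" "d \<noteq> 0"
  shows "size_weight p d \<noteq> 0"
proof -
  have "(of_nat (p\<^sup>2) :: 'k) \<noteq> of_nat (q\<^sup>2)" if "q \<noteq> p" for q
    using that by (simp only: of_nat_eq_iff) simp
  then show ?thesis
    using assms by (auto simp: size_weight_def prod_list_zero_iff other_sizes_def field_simps)
qed

text \<open>A block of size other than \<open>p\<close> meets its own size in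
  \<open>other_sizes p\<close>, which contains all remaining sizes up to \<open>n\<close>, and so
  contributes 0. The blocks of size \<open>p\<close> contribute the weight once each.\<close>

lemma profile_size_trace:
  assumes x: "x \<in> Alg scale" and \<rho>: "\<rho> \<in> profiles n" "x \<in> pstratum \<rho>" and p: "1 \<le> p"
  shows "size_trace (other_sizes p) x = of_nat (count \<rho> p) * size_weight p (\<Delta> x)"
proof -
  interpret based_algebra scale n e x by unfold_locales (rule x)
  have nz: "0 \<notin># \<rho>" using \<rho>(1) by (simp add: profiles_def)
  obtain rs a b c where rs: "mset rs = \<rho>" and fr: "frame (length rs) (\<lambda>s. rs ! s) a b c"
    and iso: "\<forall>s<length rs. alg_iso scale (corner (c s)) x (*) (UNIV :: 'k set) (*)"
    using iffD1[OF profile_stratum_iff[OF nz] \<rho>(2)] by (elim exE conjE) (rule that)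
  interpret disc_algebra scale n e x by unfold_locales (rule frame_disc[OF fr])
  obtain u where u: "is_unit u" "pframe u (length rs) (\<lambda>s. rs ! s) a b c" using fr by
      (auto simp: frame_def)
  let ?d = "\<Delta> x"
  have "size_trace (other_sizes p) x = (\<Sum>s<length rs. of_nat ((rs ! s)\<^sup>2) *
      (\<Prod>q\<leftarrow>other_sizes p. ?d\<^sup>2 * (1 / of_nat ((rs ! s)\<^sup>2) - 1 / of_nat (q\<^sup>2))))"
    by (rule size_trace_frame[OF u corner_scalar[OF pframeD(1)[OF u(2)]]]) (use iso in auto)
  also have "\<dots> = (\<Sum>s<length rs. if rs ! s = p then size_weight p ?d else 0)"
  proof (rule sum.cong[OF refl])
    fix s assume "s \<in> {..<length rs}"
    then have "rs ! s \<in># \<rho>" using rs by (metis lessThan_iff nth_mem set_mset_mset)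
    then have "1 \<le> rs ! s" "rs ! s \<le> n" using profiles_le[OF \<rho>(1)] by blast+
    then have "rs ! s \<noteq> p \<Longrightarrow> rs ! s \<in> set (other_sizes p)"
      by (auto simp: other_sizes_def)
    then show "of_nat ((rs ! s)\<^sup>2) * (\<Prod>q\<leftarrow>other_sizes p. ?d\<^sup>2 * (1 / of_nat ((rs ! s)\<^sup>2) - 1 /
        of_nat (q\<^sup>2))) =
        (if rs ! s = p then size_weight p ?d else 0)"
      by (auto simp: size_weight_def prod_list_zero_iff image_iff intro!: bexI[of _ "rs ! s"])
  qed
  also have "\<dots> = of_nat (card {s. s < length rs \<and> rs ! s = p}) * size_weight p ?d"
    by (simp add: sum.If_cases Int_def)
  also have "card {s. s < length rs \<and> rs ! s = p} = count \<rho> p"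
    using rs by (auto simp: count_mset count_list_eq_length_filter length_filter_conv_card
        eq_commute)
  finally show ?thesis .
qed

lemma closed_profile_exists:
  assumes ac: "is_alg_closed TYPE('k)" and x: "x \<in> locus"
  shows "\<exists>\<rho>\<in>profiles n. x \<in> pstratum \<rho>"
proof -
  interpret based_algebra scale n e x by unfold_locales (use x in \<open>simp add: separable_locus_def\<close>)
  obtain W where W: "W \<in> wtypes n" "x \<in> wstratum W"
    using wedderburn_exists x by (auto simp: separable_locus_def)
  have div: "division_alg (fst (snd (W ! s))) (snd (snd (W ! s)))" if "s < length W" for s
    using W(1) that by unfold_locales (simp add: wtypes_iff)
  have d1: "fst (snd (W ! s)) = 1" if "s < length W" for s
    using division_alg.alg_closed_trivial(1)[OF div[OF that] ac] .
  have "x \<in> pstratum (mset (map fst W))"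
    by (rule profile_if_wedderburn[OF W]) (rule division_alg.alg_closed_trivial(2)[OF div ac])
  moreover have "mset (map fst W) \<in> profiles n"
  proof -
    have "(\<Sum>r\<in>#mset (map fst W). r\<^sup>2) = (\<Sum>s<length W. (fst (W ! s))\<^sup>2)"
      by (simp only: mset_map[symmetric] sum_mset_sum_list map_map)
          (simp add: sum_list_sum_nth lessThan_atLeast0)
    also have "\<dots> = n" using W(1) d1 by (simp add: wtypes_iff)
    finally show ?thesis using W(1) by (force simp: profiles_def wtypes_def)
  qed
  ultimately show ?thesis by blast
qed

lemma profile_subset:
  assumes "\<rho> \<in> profiles n"
  shows "pstratum \<rho> \<subseteq> locus"
proof
  fix x assume x: "x \<in> pstratum \<rho>"
  then have "x \<in> Alg scale" by (auto simp: profile_stratum_def)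
  then interpret based_algebra scale n e x by unfold_locales
  have nz: "0 \<notin># \<rho>" using assms by (simp add: profiles_def)
  have "\<Delta> x \<noteq> 0"
    using iffD1[OF profile_stratum_iff[OF nz] x] frame_disc by (elim exE conjE)
  then show "x \<in> locus" using alg by (simp add: separable_locus_def)
qed

text \<open>The equations \<open>f p x = 0\<close> for p from 1 to n prescribe how often each size
  occurs. They determine the profile on the separable locus, where the weights do not vanish and,
  over an algebraically closed field, every point has some profile.\<close>

lemma profile_locally_closed:
  assumes ac: "is_alg_closed TYPE('k)" and \<rho>: "\<rho> \<in> profiles n"
  shows "locally_closed_in (zariskiA) (pstratum \<rho>)"
proof -
  define f where "f p x = size_trace (other_sizes p) x - of_nat (count \<rho> p) * size_weight p (\<Delta> x)"
      for p x
  have "polyfun (f p)" for p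
  proof -
    have "polyfun (\<lambda>x. \<Prod>q\<leftarrow>qs. (\<Delta> x)\<^sup>2 * (1 / of_nat (p\<^sup>2) - 1 / of_nat (q\<^sup>2)))" for qs :: "nat list"
    proof (induction qs)
      case Nil
      then show ?case by (simp add: polyfun_const)
    next
      case (Cons q qs)
      have "polyfun (\<lambda>x. (\<Delta> x)\<^sup>2 * (1 / of_nat (p\<^sup>2) - 1 / of_nat (q\<^sup>2)))"
        by (intro polyfun_mult polyfun_power polyfun_disc polyfun_const)
      then show ?case using polyfun_mult Cons by simp
    qed
    then show ?thesis
      unfolding f_def size_weight_def
      by (intro polyfun_diff polyfun_size_trace polyfun_mult polyfun_const)
  qed
  then have "closedin (zariskiA) {x \<in> Alg scale. \<forall>g\<in>f ` {1..n}. g x = 0}"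
    by (intro closedin_zeros) auto
  moreover have "pstratum \<rho> = locus \<inter> {x \<in> Alg scale. \<forall>g\<in>f ` {1..n}. g x = 0}"
  proof (intro equalityI subsetI)
    fix x assume x: "x \<in> pstratum \<rho>"
    then have xA: "x \<in> Alg scale" by (auto simp: profile_stratum_def)
    have "f p x = 0" if "1 \<le> p" for p
      using profile_size_trace[OF xA \<rho> x that] by (simp add: f_def)
    then show "x \<in> locus \<inter> {x \<in> Alg scale. \<forall>g\<in>f ` {1..n}. g x = 0}"
      using profile_subset[OF \<rho>] x xA by auto
  next
    fix x assume x: "x \<in> locus \<inter> {x \<in> Alg scale. \<forall>g\<in>f ` {1..n}. g x = 0}"
    then obtain \<rho>' where \<rho>': "\<rho>' \<in> profiles n" "x \<in> pstratum \<rho>'"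
      using closed_profile_exists[OF ac] by blast
    have "count \<rho> p = count \<rho>' p" for p
    proof (cases "1 \<le> p \<and> p \<le> n")
      case True
      then have "f p x = 0" using x by auto
      then have "of_nat (count \<rho>' p) * size_weight p (\<Delta> x) =
          of_nat (count \<rho> p) * size_weight p (\<Delta> x)"
        using profile_size_trace[OF _ \<rho>', of p] True x by (auto simp: f_def)
      moreover have "size_weight p (\<Delta> x) \<noteq> 0"
        using size_weight_nonzero[of p "\<Delta> x"] True x by (auto simp: separable_locus_def)
      ultimately show ?thesis by (metis mult_right_cancel of_nat_eq_iff)
    next
      \<comment> \<open>Members of a profile lie between 1 and \<open>n\<close>, so both counts are
        0.\<close>
      case False
      then show ?thesis using profiles_le[OF \<rho>] profiles_le[OF \<rho>'(1)] by (metis count_inI)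
    qed
    then have "\<rho> = \<rho>'" by (rule multiset_eqI)
    then show "x \<in> pstratum \<rho>" using \<rho>'(2) by simp
  qed
  ultimately show ?thesis
    using openin_separable_locus unfolding locally_closed_in_def by blast
qed

text \<open>A copy of the field on \<open>kspace 1\<close>, whose vectors are supported at the index
  0. It presents a profile as a Wedderburn type, so that \<open>wedderburn_nonempty\<close> also
  yields points of the profile strata.\<close>

definition kmult :: "(nat \<Rightarrow> 'k) \<Rightarrow> (nat \<Rightarrow> 'k) \<Rightarrow> nat \<Rightarrow> 'k" where
  "kmult a b = (\<lambda>i. a i * b i)"

lemma division_kmult: "division_algebra 1 kmult"
  unfolding division_algebra_def
proof (intro conjI ballI allI)
  show "\<exists>u\<in>kspace 1. u \<noteq> 0 \<and> (\<forall>a\<in>kspace 1. kmult u a = a \<and> kmult a u = a) \<and>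
      (\<forall>a\<in>kspace 1. a \<noteq> 0 \<longrightarrow> (\<exists>b\<in>kspace 1. kmult a b = u \<and> kmult b a = u))"
  proof (rule bexI[of _ "kunit 0"], intro conjI ballI impI)
    show "kunit 0 \<noteq> (0 :: nat \<Rightarrow> 'k)" by (auto simp: kunit_def fun_eq_iff)
    show "kmult (kunit 0) a = a" "kmult a (kunit 0) = a" if "a \<in> kspace 1" for a
      using that by (auto simp: kmult_def kunit_def kspace_def fun_eq_iff)
    fix a :: "nat \<Rightarrow> 'k" assume a: "a \<in> kspace 1" "a \<noteq> 0"
    have "a 0 \<noteq> 0"
    proof
      assume "a 0 = 0"
      then have "a i = 0" for i using a(1) by (cases i) (auto simp: kspace_def)
      then show False using a(2) by (auto simp: fun_eq_iff)
    qed
    then show "\<exists>b\<in>kspace 1. kmult a b = kunit 0 \<and> kmult b a = kunit 0"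
      using a(1) by (intro bexI[of _ "kscale (1 / a 0) (kunit 0)"])
        (auto simp: kmult_def kunit_def kscale_def kspace_def fun_eq_iff)
  qed (simp add: kunit_kspace)
qed (auto simp: kmult_def kspace_def kscale_def fun_eq_iff algebra_simps)

lemma kmult_iso: "alg_iso (*) (UNIV :: 'k set) (*) kscale (kspace 1) kmult"
  unfolding alg_iso_def
proof (intro exI[of _ "\<lambda>t. kscale t (kunit 0)"] conjI ballI allI)
  show "bij_betw (\<lambda>t :: 'k. kscale t (kunit 0)) UNIV (kspace 1)"
    by (rule bij_betw_byWitness[where f' = "\<lambda>v. v 0"])
       (auto simp: kscale_def kunit_def kspace_def fun_eq_iff)
qed (auto simp: kmult_def kscale_def kunit_def fun_eq_iff algebra_simps)

lemma profile_nonempty: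
  assumes \<rho>: "\<rho> \<in> profiles n"
  shows "pstratum \<rho> \<noteq> {}"
proof -
  obtain rs where rs: "mset rs = \<rho>" using ex_mset by blast
  let ?W = "map (\<lambda>r. (r, 1 :: nat, kmult)) rs"
  have "(\<Sum>s<length rs. (rs ! s)\<^sup>2) = (\<Sum>r\<in>#\<rho>. r\<^sup>2)"
    unfolding rs[symmetric] mset_map[symmetric] sum_mset_sum_list
    by (simp add: sum_list_sum_nth lessThan_atLeast0)
  moreover have "0 < rs ! s" if "s < length rs" for s
    using profiles_le(1)[OF \<rho>, of "rs ! s"] that rs by auto
  ultimately have W: "?W \<in> wtypes n"
    using \<rho> division_kmult by (simp add: wtypes_iff profiles_def)
  then obtain x where x: "x \<in> wstratum ?W" using wedderburn_nonempty by blast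
  then have "x \<in> Alg scale" by (simp add: wedderburn_stratum_def)
  then interpret based_algebra scale n e x by unfold_locales
  have "x \<in> pstratum (mset (map fst ?W))"
    by (rule profile_if_wedderburn[OF W x]) (use kmult_iso in simp)
  then have "x \<in> pstratum \<rho>" using rs by (simp add: comp_def)
  then show ?thesis by blast
qed

lemma profile_stratification:
  assumes ac: "is_alg_closed TYPE('k)"
  shows "stratification scale n e (locus) (profiles n) (pstratum)"
  unfolding stratification_def
proof (intro conjI ballI)
  show "(\<Union>\<rho>\<in>profiles n. pstratum \<rho>) = locus"
    using profile_subset closed_profile_exists[OF ac] by blast
  show "disjoint_family_on (pstratum) (profiles n)"
    unfolding disjoint_family_on_def
  proof (intro ballI impI, rule ccontr)
    fix \<rho> \<rho>' assume \<rho>: "\<rho> \<in> profiles n" "\<rho>' \<in> profiles n" "\<rho> \<noteq> \<rho>'"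
      and "pstratum \<rho> \<inter> pstratum \<rho>' \<noteq> {}"
    then obtain x where x: "x \<in> pstratum \<rho>" "x \<in> pstratum \<rho>'" by blast
    then have "x \<in> Alg scale" by (auto simp: profile_stratum_def)
    then interpret based_algebra scale n e x by unfold_locales
    show False using profile_unique[OF _ x(1) _ x(2)] \<rho> by (simp add: profiles_def)
  qed
qed (simp_all add: profile_nonempty profile_locally_closed ac profile_GL_stable)

lemma wedderburn_partition: "partition_on (locus) (wstratum ` wtypes n)"
proof (rule partition_onI)
  show "\<Union> (wstratum ` wtypes n) = locus"
  proof (intro equalityI subsetI)
    fix x assume "x \<in> \<Union> (wstratum ` wtypes n)"
    then obtain W where W: "W \<in> wtypes n" "x \<in> wstratum W" by blast
    then have "x \<in> Alg scale" by (simp add: wedderburn_stratum_def)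
    then interpret based_algebra scale n e x by unfold_locales
    show "x \<in> locus" using wedderburn_disc[OF W] alg by (simp add: separable_locus_def)
  next
    fix x assume x: "x \<in> locus"
    then interpret based_algebra scale n e x by unfold_locales (simp add: separable_locus_def)
    show "x \<in> \<Union> (wstratum ` wtypes n)"
      using wedderburn_exists x by (auto simp: separable_locus_def)
  qed
  show "disjnt p q" if pq: "p \<in> wstratum ` wtypes n" "q \<in> wstratum ` wtypes n" "p \<noteq> q" for p q
  proof -
    obtain W W' where "p = wstratum W" "q = wstratum W'" using pq by blast
    then show ?thesis using wedderburn_strata_eq[of _ W W'] pq(3) unfolding disjnt_iff by blast
  qed
  show "{} \<notin> wstratum ` wtypes n"
    using wedderburn_nonempty by fastforce
qed

text \<open>Types are compared at a common point of their strata, and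
  \<open>wedderburn_nonempty\<close> provides one.\<close>

lemma wedderburn_eq_iff:
  assumes W: "W \<in> wtypes n" and W': "W' \<in> wtypes n"
  shows "wstratum W = wstratum W' \<longleftrightarrow> same_wtype W W'"
proof
  assume eq: "wstratum W = wstratum W'"
  obtain x where x: "x \<in> wstratum W" using wedderburn_nonempty[OF W] by blast
  then have "x \<in> Alg scale" by (simp add: wedderburn_stratum_def)
  then interpret based_algebra scale n e x by unfold_locales
  show "same_wtype W W'" using wedderburn_same[OF W x W'] x eq by simp
next
  assume same: "same_wtype W W'"
  obtain x where x: "x \<in> wstratum W'" using wedderburn_nonempty[OF W'] by blast
  then have "x \<in> Alg scale" by (simp add: wedderburn_stratum_def)
  then interpret based_algebra scale n e x by unfold_locales
  have "x \<in> wstratum W" by (rule same_wtype_stratum[OF W' W same x])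
  then show "wstratum W = wstratum W'"
    using x by (rule wedderburn_strata_eq)
qed

text \<open>The profile of \<open>n\<close> blocks of size 1 is that of the algebra k^n.\<close>

lemma separable_locus_nonempty: "locus \<noteq> {}"
proof -
  have "replicate_mset n 1 \<in> profiles n" by (auto simp: profiles_def)
  then show ?thesis using profile_nonempty profile_subset by blast
qed

lemma separable_locus_eq: "locus = {x \<in> Alg scale. separable_algebra scale x}"
proof -
  have "\<Delta> x \<noteq> 0 \<longleftrightarrow> separable_algebra scale x" if "x \<in> Alg scale" for x
  proof -
    interpret based_algebra scale n e x by unfold_locales (rule that)
    show ?thesis by (rule disc_iff_separable)
  qed
  then show ?thesis unfolding separable_locus_def by blast
qed

end

theorem theorem1p8:
  fixes scale :: "'k::field_char_0 \<Rightarrow> 'v::ab_group_add \<Rightarrow> 'v"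
    and n :: nat
    and e :: "nat \<Rightarrow> 'v"
  assumes "is_basis scale n e"
  shows
    "(finite {r. rank_stratum scale r \<noteq> {}} \<and>
      stratification scale n e (Alg scale) {r. rank_stratum scale r \<noteq> {}} (rank_stratum scale) \<and>
      determinantal scale n e (Alg scale) (rank_stratum scale))
   \<and> ((\<forall>x \<in> Alg scale. orbit scale x = iso_class scale x) \<and>
      refines (Alg scale) (orbit scale ` Alg scale)
        {rank_stratum scale r | r. rank_stratum scale r \<noteq> {}})
   \<and> (is_alg_closed TYPE('k) \<longrightarrow>
      finite (profiles n) \<and>
      stratification scale n e (separable_locus scale n e) (profiles n) (profile_stratum scale))
   \<and> (partition_on (separable_locus scale n e) (wedderburn_stratum scale ` wtypes n) \<and>
      (\<forall>W \<in> wtypes n. GL_stable scale (wedderburn_stratum scale W)) \<and>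
      (\<forall>W \<in> wtypes n. \<forall>W' \<in> wtypes n.
         wedderburn_stratum scale W = wedderburn_stratum scale W' \<longleftrightarrow> same_wtype W W'))
   \<and> (openin (zariski_Alg scale n e) (separable_locus scale n e) \<and>
      separable_locus scale n e \<noteq> {} \<and>
      separable_locus scale n e = {x \<in> Alg scale. separable_algebra scale x})"
proof -
  interpret based_space scale n e by unfold_locales (rule assms)
  show ?thesis
    using finite_rank_strata rank_stratification determinantal_rank orbit_eq_iso_class orbits_refine
      finite_profiles profile_stratification wedderburn_partition wedderburn_GL_stable
          wedderburn_eq_iff
      openin_separable_locus separable_locus_nonempty separable_locus_eq
    by (intro conjI ballI impI)
qed

end
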